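(* Let $r>0$ and let $H:\mathbb{R}\times\mathcal{P}_2\times\mathbb{R}\to\mathbb{R}$ be the Hamiltonian described in the context. Suppose that: (i) $H(x,\mu,y)$ is jointly continuous and all its second-order partial derivatives exist; (ii) there is a constant $\ell>0$ such that for all $(x,\mu,y),(x',\mu',y')\in\mathbb{R}\times\mathcal{P}_2\times\mathbb{R}$, $$|\partial_yH(x,\mu,y)-\partial_yH(x',\mu',y')|\le \ell\left(|x-x'|+|y-y'|+\mathcal{W}_2(\mu,\mu')\right),$$ $$|\partial_xH(x,\mu,y)-\partial_xH(x',\mu',y')|\le \ell\left(|x-x'|+|y-y'|+\mathcal{W}_2(\mu,\mu')\right);$$ (iii) there are constants $\kappa,C_0>0$ with $C_0+r/2<\kappa$ such that for all $(x,\mu,y),(x',\mu',y')$, $$-(x-x')\left[\partial_xH(x,\mu,y)-\partial_xH(x',\mu',y')\right]+(y-y')\left[\partial_yH(x,\mu,y)-\partial_yH(x',\mu',y')\right]\le-\kappa\left(|x-x'|^2+|y-y'|^2\right)+C_0\mathcal{W}_2^2(\mu,\mu').$$ Let $(X^{\xi},Y^{\xi},Z^{\xi})$ and $(X^{x,\xi},Y^{x,\xi},Z^{x,\xi})$ be the unique $L_r^2$ solutions of the two FBSDEs in the context. Then for any $\xi\in\mathbb{L}^2(\mathcal{F}_0)$, $$X_t^{x,\xi}|_{x=\xi}=X_t^{\xi},\qquad Y_t^{x,\xi}|_{x=\xi}=Y_t^{\xi}\qquad\text{for } dt\times d\mathbb{P}\text{-a.e. }(t,\omega),$$ and $$Y_0^{x,\xi}|_{x=\xi}=Y_0^{\xi}\qquad\text{for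 } d\mathbb{P}\text{-a.e. }\omega.$$
   Context: $(\Omega,\mathcal{F},\mathbb{P},\mathbb{F})$ is a filtered probability space with a real Brownian motion $B$; the filtration $\mathbb{F}=(\mathcal{F}_t)_{t\ge0}$ is that of $B$ augmented by all $\mathbb{P}$-null sets and a sub-$\sigma$-algebra $\mathcal{F}_0$ independent of $B$ and rich enough to support any probability measure on $\mathbb{R}$ with finite second moment. $\mathcal{P}_2$ is the set of probability measures on $\mathbb{R}$ with finite second moment, with the 2-Wasserstein distance $\mathcal{W}_2$; $\mathcal{L}_\xi$ is the law of $\xi$; $\mathbb{L}^2(\mathcal{F}_0)$ is the set of real $\mathcal{F}_0$-measurable square-integrable random variables. $L^2_r$ is the space of real adapted processes $v$ on $[0,\infty)$ with $\|v\|_r^2:=\mathbb{E}\left[\int_0^\infty e^{-rt}|v_t|^2dt\right]<\infty$. Hamiltonian: $H(x,\mu,y)=\min_{a\in\mathbb{R}}[b(x,\mu,a)y+f(x,\mu,a)]$, where $b(x,\mu,a)=b_0(x,\mu)+b_1(x,a)$ and $f(x,\mu,a)=f_0(x,\mu)+f_1(x,a)$ are real-valued; the minimizer $\hat\alpha(x,y)$ is unique, and $b,f$ are smooth enough that $\partial_yH(x,\mu,y)=b(x,\mu,\hat\alpha(x,y))$. FBSDEs on $[0,\infty)$, for $\xi\in\mathbb{L}^2(\mathcal{F}_0)$ and $x\in\mathbb{R}$: $$dX_t^{\xi}=\partial_yH(X_t^{\xi},\mathcal{L}_{X_t^{\xi}},Y_t^{\xi})dt+dB_t,\quad dY_t^{\xi}=-[\partial_xH(X_t^{\xi},\mathcal{L}_{X_t^{\xi}},Y_t^{\xi})-rY_t^{\xi}]dt+Z_t^{\xi}dB_t,\quad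 X_0^{\xi}=\xi,$$ $$dX_t^{x,\xi}=\partial_yH(X_t^{x,\xi},\mathcal{L}_{X_t^{\xi}},Y_t^{x,\xi})dt+dB_t,\quad dY_t^{x,\xi}=-[\partial_xH(X_t^{x,\xi},\mathcal{L}_{X_t^{\xi}},Y_t^{x,\xi})-rY_t^{x,\xi}]dt+Z_t^{x,\xi}dB_t,\quad X_0^{x,\xi}=x.$$ An $L_r^2$ solution is a triple of processes in $L_r^2$ satisfying the equations on every finite interval (no terminal condition is prescribed). Under (i)-(iii) both have unique solutions in $L_r^2$. $Y_0^{x,\xi}$ is a.s. constant and is regarded as a real number. $X_t^{x,\xi}|_{x=\xi}$ denotes the process $(t,\omega)\mapsto X_t^{\xi(\omega),\xi}(\omega)$ obtained by substituting $\xi(\omega)$ for the parameter $x$ in the family $(X^{x,\xi})_{x\in\mathbb{R}}$ (the second superscript $\xi$, entering only through $\mathcal{L}_{X^\xi_t}$, is unchanged), and similarly for $Y$. A version of the family that is jointly measurable in $(t,x,\omega)$ and, for the $\omega$-dependence, measurable with respect to the (augmented) $\sigma$-algebra generated by $B$, hence independent of $\mathcal{F}_0$, is used. *)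

theory Defs
  imports "HOL-Probability.Probability"
begin

section \<open>The Wasserstein space\<close>

definition P2 :: "real measure set" where
  "P2 = {\<mu>. prob_space \<mu> \<and> sets \<mu> = sets borel \<and> integrable \<mu> (\<lambda>x. x\<^sup>2)}"

definition couplings :: "real measure \<Rightarrow> real measure \<Rightarrow> (real \<times> real) measure set" where
  "couplings \<mu> \<nu> = {\<pi>. sets \<pi> = sets (borel \<Otimes>\<^sub>M borel) \<and> distr \<pi> borel fst = \<mu> \<and> distr \<pi> borel snd = \<nu>}"

text \<open>Only used for arguments in \<^const>\<open>P2\<close>; then the infimum is over a nonempty set of
  finite nonnegative integrals.\<close>

definition W2 :: "real measure \<Rightarrow> real measure \<Rightarrow> real" where
  "W2 \<mu> \<nu> = sqrt (INF \<pi>\<in>couplings \<mu> \<nu>. \<integral>z. \<bar>fst z - snd z\<bar>\<^sup>2 \<partial>\<pi>)"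


section \<open>Brownian motion and its enlarged filtration\<close>

text \<open>Processes are functions \<open>real \<Rightarrow> 'a \<Rightarrow> real\<close>; their values at negative times are irrelevant.\<close>

definition brownian_motion :: "'a measure \<Rightarrow> (real \<Rightarrow> 'a \<Rightarrow> real) \<Rightarrow> bool" where
  "brownian_motion M B \<longleftrightarrow>
     (\<forall>t\<ge>0. B t \<in> borel_measurable M) \<and>
     (AE \<omega> in M. B 0 \<omega> = 0) \<and>
     (\<forall>s t. 0 \<le> s \<longrightarrow> s < t \<longrightarrow>
        distributed M lborel (\<lambda>\<omega>. B t \<omega> - B s \<omega>) (normal_density 0 (sqrt (t - s)))) \<and>
     (\<forall>n (\<tau> :: nat \<Rightarrow> real). 0 \<le> \<tau> 0 \<longrightarrow> mono \<tau> \<longrightarrow>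
        prob_space.indep_vars M (\<lambda>_. borel) (\<lambda>i \<omega>. B (\<tau> (Suc i)) \<omega> - B (\<tau> i) \<omega>) {..<n}) \<and>
     (AE \<omega> in M. continuous_on {0..} (\<lambda>t. B t \<omega>))"

definition cylinders :: "'a measure \<Rightarrow> (real \<Rightarrow> 'a \<Rightarrow> real) \<Rightarrow> real set \<Rightarrow> 'a set set" where
  "cylinders M B T = {B s -` A \<inter> space M | s A. s \<in> T \<and> A \<in> sets borel}"

definition brownian_sigma :: "'a measure \<Rightarrow> (real \<Rightarrow> 'a \<Rightarrow> real) \<Rightarrow> 'a measure" where
  "brownian_sigma M B = sigma (space M) (cylinders M B {0..} \<union> null_sets M)"

text \<open>\<open>F0\<close> is the initial \<open>\<sigma>\<close>-algebra before augmentation; the \<open>\<sigma>\<close>-algebra at time \<open>0\<close> of the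
  filtration is \<open>filt M B F0 0\<close>, which also contains the null sets. No completeness of \<open>M\<close> is
  assumed.\<close>

definition filt :: "'a measure \<Rightarrow> (real \<Rightarrow> 'a \<Rightarrow> real) \<Rightarrow> 'a measure \<Rightarrow> real \<Rightarrow> 'a measure" where
  "filt M B F0 t = sigma (space M) (sets F0 \<union> cylinders M B {0..t} \<union> null_sets M)"

locale brownian_setup = prob_space M
  for M :: "'a measure" and B :: "real \<Rightarrow> 'a \<Rightarrow> real" and F0 :: "'a measure" +
  assumes brownian: "brownian_motion M B"
    and subalgebra_F0: "subalgebra M F0"
    and indep_F0: "indep_set (sets F0) (sigma_sets (space M) (cylinders M B {0..}))"
    and rich_F0: "\<mu> \<in> P2 \<Longrightarrow> \<exists>\<xi>\<in>borel_measurable F0. distr M borel \<xi> = \<mu>"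

definition L2 :: "'a measure \<Rightarrow> 'a measure \<Rightarrow> ('a \<Rightarrow> real) set" where
  "L2 M G = {\<xi> \<in> borel_measurable G. integrable M (\<lambda>\<omega>. (\<xi> \<omega>)\<^sup>2)}"

abbreviation time_axis :: "real measure" where
  "time_axis \<equiv> restrict_space lborel {0..}"

text \<open>The space \<open>L\<^sup>2\<^sub>r\<close>; joint measurability in \<open>(t, \<omega>)\<close> is implicit in forming the norm.\<close>

definition Lr2 ::
  "'a measure \<Rightarrow> (real \<Rightarrow> 'a measure) \<Rightarrow> real \<Rightarrow> (real \<Rightarrow> 'a \<Rightarrow> real) set" where
  "Lr2 M F r = {v.
     (\<lambda>(t, \<omega>). v t \<omega>) \<in> borel_measurable (time_axis \<Otimes>\<^sub>M M) \<and>
     (\<forall>t\<ge>0. v t \<in> borel_measurable (F t)) \<and>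
     (\<integral>\<^sup>+\<omega>. (\<integral>\<^sup>+t. ennreal (exp (- r * t) * \<bar>v t \<omega>\<bar>\<^sup>2) \<partial>time_axis) \<partial>M) < \<infinity>}"


section \<open>The Ito integral\<close>

text \<open>\<open>(n, \<tau>, \<eta>)\<close> encodes the simple integrand that equals \<open>\<eta> i\<close> on \<open>(\<tau> i, \<tau> (i + 1)]\<close> for \<open>i < n\<close>
  and vanishes elsewhere.\<close>

type_synonym 'a simple_integrand = "nat \<times> (nat \<Rightarrow> real) \<times> (nat \<Rightarrow> 'a \<Rightarrow> real)"

fun is_simple :: "'a measure \<Rightarrow> (real \<Rightarrow> 'a measure) \<Rightarrow> 'a simple_integrand \<Rightarrow> bool" where
  "is_simple M F (n, \<tau>, \<eta>) \<longleftrightarrow>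
     0 \<le> \<tau> 0 \<and> mono \<tau> \<and>
     (\<forall>i<n. \<eta> i \<in> borel_measurable (F (\<tau> i)) \<and> (\<exists>C. \<forall>\<omega>\<in>space M. \<bar>\<eta> i \<omega>\<bar> \<le> C))"

fun simple_eval :: "'a simple_integrand \<Rightarrow> real \<Rightarrow> 'a \<Rightarrow> real" where
  "simple_eval (n, \<tau>, \<eta>) t \<omega> = (\<Sum>i<n. \<eta> i \<omega> * indicator {\<tau> i<..\<tau> (Suc i)} t)"

fun simple_ito :: "(real \<Rightarrow> 'a \<Rightarrow> real) \<Rightarrow> 'a simple_integrand \<Rightarrow> real \<Rightarrow> 'a \<Rightarrow> real" where
  "simple_ito B (n, \<tau>, \<eta>) t \<omega> = (\<Sum>i<n. \<eta> i \<omega> * (B (min t (\<tau> (Suc i))) \<omega> - B (min t (\<tau> i)) \<omega>))"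

text \<open>\<open>I\<close> is a continuous adapted version of the process \<open>t \<mapsto> \<integral>\<^sub>0\<^sup>t Z\<^sub>s dB\<^sub>s\<close>, the integral being the
  \<open>L\<^sup>2\<close>-limit of the integrals of simple integrands that converge to \<open>Z\<close> in \<open>L\<^sup>2([0,T] \<times> \<Omega>)\<close>. It is
  determined by \<open>Z\<close> up to indistinguishability.\<close>

definition has_ito_integral ::
  "'a measure \<Rightarrow> (real \<Rightarrow> 'a measure) \<Rightarrow> (real \<Rightarrow> 'a \<Rightarrow> real) \<Rightarrow>
   (real \<Rightarrow> 'a \<Rightarrow> real) \<Rightarrow> (real \<Rightarrow> 'a \<Rightarrow> real) \<Rightarrow> bool" where
  "has_ito_integral M F B Z I \<longleftrightarrow>
     (\<forall>t\<ge>0. I t \<in> borel_measurable (F t)) \<and>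
     (AE \<omega> in M. continuous_on {0..} (\<lambda>t. I t \<omega>)) \<and>
     (\<forall>T\<ge>0. \<exists>S :: nat \<Rightarrow> 'a simple_integrand.
        (\<forall>k. is_simple M F (S k)) \<and>
        (\<lambda>k. \<integral>\<^sup>+\<omega>. (\<integral>\<^sup>+t\<in>{0..T}. ennreal ((Z t \<omega> - simple_eval (S k) t \<omega>)\<^sup>2) \<partial>lborel) \<partial>M)
          \<longlonglongrightarrow> 0 \<and>
        (\<lambda>k. \<integral>\<^sup>+\<omega>. ennreal ((I T \<omega> - simple_ito B (S k) T \<omega>)\<^sup>2) \<partial>M) \<longlonglongrightarrow> 0)"


section \<open>The Hamiltonian\<close>

definition separated ::
  "(real \<Rightarrow> real measure \<Rightarrow> real) \<Rightarrow> (real \<Rightarrow> real \<Rightarrow> real) \<Rightarrow> real \<Rightarrow> real measure \<Rightarrow> real \<Rightarrow> real" where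
  "separated g0 g1 x \<mu> a = g0 x \<mu> + g1 x a"

text \<open>\<open>H x \<mu> y = min\<^sub>a [b x \<mu> a * y + f x \<mu> a]\<close>, the minimum being attained exactly at
  \<open>a = \<alpha> x y\<close>, together with \<open>\<partial>\<^sub>y H x \<mu> y = b x \<mu> (\<alpha> x y)\<close>. Measure arguments range over
  \<^const>\<open>P2\<close> only.\<close>

definition is_hamiltonian ::
  "(real \<Rightarrow> real measure \<Rightarrow> real \<Rightarrow> real) \<Rightarrow> (real \<Rightarrow> real measure \<Rightarrow> real \<Rightarrow> real) \<Rightarrow>
   (real \<Rightarrow> real \<Rightarrow> real) \<Rightarrow> (real \<Rightarrow> real measure \<Rightarrow> real \<Rightarrow> real) \<Rightarrow> bool" where
  "is_hamiltonian b f \<alpha> H \<longleftrightarrow>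
     (\<forall>x. \<forall>\<mu>\<in>P2. \<forall>y.
        H x \<mu> y = b x \<mu> (\<alpha> x y) * y + f x \<mu> (\<alpha> x y) \<and>
        (\<forall>a. a \<noteq> \<alpha> x y \<longrightarrow> H x \<mu> y < b x \<mu> a * y + f x \<mu> a) \<and>
        ((\<lambda>y'. H x \<mu> y') has_real_derivative b x \<mu> (\<alpha> x y)) (at y))"

definition partial_x ::
  "(real \<Rightarrow> real measure \<Rightarrow> real \<Rightarrow> real) \<Rightarrow> real \<Rightarrow> real measure \<Rightarrow> real \<Rightarrow> real" where
  "partial_x H x \<mu> y = deriv (\<lambda>x'. H x' \<mu> y) x"

definition partial_y ::
  "(real \<Rightarrow> real measure \<Rightarrow> real \<Rightarrow> real) \<Rightarrow> real \<Rightarrow> real measure \<Rightarrow> real \<Rightarrow> real" where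
  "partial_y H x \<mu> y = deriv (\<lambda>y'. H x \<mu> y') y"

definition jointly_continuous :: "(real \<Rightarrow> real measure \<Rightarrow> real \<Rightarrow> real) \<Rightarrow> bool" where
  "jointly_continuous H \<longleftrightarrow>
     (\<forall>x. \<forall>\<mu>\<in>P2. \<forall>y. \<forall>e>0. \<exists>d>0. \<forall>x'. \<forall>\<mu>'\<in>P2. \<forall>y'.
        \<bar>x' - x\<bar> < d \<longrightarrow> W2 \<mu>' \<mu> < d \<longrightarrow> \<bar>y' - y\<bar> < d \<longrightarrow> \<bar>H x' \<mu>' y' - H x \<mu> y\<bar> < e)"

text \<open>Partial derivatives are those with respect to the real variables \<open>x\<close> and \<open>y\<close>. Existence of the
  second-order ones presupposes that of the first-order ones.\<close>

definition partials_exist :: "(real \<Rightarrow> real measure \<Rightarrow> real \<Rightarrow> real) \<Rightarrow> bool" where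
  "partials_exist G \<longleftrightarrow>
     (\<forall>x. \<forall>\<mu>\<in>P2. \<forall>y. (\<lambda>x'. G x' \<mu> y) field_differentiable (at x) \<and>
                        (\<lambda>y'. G x \<mu> y') field_differentiable (at y))"

definition second_partials_exist :: "(real \<Rightarrow> real measure \<Rightarrow> real \<Rightarrow> real) \<Rightarrow> bool" where
  "second_partials_exist H \<longleftrightarrow>
     partials_exist H \<and> partials_exist (partial_x H) \<and> partials_exist (partial_y H)"


section \<open>The forward-backward equations\<close>

text \<open>\<open>L\<^sup>2\<^sub>r\<close> solutions of
    \<open>dX = \<partial>\<^sub>y H(X, m, Y) dt + dB\<close>, \<open>dY = -[\<partial>\<^sub>x H(X, m, Y) - r Y] dt + Z dB\<close>, \<open>X\<^sub>0 = \<xi>\<close>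
  on \<open>[0,\<infinity>)\<close> along a flow of laws \<open>m\<close>. The equations hold almost surely for all times simultaneously,
  so \<open>X\<close> and \<open>Y\<close> have almost surely continuous paths and \<open>Y\<^sub>0\<close> is meaningful. The flow enters only
  under \<open>ds\<close>, and \<open>law (X\<^sub>s)\<close> lies in \<^const>\<open>P2\<close> for almost every \<open>s\<close> since \<open>X \<in> L\<^sup>2\<^sub>r\<close>.\<close>

definition fbsde_solution ::
  "'a measure \<Rightarrow> (real \<Rightarrow> 'a \<Rightarrow> real) \<Rightarrow> (real \<Rightarrow> 'a measure) \<Rightarrow> real \<Rightarrow>
   (real \<Rightarrow> real measure \<Rightarrow> real \<Rightarrow> real) \<Rightarrow> (real \<Rightarrow> real measure) \<Rightarrow> ('a \<Rightarrow> real) \<Rightarrow>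
   (real \<Rightarrow> 'a \<Rightarrow> real) \<Rightarrow> (real \<Rightarrow> 'a \<Rightarrow> real) \<Rightarrow> (real \<Rightarrow> 'a \<Rightarrow> real) \<Rightarrow> bool" where
  "fbsde_solution M B F r H m \<xi> X Y Z \<longleftrightarrow>
     X \<in> Lr2 M F r \<and> Y \<in> Lr2 M F r \<and> Z \<in> Lr2 M F r \<and>
     (\<exists>I. has_ito_integral M F B Z I \<and>
       (AE \<omega> in M. \<forall>t\<ge>0.
          set_integrable lborel {0..t} (\<lambda>s. partial_y H (X s \<omega>) (m s) (Y s \<omega>)) \<and>
          set_integrable lborel {0..t} (\<lambda>s. partial_x H (X s \<omega>) (m s) (Y s \<omega>) - r * Y s \<omega>) \<and>
          X t \<omega> = \<xi> \<omega> + (LBINT s:{0..t}. partial_y H (X s \<omega>) (m s) (Y s \<omega>)) + B t \<omega> \<and>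
          Y t \<omega> = Y 0 \<omega> - (LBINT s:{0..t}. partial_x H (X s \<omega>) (m s) (Y s \<omega>) - r * Y s \<omega>) + I t \<omega>))"

definition law_flow :: "'a measure \<Rightarrow> (real \<Rightarrow> 'a \<Rightarrow> real) \<Rightarrow> real \<Rightarrow> real measure" where
  "law_flow M X s = distr M borel (X s)"

text \<open>A parametrised family \<open>V x t \<omega>\<close> that is jointly measurable in \<open>(t, x, \<omega>)\<close>, where \<open>\<Omega>\<close> carries the
  augmented Brownian \<open>\<sigma>\<close>-algebra. It is essential that this \<open>\<sigma>\<close>-algebra enters the product: joint
  measurability over \<open>M\<close> with \<^const>\<open>brownian_sigma\<close>-measurable sections would permit changing each
  \<open>V x\<close> on the null set \<open>{\<xi> = x}\<close>, which alters the substitution \<open>x = \<xi>\<close>.\<close>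

definition brownian_measurable_family ::
  "'a measure \<Rightarrow> (real \<Rightarrow> 'a \<Rightarrow> real) \<Rightarrow> (real \<Rightarrow> real \<Rightarrow> 'a \<Rightarrow> real) \<Rightarrow> bool" where
  "brownian_measurable_family M B V \<longleftrightarrow>
     (\<lambda>(t, x, \<omega>). V x t \<omega>) \<in> borel_measurable (time_axis \<Otimes>\<^sub>M (borel \<Otimes>\<^sub>M brownian_sigma M B))"

text \<open>The real number with which an almost surely constant random variable is identified.\<close>

definition as_constant :: "'a measure \<Rightarrow> ('a \<Rightarrow> real) \<Rightarrow> real" where
  "as_constant M V = (THE c. AE \<omega> in M. V \<omega> = c)"

end

theory Submission
  imports Defs
begin

text \<open>Let \<open>x\<close>, \<open>y\<close> be the differences of the \<open>X\<close>- and \<open>Y\<close>-components of two solutions along the same flow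
  of laws. The process \<open>x\<close> has no martingale part, so \<open>E[x\<^sub>T y\<^sub>T]\<close> can be computed from
  integration by parts and the orthogonality of Ito increments to the past; monotonicity makes
  \<open>e\<^sup>-\<^sup>r\<^sup>T E[x\<^sub>T y\<^sub>T]\<close> decreasing, and as it is integrable in \<open>T\<close> it is nonnegative. This bounds the
  weighted \<open>L\<^sup>2\<close> norm of \<open>(x, y)\<close> by a multiple of that of the difference of the initial values, and the
  bound may be localized to any event of the initial \<open>\<sigma>\<close>-algebra.

  For the substitution, cut \<open>\<Omega>\<close> into the slabs \<open>{k\<delta> \<le> \<xi> < (k + 1)\<delta>}\<close>. On each slab \<open>X\<^sup>\<xi>\<close> is compared
  with \<open>X\<close> started at \<open>k\<delta>\<close> by the localized bound, and so is the substituted process, after conditioning on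
  \<open>\<xi>\<close>, which is independent of the Brownian \<open>\<sigma>\<close>-algebra. Summing over \<open>k\<close> and letting \<open>\<delta> \<rightarrow> 0\<close> gives
  the claim. No adaptedness or integrability of the substituted process is needed beforehand.\<close>

section \<open>Independence of Brownian increments from the past\<close>

text \<open>The tempting proof checks that the substituted triple solves the equation started at
  \<open>\<xi>\<close> and then quotes uniqueness. It founders on the stochastic integral: nothing
  is known about how \<open>Zx x\<close> depends on \<open>x\<close>, so the substituted integrand
  cannot be integrated. Estimates between solutions with nearby initial values never meet it. The
  solutions compared follow one and the same flow of laws, so the Wasserstein terms of the
  hypotheses vanish and the differences obey classical Lipschitz and strict monotonicity bounds. No
  terminal value is prescribed; its place is taken by the sign of the discounted product at late
  times. There are infinitely many slabs, so the bound on each must be proportional to its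
  probability. This is possible because the indicator of an initial event can be moved into the
  variable against which the martingale part is tested. The statement at time 0 needs its own
  argument, since a null set of times may contain 0: \<open>Y 0\<close> is tied to later times by
  averaging the martingale identity over \<open>[0,1]\<close>. The localized bound is then of order
  \<open>\<delta>\<close>, against the square of \<open>\<delta>\<close> for the paths; either
  suffices.\<close>

lemma sigma_sets_AE_eq:
  assumes A: "A \<in> sigma_sets (space M) \<A>" and S: "sigma_algebra (space M) \<S>"
    and gen: "\<And>a. a \<in> \<A> \<Longrightarrow> \<exists>a'\<in>\<S>. AE \<omega> in M. \<omega> \<in> a \<longleftrightarrow> \<omega> \<in> a'"
  shows "\<exists>A'\<in>\<S>. AE \<omega> in M. \<omega> \<in> A \<longleftrightarrow> \<omega> \<in> A'"
proof -
  interpret S: sigma_algebra "space M" \<S> by fact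
  show ?thesis using A
  proof induction
    case (Basic a)
    then show ?case by (rule gen)
  next
    case Empty
    show ?case by (rule bexI[of _ "{}"]) auto
  next
    case (Compl a)
    then obtain a' where "a' \<in> \<S>" "AE \<omega> in M. \<omega> \<in> a \<longleftrightarrow> \<omega> \<in> a'" by blast
    then show ?case
      by (intro bexI[of _ "space M - a'"]) auto
  next
    case (Union a)
    then obtain a' where a': "\<And>i. a' i \<in> \<S>" "\<And>i. AE \<omega> in M. \<omega> \<in> a i \<longleftrightarrow> \<omega> \<in> a' i" by metis
    then have "AE \<omega> in M. \<forall>i::nat. \<omega> \<in> a i \<longleftrightarrow> \<omega> \<in> a' i" by (simp add: AE_all_countable)
    then have "AE \<omega> in M. \<omega> \<in> (\<Union>i. a i) \<longleftrightarrow> \<omega> \<in> (\<Union>i. a' i)"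
      by eventually_elim auto
    moreover have "(\<Union>i. a' i) \<in> \<S>" using a' by auto
    ultimately show ?case by blast
  qed
qed

section \<open>Independence modulo null sets\<close>

context prob_space
begin

lemma indep_set_events: "indep_set \<S> \<T> \<Longrightarrow> \<S> \<subseteq> events \<and> \<T> \<subseteq> events"
  by (auto simp: indep_set_def indep_sets_def split: bool.splits)

lemma indep_set_subsets:
  assumes ind: "indep_set \<S> \<T>" and sub: "\<A> \<subseteq> \<S>" "\<C> \<subseteq> \<T>"
  shows "indep_set \<A> \<C>"
proof (rule indep_setI)
  show "\<A> \<subseteq> events" "\<C> \<subseteq> events" using indep_set_events[OF ind] sub by blast+
  show "prob (a \<inter> c) = prob a * prob c" if "a \<in> \<A>" "c \<in> \<C>" for a c
    using that sub by (intro indep_setD[OF ind]) auto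
qed

text \<open>Independence sees events only up to null sets. Through this lemma the augmentations of
  the filtration and of the Brownian sigma-algebra reduce to their unaugmented counterparts.\<close>

lemma indep_set_AE_eq:
  assumes ind: "indep_set \<S> \<T>"
    and ev: "\<A> \<subseteq> events" "\<C> \<subseteq> events"
    and A: "\<And>a. a \<in> \<A> \<Longrightarrow> \<exists>a'\<in>\<S>. AE \<omega> in M. \<omega> \<in> a \<longleftrightarrow> \<omega> \<in> a'"
    and C: "\<And>a. a \<in> \<C> \<Longrightarrow> \<exists>a'\<in>\<T>. AE \<omega> in M. \<omega> \<in> a \<longleftrightarrow> \<omega> \<in> a'"
  shows "indep_set \<A> \<C>"
proof (rule indep_setI[OF ev])
  fix a c assume ac: "a \<in> \<A>" "c \<in> \<C>"
  obtain a' where a': "a' \<in> \<S>" "AE \<omega> in M. \<omega> \<in> a \<longleftrightarrow> \<omega> \<in> a'" using A ac by blast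
  obtain c' where c': "c' \<in> \<T>" "AE \<omega> in M. \<omega> \<in> c \<longleftrightarrow> \<omega> \<in> c'" using C ac by blast
  have S: "\<S> \<subseteq> events" "\<T> \<subseteq> events"
    using indep_set_events[OF ind] by auto
  have "prob (a \<inter> c) = prob (a' \<inter> c')"
    using a' c' ac ev S by (intro finite_measure_eq_AE) auto
  also have "\<dots> = prob a' * prob c'" using indep_setD[OF ind] a' c' by blast
  also have "prob a' = prob a" using a' ac ev S by (intro finite_measure_eq_AE) auto
  also have "prob c' = prob c" using c' ac ev S by (intro finite_measure_eq_AE) auto
  finally show "prob (a \<inter> c) = prob a * prob c" .
qed

text \<open>The preimages under one variable already form a sigma-algebra, so the
  \<open>sigma_sets\<close> in \<open>indep_var_eq\<close> add nothing and it is enough that the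
  preimages lie in two independent families.\<close>

lemma indep_var_of_indep_set:
  assumes ind: "indep_set \<S> \<T>"
    and X: "X \<in> measurable M N1" "\<And>A. A \<in> sets N1 \<Longrightarrow> X -` A \<inter> space M \<in> \<S>"
    and Y: "Y \<in> measurable M N2" "\<And>A. A \<in> sets N2 \<Longrightarrow> Y -` A \<inter> space M \<in> \<T>"
  shows "indep_var N1 X N2 Y"
proof -
  have sX: "sigma_sets (space M) {X -` A \<inter> space M | A. A \<in> sets N1} = {X -` A \<inter> space M | A. A \<in> sets N1}"
    using sigma_sets_vimage_commute[of X "space M" "space N1" "sets N1"] X(1)
    by (auto simp: sets.sigma_sets_eq measurable_def)
  have sY: "sigma_sets (space M) {Y -` A \<inter> space M | A. A \<in> sets N2} = {Y -` A \<inter> space M | A. A \<in> sets N2}"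
    using sigma_sets_vimage_commute[of Y "space M" "space N2" "sets N2"] Y(1)
    by (auto simp: sets.sigma_sets_eq measurable_def)
  show ?thesis
    unfolding indep_var_eq sX sY
    using X Y ind by (auto simp: indep_sets2_eq indep_set_def[symmetric] intro!: indep_setI dest: indep_setD measurable_sets)
qed

end

text \<open>Finite-dimensional cylinders are the pi-system generating the past of \<open>B\<close>.
  In an intersection the constraints at common indices are intersected and all others are kept,
  which is what \<open>?A\<close> encodes.\<close>

lemma Int_stable_finite_vimage_Inter:
  fixes B :: "'c \<Rightarrow> 'a \<Rightarrow> 'd"
  shows "Int_stable {{\<omega>\<in>\<Omega>. \<forall>j\<in>J. B j \<omega> \<in> A j} | J A. finite J \<and> J \<subseteq> T \<and> (\<forall>j\<in>J. A j \<in> sets N)}"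
proof (rule Int_stableI, clarsimp)
  fix J J' :: "'c set" and A A' :: "'c \<Rightarrow> 'd set"
  assume *: "finite J" "J \<subseteq> T" "\<forall>j\<in>J. A j \<in> sets N" "finite J'" "J' \<subseteq> T" "\<forall>j\<in>J'. A' j \<in> sets N"
  let ?A = "\<lambda>j. if j \<in> J then if j \<in> J' then A j \<inter> A' j else A j else A' j"
  have "{\<omega> \<in> \<Omega>. \<forall>j\<in>J. B j \<omega> \<in> A j} \<inter> {\<omega> \<in> \<Omega>. \<forall>j\<in>J'. B j \<omega> \<in> A' j} = {\<omega> \<in> \<Omega>. \<forall>j\<in>J \<union> J'. B j \<omega> \<in> ?A j}"
    by (auto split: if_splits)
  then show "\<exists>J'' A''.
          {\<omega> \<in> \<Omega>. \<forall>j\<in>J. B j \<omega> \<in> A j} \<inter> {\<omega> \<in> \<Omega>. \<forall>j\<in>J'. B j \<omega> \<in> A' j} =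
          {\<omega> \<in> \<Omega>. \<forall>j\<in>J''. B j \<omega> \<in> A'' j} \<and>
          finite J'' \<and> J'' \<subseteq> T \<and> (\<forall>j\<in>J''. A'' j \<in> sets N)"
    using * by (intro exI[of _ "J \<union> J'"] exI[of _ ?A]) auto
qed

text \<open>\<open>brownian_motion\<close> only provides independence of the increments along one
  partition. A finite-dimensional cylinder up to time \<open>s\<close> becomes an event about the
  increments of a partition of \<open>[0, s]\<close>, to which \<open>B u - B s\<close> is adjoined
  as one more increment; pi-lambda extends this to the generated sigma-algebras.\<close>

lemma brownian_indep_past:
  assumes "prob_space M" and bm: "brownian_motion M B" and s: "0 \<le> s" "s \<le> u"
  shows "prob_space.indep_set M (sigma_sets (space M) (cylinders M B {0..s}))
           {(\<lambda>\<omega>. B u \<omega> - B s \<omega>) -` A \<inter> space M | A. A \<in> sets borel}"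
proof -
  interpret prob_space M by fact
  let ?\<C> = "{{\<omega>\<in>space M. \<forall>j\<in>J. B j \<omega> \<in> A j} | J A. finite J \<and> J \<subseteq> {0..s} \<and> (\<forall>j\<in>J. A j \<in> sets (borel :: real measure))}"
  let ?\<D> = "{(\<lambda>\<omega>. B u \<omega> - B s \<omega>) -` A \<inter> space M | A. A \<in> sets borel}"
  have meas[measurable]: "t \<ge> 0 \<Longrightarrow> B t \<in> borel_measurable M" for t
    using bm by (auto simp: brownian_motion_def)
  have B0: "AE \<omega> in M. B 0 \<omega> = 0" using bm by (auto simp: brownian_motion_def)
  have ind: "indep_vars (\<lambda>_. borel) (\<lambda>i \<omega>. B (\<tau> (Suc i)) \<omega> - B (\<tau> i) \<omega>) {..<n}"
    if "0 \<le> \<tau> 0" "mono \<tau>" for n \<tau>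
    using bm that by (auto simp: brownian_motion_def)
  have Cev: "?\<C> \<subseteq> events"
  proof clarify
    fix J and A :: "real \<Rightarrow> real set" assume J: "finite J" "J \<subseteq> {0..s}" "\<forall>j\<in>J. A j \<in> sets borel"
    then have *: "B j -` A j \<inter> space M \<in> events" if "j \<in> J" for j
      using that by (intro measurable_sets[OF meas]) auto
    then have "space M \<inter> (\<Inter>j\<in>J. B j -` A j \<inter> space M) \<in> events" if "J \<noteq> {}"
      using J that * by (intro sets.Int[OF sets.top sets.finite_INT]) blast+
    moreover have "{\<omega>\<in>space M. \<forall>j\<in>J. B j \<omega> \<in> A j} = (if J = {} then space M else space M \<inter> (\<Inter>j\<in>J. B j -` A j \<inter> space M))"
      by auto
    ultimately show "{\<omega>\<in>space M. \<forall>j\<in>J. B j \<omega> \<in> A j} \<in> events" by auto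
  qed
  have Dev: "?\<D> \<subseteq> events" using s by auto
  have base: "indep_set ?\<C> ?\<D>"
  proof (rule indep_setI[OF Cev Dev], clarify)
    fix J and A :: "real \<Rightarrow> real set" and D :: "real set"
    assume J: "finite J" "J \<subseteq> {0..s}" "\<forall>j\<in>J. A j \<in> sets borel" and D: "D \<in> sets borel"
    \<comment> \<open>The point 0 makes every value of \<open>B\<close> a sum of increments, as
      \<open>B 0\<close> vanishes almost surely; the point \<open>s\<close> makes the final
      increment exactly \<open>B u - B s\<close>.\<close>
    define xs where "xs = sorted_list_of_set (J \<union> {0, s})"
    have xs: "sorted xs" "set xs = J \<union> {0,s}" unfolding xs_def using J by (simp_all del: sorted_list_of_set_insert_remove)
    \<comment> \<open>Past the end of the list the partition stays at \<open>u\<close>, so it is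
      monotone on all of \<open>nat\<close> and its step from \<open>n\<close> to
      \<open>Suc n\<close> leads from \<open>s\<close> to \<open>u\<close>.\<close>
    define \<tau> where "\<tau> i = (if i < length xs then xs ! i else u)" for i
    have ne: "xs \<noteq> []" using xs by auto
    define n where "n = length xs - 1"
    have len: "length xs = Suc n" using ne by (simp add: n_def)
    have bnd: "y \<le> u \<and> 0 \<le> y \<and> y \<le> s" if "y \<in> set xs" for y using that xs J s by auto
    have mono: "mono \<tau>"
    proof (rule monoI)
      fix i j :: nat assume "i \<le> j"
      then show "\<tau> i \<le> \<tau> j" using xs(1) bnd[OF nth_mem] by (auto simp: \<tau>_def sorted_nth_mono)
    qed
    have hd0: "\<tau> 0 = 0"
    proof -
      obtain k where k: "k < length xs" "xs ! k = 0" using xs(2) by (metis Un_iff in_set_conv_nth insertI1)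
      have "xs ! 0 \<le> xs ! k" using k xs by (intro sorted_nth_mono) auto
      moreover have "0 \<le> xs ! 0" using bnd[of "xs ! 0"] ne by (auto simp: nth_mem)
      ultimately show ?thesis using k ne by (auto simp: \<tau>_def)
    qed
    have last: "\<tau> n = s"
    proof -
      obtain k where k: "k < length xs" "xs ! k = s" using xs(2) by (metis Un_iff in_set_conv_nth insertCI)
      have "xs ! k \<le> xs ! n" using k xs len by (intro sorted_nth_mono) auto
      moreover have "xs ! n \<le> s" using bnd[of "xs ! n"] len by (auto simp: nth_mem)
      ultimately show ?thesis using k len by (auto simp: \<tau>_def)
    qed
    have lst: "\<tau> (Suc n) = u" using len by (simp add: \<tau>_def)
    define \<Delta> where "\<Delta> i \<omega> = B (\<tau> (Suc i)) \<omega> - B (\<tau> i) \<omega>" for i \<omega>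
    have iv: "indep_vars (\<lambda>_. borel) \<Delta> {..<Suc n}"
      using ind[OF _ mono, of "Suc n"] hd0 unfolding \<Delta>_def by simp
    \<comment> \<open>Disjoint blocks of an independent family are independent: the first
      \<open>n\<close> increments against the last one.\<close>
    have ivr: "indep_var (PiM {..<n} (\<lambda>_. borel)) (\<lambda>\<omega>. restrict (\<lambda>i. \<Delta> i \<omega>) {..<n})
                 (PiM {n} (\<lambda>_. borel)) (\<lambda>\<omega>. restrict (\<lambda>i. \<Delta> i \<omega>) {n})"
      using iv by (rule indep_var_restrict) auto
    define idx where "idx j = (SOME i. i \<le> n \<and> \<tau> i = j)" for j
    have idx: "idx j \<le> n \<and> \<tau> (idx j) = j" if "j \<in> J" for j
    proof -
      have "j \<in> set xs" using that xs by auto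
      then obtain i where "i < length xs" "xs ! i = j" by (metis in_set_conv_nth)
      then have "i \<le> n \<and> \<tau> i = j" using len by (auto simp: \<tau>_def)
      then show ?thesis unfolding idx_def by (rule someI)
    qed
    \<comment> \<open>The cylinder expressed through partial sums of increments. It agrees with the
      original event where \<open>B 0\<close> is 0, hence only almost surely, which is all that the
      comparison of probabilities requires.\<close>
    define V where "V = {v \<in> space (PiM {..<n} (\<lambda>_. borel :: real measure)). \<forall>j\<in>J. (\<Sum>k<idx j. v k) \<in> A j}"
    have V: "V \<in> sets (PiM {..<n} (\<lambda>_. borel))"
    proof -
      have "{v \<in> space (PiM {..<n} (\<lambda>_. borel :: real measure)). (\<Sum>k<idx j. v k) \<in> A j} \<in> sets (PiM {..<n} (\<lambda>_. borel))"
        if "j \<in> J" for j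
      proof -
        have "(\<lambda>v. (\<Sum>k<idx j. v k)) \<in> borel_measurable (PiM {..<n} (\<lambda>_. borel :: real measure))"
          using idx[OF that] by (intro borel_measurable_sum measurable_component_singleton) auto
        then show ?thesis using J that
          by (auto simp: vimage_def Int_def conj_commute dest!: measurable_sets)
      qed
      then show ?thesis unfolding V_def using J by (intro sets.sets_Collect_finite_All) auto
    qed
    define W where "W = {v \<in> space (PiM {n} (\<lambda>_. borel :: real measure)). v n \<in> D}"
    have W: "W \<in> sets (PiM {n} (\<lambda>_. borel))"
      unfolding W_def using D by measurable
    let ?Z1 = "(\<lambda>\<omega>. restrict (\<lambda>i. \<Delta> i \<omega>) {..<n}) -` V \<inter> space M"
    let ?Z2 = "(\<lambda>\<omega>. restrict (\<lambda>i. \<Delta> i \<omega>) {n}) -` W \<inter> space M"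
    have Z2: "?Z2 = (\<lambda>\<omega>. B u \<omega> - B s \<omega>) -` D \<inter> space M"
      by (auto simp: W_def \<Delta>_def last lst space_PiM)
    have tele: "(\<Sum>k<i. \<Delta> k \<omega>) = B (\<tau> i) \<omega> - B 0 \<omega>" for i \<omega>
      unfolding \<Delta>_def by (subst sum_lessThan_telescope) (simp add: hd0)
    have Z1: "AE \<omega> in M. \<omega> \<in> {\<omega>\<in>space M. \<forall>j\<in>J. B j \<omega> \<in> A j} \<longleftrightarrow> \<omega> \<in> ?Z1"
      using B0 AE_space
    proof eventually_elim
      case (elim \<omega>)
      have "(\<Sum>k<idx j. restrict (\<lambda>i. \<Delta> i \<omega>) {..<n} k) = B j \<omega>" if "j \<in> J" for j
      proof -
        have "(\<Sum>k<idx j. restrict (\<lambda>i. \<Delta> i \<omega>) {..<n} k) = (\<Sum>k<idx j. \<Delta> k \<omega>)"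
          using idx[OF that] by (intro sum.cong) auto
        then show ?thesis using idx[OF that] elim by (simp add: tele)
      qed
      then show ?case using elim by (auto simp: V_def space_PiM simp del: restrict_apply)
    qed
    have Z1e: "?Z1 \<in> events"
      using V indep_var_rv1[OF ivr] by (rule measurable_sets[rotated])
    have Ce: "{\<omega>\<in>space M. \<forall>j\<in>J. B j \<omega> \<in> A j} \<in> events" using Cev J by blast
    have Z2e: "?Z2 \<in> events" using W indep_var_rv2[OF ivr] by (rule measurable_sets[rotated])
    have "prob ({\<omega>\<in>space M. \<forall>j\<in>J. B j \<omega> \<in> A j} \<inter> ?Z2) = prob (?Z1 \<inter> ?Z2)"
      using Z1 Ce Z1e Z2e by (intro finite_measure_eq_AE) auto
    also have "?Z1 \<inter> ?Z2 = (\<lambda>\<omega>. (restrict (\<lambda>i. \<Delta> i \<omega>) {..<n}, restrict (\<lambda>i. \<Delta> i \<omega>) {n})) -` (V \<times> W) \<inter> space M"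
      by auto
    also have "prob \<dots> = prob ?Z1 * prob ?Z2"
      using indep_varD[OF ivr V W] .
    also have "prob ?Z1 = prob {\<omega>\<in>space M. \<forall>j\<in>J. B j \<omega> \<in> A j}"
      using Z1 Ce Z1e by (intro finite_measure_eq_AE) auto
    finally show "prob ({\<omega>\<in>space M. \<forall>j\<in>J. B j \<omega> \<in> A j} \<inter> ((\<lambda>\<omega>. B u \<omega> - B s \<omega>) -` D \<inter> space M)) =
       prob {\<omega>\<in>space M. \<forall>j\<in>J. B j \<omega> \<in> A j} * prob ((\<lambda>\<omega>. B u \<omega> - B s \<omega>) -` D \<inter> space M)"
      unfolding Z2 .
  qed
  have "Int_stable ?\<D>"
  proof (rule Int_stableI, clarify)
    fix D D' :: "real set" assume "D \<in> sets borel" "D' \<in> sets borel"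
    then show "\<exists>A. ((\<lambda>\<omega>. B u \<omega> - B s \<omega>) -` D \<inter> space M) \<inter> ((\<lambda>\<omega>. B u \<omega> - B s \<omega>) -` D' \<inter> space M)
       = (\<lambda>\<omega>. B u \<omega> - B s \<omega>) -` A \<inter> space M \<and> A \<in> sets borel"
      by (intro exI[of _ "D \<inter> D'"]) auto
  qed
  then have "indep_set (sigma_sets (space M) ?\<C>) (sigma_sets (space M) ?\<D>)"
    using base Int_stable_finite_vimage_Inter by (intro indep_set_sigma_sets) auto
  moreover have "sigma_sets (space M) (cylinders M B {0..s}) \<subseteq> sigma_sets (space M) ?\<C>"
  proof (rule sigma_sets_mono, clarsimp simp: cylinders_def)
    fix t and A :: "real set" assume "0 \<le> t" "t \<le> s" "A \<in> sets borel"
    then show "B t -` A \<inter> space M \<in> sigma_sets (space M) ?\<C>"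
      by (intro sigma_sets.Basic) (auto intro!: exI[of _ "{t}"] exI[of _ "\<lambda>_. A"])
  qed
  moreover have "?\<D> \<subseteq> sigma_sets (space M) ?\<D>" by auto
  ultimately show ?thesis
    by (rule indep_set_subsets)
qed

lemma cylinders_mono: "S \<subseteq> T \<Longrightarrow> cylinders M B S \<subseteq> cylinders M B T"
  unfolding cylinders_def by blast

section \<open>The enlarged filtration and its independence from future increments\<close>

context brownian_setup
begin

abbreviation "\<F> \<equiv> filt M B F0"

lemma B_measurable: "0 \<le> t \<Longrightarrow> B t \<in> borel_measurable M"
  using brownian by (auto simp: brownian_motion_def)

lemma F0_events: "sets F0 \<subseteq> events"
  using subalgebra_F0 by (auto simp: subalgebra_def)

lemma cylinders_events: "T \<subseteq> {0..} \<Longrightarrow> cylinders M B T \<subseteq> events"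
  by (auto simp: cylinders_def intro!: measurable_sets[OF B_measurable])

lemma filt_generator: "0 \<le> t \<Longrightarrow> sets F0 \<union> cylinders M B {0..t} \<union> null_sets M \<subseteq> events"
  using F0_events cylinders_events[of "{0..t}"] by auto

lemma space_filt [simp]: "space (filt M B F0 t) = space M"
  unfolding filt_def by (rule space_measure_of_conv)

lemma sets_filt:
  "0 \<le> t \<Longrightarrow> sets (\<F> t) = sigma_sets (space M) (sets F0 \<union> cylinders M B {0..t} \<union> null_sets M)"
  unfolding filt_def using filt_generator[of t] sets.space_closed[of M] by (intro sets_measure_of) blast

lemma subalgebra_filt: "0 \<le> t \<Longrightarrow> subalgebra M (\<F> t)"
  using sets.sigma_sets_subset[OF filt_generator] by (simp add: subalgebra_def sets_filt)

lemma subalgebra_filt_mono: "0 \<le> s \<Longrightarrow> s \<le> t \<Longrightarrow> subalgebra (\<F> t) (\<F> s)"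
  using sigma_sets_subseteq[of "sets F0 \<union> cylinders M B {0..s} \<union> null_sets M"
      "sets F0 \<union> cylinders M B {0..t} \<union> null_sets M" "space M"]
    cylinders_mono[of "{0..s}" "{0..t}" M B]
  by (auto simp: subalgebra_def sets_filt)

lemma filt_measurableD: "0 \<le> t \<Longrightarrow> f \<in> measurable (\<F> t) N \<Longrightarrow> f \<in> measurable M N"
  by (rule measurable_from_subalg[OF subalgebra_filt])

lemma filt_measurable_mono:
  "0 \<le> s \<Longrightarrow> s \<le> t \<Longrightarrow> f \<in> measurable (\<F> s) N \<Longrightarrow> f \<in> measurable (\<F> t) N"
  by (rule measurable_from_subalg[OF subalgebra_filt_mono])

lemma space_brownian_sigma [simp]: "space (brownian_sigma M B) = space M"
  unfolding brownian_sigma_def by (rule space_measure_of_conv)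

lemma sets_brownian_sigma:
  "sets (brownian_sigma M B) = sigma_sets (space M) (cylinders M B {0..} \<union> null_sets M)"
  unfolding brownian_sigma_def using cylinders_events[of "{0..}"] sets.space_closed[of M]
  by (intro sets_measure_of) auto

lemma subalgebra_brownian_sigma: "subalgebra M (brownian_sigma M B)"
  using sets.sigma_sets_subset[of "cylinders M B {0..} \<union> null_sets M" M] cylinders_events[of "{0..}"]
  by (auto simp: subalgebra_def sets_brownian_sigma)

lemma null_set_AE_empty: "N \<in> null_sets M \<Longrightarrow> AE \<omega> in M. \<omega> \<in> N \<longleftrightarrow> \<omega> \<in> {}"
  using AE_not_in by auto

lemma sigma_algebra_cylinders:
  "T \<subseteq> {0..} \<Longrightarrow> sigma_algebra (space M) (sigma_sets (space M) (cylinders M B T))"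
  using cylinders_events[of T] sets.space_closed[of M] by (intro sigma_algebra_sigma_sets) blast

text \<open>\<open>indep_F0\<close> concerns the sigma-algebras before augmentation. Null sets
  change nothing, and the time-0 cylinders contained in \<open>\<F> 0\<close> are trivial modulo
  null sets because \<open>B 0\<close> is almost surely 0.\<close>

lemma indep_filt0_brownian_sigma: "indep_set (sets (\<F> 0)) (sets (brownian_sigma M B))"
proof (rule indep_set_AE_eq[OF indep_F0])
  show "sets (\<F> 0) \<subseteq> events" "sets (brownian_sigma M B) \<subseteq> events"
    using subalgebra_filt[of 0] subalgebra_brownian_sigma by (auto simp: subalgebra_def)
  have sF0: "space F0 = space M" using subalgebra_F0 by (simp add: subalgebra_def)
  fix a
  {
    assume "a \<in> sets (\<F> 0)"
    then have a: "a \<in> sigma_sets (space M) (sets F0 \<union> cylinders M B {0..0} \<union> null_sets M)"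
      by (simp add: sets_filt)
    show "\<exists>a'\<in>sets F0. AE \<omega> in M. \<omega> \<in> a \<longleftrightarrow> \<omega> \<in> a'"
    proof (rule sigma_sets_AE_eq[OF a])
      show "sigma_algebra (space M) (sets F0)" using sets.sigma_algebra_axioms[of F0] sF0 by simp
      fix c assume "c \<in> sets F0 \<union> cylinders M B {0..0} \<union> null_sets M"
      then consider "c \<in> sets F0" | "c \<in> null_sets M" | A where "c = B 0 -` A \<inter> space M"
        by (auto simp: cylinders_def)
      then show "\<exists>a'\<in>sets F0. AE \<omega> in M. \<omega> \<in> c \<longleftrightarrow> \<omega> \<in> a'"
      proof cases
        case 3
        have "AE \<omega> in M. B 0 \<omega> = 0" using brownian by (auto simp: brownian_motion_def)
        then have "AE \<omega> in M. \<omega> \<in> c \<longleftrightarrow> \<omega> \<in> (if 0 \<in> A then space F0 else {})"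
          using AE_space by eventually_elim (auto simp: 3 sF0)
        then show ?thesis by (rule bexI) auto
      next
        case 2
        then show ?thesis by (intro bexI[of _ "{}"] null_set_AE_empty) auto
      qed auto
    qed
  }
  {
    assume "a \<in> sets (brownian_sigma M B)"
    then have a: "a \<in> sigma_sets (space M) (cylinders M B {0..} \<union> null_sets M)"
      by (simp add: sets_brownian_sigma)
    show "\<exists>a'\<in>sigma_sets (space M) (cylinders M B {0..}). AE \<omega> in M. \<omega> \<in> a \<longleftrightarrow> \<omega> \<in> a'"
    proof (rule sigma_sets_AE_eq[OF a sigma_algebra_cylinders])
      fix c assume "c \<in> cylinders M B {0..} \<union> null_sets M"
      then show "\<exists>a'\<in>sigma_sets (space M) (cylinders M B {0..}). AE \<omega> in M. \<omega> \<in> c \<longleftrightarrow> \<omega> \<in> a'"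
      proof
        assume "c \<in> null_sets M"
        then show ?thesis by (intro bexI[of _ "{}"] null_set_AE_empty sigma_sets.Empty)
      qed (auto intro: sigma_sets.Basic)
    qed simp
  }
qed

text \<open>On the pi-system of sets \<open>F \<inter> C\<close> the claim is a threefold
  factorization: \<open>F\<close> is independent of the whole Brownian sigma-algebra, which contains
  both \<open>C\<close> and the increment event, and these two are independent of each other by
  \<open>brownian_indep_past\<close>.\<close>

lemma indep_filt_increment:
  assumes s: "0 \<le> s" "s \<le> u"
  shows "indep_set (sets (\<F> s)) {(\<lambda>\<omega>. B u \<omega> - B s \<omega>) -` A \<inter> space M | A. A \<in> sets borel}"
proof -
  let ?C = "sigma_sets (space M) (cylinders M B {0..s})"
  let ?D = "{(\<lambda>\<omega>. B u \<omega> - B s \<omega>) -` A \<inter> space M | A. A \<in> sets borel}"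
  let ?G = "{F \<inter> C | F C. F \<in> sets F0 \<and> C \<in> ?C}"
  have sF0: "space F0 = space M" using subalgebra_F0 by (simp add: subalgebra_def)
  interpret C: sigma_algebra "space M" ?C using s by (intro sigma_algebra_cylinders) auto
  interpret U: sigma_algebra "space M" "sigma_sets (space M) (cylinders M B {0..})"
    by (intro sigma_algebra_cylinders) auto
  have ip: "indep_set ?C ?D" using prob_space_axioms brownian s by (rule brownian_indep_past)
  have CU: "?C \<subseteq> sigma_sets (space M) (cylinders M B {0..})"
    by (intro sigma_sets_subseteq cylinders_mono) auto
  have DU: "?D \<subseteq> sigma_sets (space M) (cylinders M B {0..})"
  proof -
    let ?U = "sigma (space M) (cylinders M B {0..})"
    have sU: "sets ?U = sigma_sets (space M) (cylinders M B {0..})" "space ?U = space M"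
      using cylinders_events[of "{0..}"] sets.space_closed[of M] by (auto intro!: sets_measure_of space_measure_of)
    have "B t \<in> borel_measurable ?U" if "t \<ge> 0" for t
    proof (rule measurableI)
      fix A :: "real set" assume "A \<in> sets borel"
      then have "B t -` A \<inter> space M \<in> cylinders M B {0..}" using that unfolding cylinders_def by auto
      then show "B t -` A \<inter> space ?U \<in> sets ?U" by (simp add: sU)
    qed simp
    then have "(\<lambda>\<omega>. B u \<omega> - B s \<omega>) \<in> borel_measurable ?U"
      using s by (intro borel_measurable_diff) auto
    from measurable_sets[OF this] show ?thesis by (auto simp: sU)
  qed
  have ev: "?G \<subseteq> events" "?D \<subseteq> events"
    using F0_events indep_set_events[OF ip] by auto
  have base: "indep_set ?G ?D"
  proof (rule indep_setI[OF ev], clarify)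
    fix F C A assume *: "F \<in> sets F0" "C \<in> ?C" "A \<in> sets (borel :: real measure)"
    let ?d = "(\<lambda>\<omega>. B u \<omega> - B s \<omega>) -` A \<inter> space M"
    have d: "?d \<in> ?D" using * by blast
    have "prob ((F \<inter> C) \<inter> ?d) = prob (F \<inter> (C \<inter> ?d))" by (simp add: Int_assoc)
    also have "\<dots> = prob F * prob (C \<inter> ?d)"
      using * d CU DU by (intro indep_setD[OF indep_F0]) auto
    also have "prob (C \<inter> ?d) = prob C * prob ?d" by (rule indep_setD[OF ip *(2) d])
    also have "prob F * (prob C * prob ?d) = prob (F \<inter> C) * prob ?d"
      using indep_setD[OF indep_F0 *(1), of C] * CU by auto
    finally show "prob ((F \<inter> C) \<inter> ?d) = prob (F \<inter> C) * prob ?d" .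
  qed
  have "Int_stable ?G"
  proof (rule Int_stableI, clarify)
    fix F F' C C' assume "F \<in> sets F0" "F' \<in> sets F0" "C \<in> ?C" "C' \<in> ?C"
    then show "\<exists>F'' C''. F \<inter> C \<inter> (F' \<inter> C') = F'' \<inter> C'' \<and> F'' \<in> sets F0 \<and> C'' \<in> ?C"
      by (intro exI[of _ "F \<inter> F'"] exI[of _ "C \<inter> C'"]) auto
  qed
  moreover have "Int_stable ?D"
  proof (rule Int_stableI, clarify)
    fix D D' :: "real set" assume "D \<in> sets borel" "D' \<in> sets borel"
    then show "\<exists>A. ((\<lambda>\<omega>. B u \<omega> - B s \<omega>) -` D \<inter> space M) \<inter> ((\<lambda>\<omega>. B u \<omega> - B s \<omega>) -` D' \<inter> space M)
       = (\<lambda>\<omega>. B u \<omega> - B s \<omega>) -` A \<inter> space M \<and> A \<in> sets borel"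
      by (intro exI[of _ "D \<inter> D'"]) auto
  qed
  ultimately have ind: "indep_set (sigma_sets (space M) ?G) (sigma_sets (space M) ?D)"
    using base by (intro indep_set_sigma_sets)
  show ?thesis
  proof (rule indep_set_AE_eq[OF ind])
    show "sets (\<F> s) \<subseteq> events" using subalgebra_filt[of s] s by (auto simp: subalgebra_def)
    show "?D \<subseteq> events" by fact
    show "\<exists>a'\<in>sigma_sets (space M) ?D. AE \<omega> in M. \<omega> \<in> a \<longleftrightarrow> \<omega> \<in> a'" if "a \<in> ?D" for a
      using that by (intro bexI[of _ a]) (auto intro!: sigma_sets.Basic)
    fix a assume "a \<in> sets (\<F> s)"
    then have a: "a \<in> sigma_sets (space M) (sets F0 \<union> cylinders M B {0..s} \<union> null_sets M)"
      using s by (simp add: sets_filt)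
    show "\<exists>a'\<in>sigma_sets (space M) ?G. AE \<omega> in M. \<omega> \<in> a \<longleftrightarrow> \<omega> \<in> a'"
    proof (rule sigma_sets_AE_eq[OF a])
      show "sigma_algebra (space M) (sigma_sets (space M) ?G)"
        using ev sets.space_closed[of M] by (intro sigma_algebra_sigma_sets) blast
      fix c assume c: "c \<in> sets F0 \<union> cylinders M B {0..s} \<union> null_sets M"
      have "c \<in> sigma_sets (space M) ?G" if "c \<in> sets F0"
      proof -
        have "c = c \<inter> space M" using sets.sets_into_space[OF that] sF0 by auto
        then have "c \<in> ?G" using that C.top by blast
        then show ?thesis by (rule sigma_sets.Basic)
      qed
      moreover have "c \<in> sigma_sets (space M) ?G" if "c \<in> cylinders M B {0..s}"
      proof -
        have "c \<subseteq> space M" using that unfolding cylinders_def by blast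
        then have "c = space F0 \<inter> c" using sF0 by auto
        moreover have "c \<in> ?C" using that by (rule sigma_sets.Basic)
        ultimately have "c \<in> ?G" by blast
        then show ?thesis by (rule sigma_sets.Basic)
      qed
      moreover have "\<exists>a'\<in>sigma_sets (space M) ?G. AE \<omega> in M. \<omega> \<in> c \<longleftrightarrow> \<omega> \<in> a'" if "c \<in> null_sets M"
        using that by (intro bexI[of _ "{}"] null_set_AE_empty sigma_sets.Empty)
      ultimately show "\<exists>a'\<in>sigma_sets (space M) ?G. AE \<omega> in M. \<omega> \<in> c \<longleftrightarrow> \<omega> \<in> a'"
        using c by (blast intro: AE_I2)
    qed
  qed
qed

lemma increment_moments:
  assumes "0 \<le> s" "s \<le> u"
  shows "integrable M (\<lambda>\<omega>. B u \<omega> - B s \<omega>)" "expectation (\<lambda>\<omega>. B u \<omega> - B s \<omega>) = 0"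
    "integrable M (\<lambda>\<omega>. (B u \<omega> - B s \<omega>)\<^sup>2)" "expectation (\<lambda>\<omega>. (B u \<omega> - B s \<omega>)\<^sup>2) = u - s"
proof -
  \<comment> \<open>The Gaussian law is prescribed for \<open>s < u\<close> only; the empty
    increment is treated by hand.\<close>
  consider "s = u" | "s < u" using assms by linarith
  then have "integrable M (\<lambda>\<omega>. B u \<omega> - B s \<omega>) \<and> expectation (\<lambda>\<omega>. B u \<omega> - B s \<omega>) = 0 \<and>
    integrable M (\<lambda>\<omega>. (B u \<omega> - B s \<omega>)\<^sup>2) \<and> expectation (\<lambda>\<omega>. (B u \<omega> - B s \<omega>)\<^sup>2) = u - s"
  proof cases
    case 1
    then show ?thesis by simp
  next
    case 2
    define \<sigma> where "\<sigma> = sqrt (u - s)"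
    have \<sigma>: "\<sigma> > 0" "\<sigma>\<^sup>2 = u - s" using 2 by (auto simp: \<sigma>_def)
    have D: "distributed M lborel (\<lambda>\<omega>. B u \<omega> - B s \<omega>) (normal_density 0 \<sigma>)"
      using brownian 2 assms by (auto simp: brownian_motion_def \<sigma>_def)
    have 1: "integrable M (\<lambda>\<omega>. B u \<omega> - B s \<omega>)"
      using distributed_integrable[OF D, of "\<lambda>x. x"] integrable_normal_moment[OF \<sigma>(1), of 0 1] by simp
    have 2: "integrable M (\<lambda>\<omega>. (B u \<omega> - B s \<omega>)\<^sup>2)"
      using distributed_integrable[OF D, of "\<lambda>x. x^2"] integrable_normal_moment[OF \<sigma>(1), of 0 2] by simp
    have 3: "expectation (\<lambda>\<omega>. B u \<omega> - B s \<omega>) = 0"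
      using normal_distributed_expectation[OF \<sigma>(1) D] by simp
    have 4: "expectation (\<lambda>\<omega>. (B u \<omega> - B s \<omega>)\<^sup>2) = u - s"
      using normal_distributed_variance[OF \<sigma>(1) D] \<sigma>(2) 3 by simp
    show ?thesis using 1 2 3 4 by simp
  qed
  then show "integrable M (\<lambda>\<omega>. B u \<omega> - B s \<omega>)" "expectation (\<lambda>\<omega>. B u \<omega> - B s \<omega>) = 0"
    "integrable M (\<lambda>\<omega>. (B u \<omega> - B s \<omega>)\<^sup>2)" "expectation (\<lambda>\<omega>. (B u \<omega> - B s \<omega>)\<^sup>2) = u - s" by auto
qed

text \<open>Used with \<open>\<phi>\<close> the identity, which gives orthogonality to the past, and
  with \<open>\<phi>\<close> the square, which gives the isometry.\<close>

lemma filt_increment_product: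
  assumes s: "0 \<le> s" "s \<le> u" and G: "G \<in> borel_measurable (\<F> s)" "integrable M G"
    and \<phi>: "\<phi> \<in> borel_measurable borel" "integrable M (\<lambda>\<omega>. \<phi> (B u \<omega> - B s \<omega>) :: real)"
  shows "integrable M (\<lambda>\<omega>. G \<omega> * \<phi> (B u \<omega> - B s \<omega>))"
    "expectation (\<lambda>\<omega>. G \<omega> * \<phi> (B u \<omega> - B s \<omega>)) = expectation G * expectation (\<lambda>\<omega>. \<phi> (B u \<omega> - B s \<omega>))"
proof -
  have "indep_var borel G borel (\<lambda>\<omega>. \<phi> (B u \<omega> - B s \<omega>))"
  proof (rule indep_var_of_indep_set[OF indep_filt_increment[OF s]])
    show "G -` A \<inter> space M \<in> sets (\<F> s)" if "A \<in> sets borel" for A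
      using measurable_sets[OF G(1) that] by simp
    show "(\<lambda>\<omega>. \<phi> (B u \<omega> - B s \<omega>)) -` A \<inter> space M \<in> {(\<lambda>\<omega>. B u \<omega> - B s \<omega>) -` A \<inter> space M | A. A \<in> sets borel}"
      if "A \<in> sets borel" for A
    proof -
      have "\<phi> -` A \<in> sets borel" using measurable_sets[OF \<phi>(1) that] by simp
      then show ?thesis by (intro CollectI exI[of _ "\<phi> -` A"]) auto
    qed
  qed (use G \<phi> in auto)
  from indep_var_integrable[OF this G(2) \<phi>(2)] indep_var_lebesgue_integral[OF this G(2) \<phi>(2)]
  show "integrable M (\<lambda>\<omega>. G \<omega> * \<phi> (B u \<omega> - B s \<omega>))"
    "expectation (\<lambda>\<omega>. G \<omega> * \<phi> (B u \<omega> - B s \<omega>)) = expectation G * expectation (\<lambda>\<omega>. \<phi> (B u \<omega> - B s \<omega>))"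
    by auto
qed

end

section \<open>The Ito integral is a martingale\<close>

lemma square_diff_le:
  fixes p q m :: real
  shows "(p - q)\<^sup>2 \<le> 2 * (p - m)\<^sup>2 + 2 * (q - m)\<^sup>2"
proof -
  have "2 * (p - m)\<^sup>2 + 2 * (q - m)\<^sup>2 - (p - q)\<^sup>2 = (p + q - 2 * m)\<^sup>2"
    by (simp add: power2_eq_square algebra_simps)
  then show ?thesis using zero_le_power2[of "p + q - 2 * m"] by linarith
qed

lemma integrable_mult_square:
  fixes f g :: "'a \<Rightarrow> real"
  assumes [measurable]: "f \<in> borel_measurable M" "g \<in> borel_measurable M"
    and i: "integrable M (\<lambda>x. (f x)\<^sup>2)" "integrable M (\<lambda>x. (g x)\<^sup>2)"
  shows "integrable M (\<lambda>x. f x * g x)"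
proof (rule Bochner_Integration.integrable_bound)
  show "integrable M (\<lambda>x. (f x)\<^sup>2 + (g x)\<^sup>2)" using i by (rule Bochner_Integration.integrable_add)
  have "\<bar>f x * g x\<bar> \<le> (f x)\<^sup>2 + (g x)\<^sup>2" for x
  proof -
    have "\<bar>f x * g x\<bar> \<le> 2 * \<bar>f x\<bar> * \<bar>g x\<bar>" by (simp add: abs_mult)
    also have "\<dots> \<le> (f x)\<^sup>2 + (g x)\<^sup>2" using sum_squares_bound[of "\<bar>f x\<bar>" "\<bar>g x\<bar>"] by simp
    finally show ?thesis .
  qed
  then show "AE x in M. norm (f x * g x) \<le> norm ((f x)\<^sup>2 + (g x)\<^sup>2)" by simp
qed simp

lemma integrable_add_square:
  fixes f g :: "'a \<Rightarrow> real"
  assumes [measurable]: "f \<in> borel_measurable M" "g \<in> borel_measurable M"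
    and i: "integrable M (\<lambda>x. (f x)\<^sup>2)" "integrable M (\<lambda>x. (g x)\<^sup>2)"
  shows "integrable M (\<lambda>x. (f x + g x)\<^sup>2)"
  using i integrable_mult_square[OF assms] by (simp add: power2_sum mult.assoc)

lemma integrable_diff_square:
  fixes f g :: "'a \<Rightarrow> real"
  assumes [measurable]: "f \<in> borel_measurable M" "g \<in> borel_measurable M"
    and i: "integrable M (\<lambda>x. (f x)\<^sup>2)" "integrable M (\<lambda>x. (g x)\<^sup>2)"
  shows "integrable M (\<lambda>x. (f x - g x)\<^sup>2)"
  using i integrable_mult_square[OF assms] by (simp add: power2_diff mult.assoc)

lemma integrable_bounded_mult:
  fixes f g :: "'a \<Rightarrow> real"
  assumes [measurable]: "f \<in> borel_measurable M" and g: "integrable M g"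
    and C: "\<And>x. x \<in> space M \<Longrightarrow> \<bar>f x\<bar> \<le> C"
  shows "integrable M (\<lambda>x. f x * g x)"
proof (rule Bochner_Integration.integrable_bound)
  show "integrable M (\<lambda>x. C * g x)" using g by simp
  show "AE x in M. norm (f x * g x) \<le> norm (C * g x)"
  proof (rule AE_I2)
    fix x assume "x \<in> space M"
    then have "\<bar>f x\<bar> \<le> \<bar>C\<bar>" using C[of x] by linarith
    then show "norm (f x * g x) \<le> norm (C * g x)" by (simp add: abs_mult mult_right_mono)
  qed
  have [measurable]: "g \<in> borel_measurable M" using g by auto
  show "(\<lambda>x. f x * g x) \<in> borel_measurable M" by measurable
qed

text \<open>A tool for passing an exact identity to an \<open>L2\<close> limit: \<open>e\<close>
  does not depend on \<open>k\<close>, while Cauchy-Schwarz bounds its square by a null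
  sequence.\<close>

lemma integral_zero_of_L2_approx:
  fixes G :: "'a \<Rightarrow> real" and R :: "nat \<Rightarrow> 'a \<Rightarrow> real"
  assumes [measurable]: "G \<in> borel_measurable M" "\<And>k. R k \<in> borel_measurable M"
    and G: "integrable M (\<lambda>x. (G x)\<^sup>2)"
    and e: "\<And>k. (\<integral>x. G x * R k x \<partial>M) = e"
    and lim: "(\<lambda>k. \<integral>\<^sup>+x. ennreal ((R k x)\<^sup>2) \<partial>M) \<longlonglongrightarrow> 0"
  shows "e = 0"
proof -
  have bound: "ennreal (e\<^sup>2) \<le> (\<integral>\<^sup>+x. ennreal ((G x)\<^sup>2) \<partial>M) * (\<integral>\<^sup>+x. ennreal ((R k x)\<^sup>2) \<partial>M)" for k
  proof -
    have "ennreal \<bar>e\<bar> \<le> (\<integral>\<^sup>+x. ennreal \<bar>G x * R k x\<bar> \<partial>M)"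
    proof (cases "integrable M (\<lambda>x. G x * R k x)")
      case True
      then show ?thesis using integral_norm_bound_ennreal[OF True] e[of k] by simp
    next
      \<comment> \<open>The integral of a non-integrable product is 0 by convention, so the bound is
        trivial.\<close>
      case False
      then show ?thesis using e[of k] by (simp add: not_integrable_integral_eq)
    qed
    then have "(ennreal \<bar>e\<bar>)\<^sup>2 \<le> (\<integral>\<^sup>+x. ennreal \<bar>G x\<bar> * ennreal \<bar>R k x\<bar> \<partial>M)\<^sup>2"
      by (intro power_mono) (auto simp: abs_mult ennreal_mult)
    also have "\<dots> \<le> (\<integral>\<^sup>+x. (ennreal \<bar>G x\<bar>)\<^sup>2 \<partial>M) * (\<integral>\<^sup>+x. (ennreal \<bar>R k x\<bar>)\<^sup>2 \<partial>M)"
      by (rule Cauchy_Schwarz_nn_integral) auto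
    finally show ?thesis by (simp add: ennreal_power)
  qed
  have fin: "(\<integral>\<^sup>+x. ennreal ((G x)\<^sup>2) \<partial>M) < \<top>" using G by (simp add: nn_integral_eq_integral)
  then have "(\<lambda>k. (\<integral>\<^sup>+x. ennreal ((G x)\<^sup>2) \<partial>M) * (\<integral>\<^sup>+x. ennreal ((R k x)\<^sup>2) \<partial>M)) \<longlonglongrightarrow> (\<integral>\<^sup>+x. ennreal ((G x)\<^sup>2) \<partial>M) * 0"
    by (intro tendsto_mult_ennreal lim tendsto_const) auto
  then have "ennreal (e\<^sup>2) \<le> 0" using bound by (intro LIMSEQ_le_const) auto
  then show ?thesis by (simp add: ennreal_eq_0_iff)
qed

section \<open>Elementary and simple integrands\<close>

context brownian_setup
begin

definition elementary :: "real \<Rightarrow> real \<Rightarrow> ('a \<Rightarrow> real) \<Rightarrow> bool" where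
  "elementary a b \<eta> \<longleftrightarrow> 0 \<le> a \<and> a \<le> b \<and> \<eta> \<in> borel_measurable (\<F> a) \<and> (\<exists>C. \<forall>\<omega>\<in>space M. \<bar>\<eta> \<omega>\<bar> \<le> C)"

lemma filt_increment_orthogonal:
  assumes "0 \<le> s" "s \<le> u" "G \<in> borel_measurable (\<F> s)" "integrable M G"
  shows "integrable M (\<lambda>\<omega>. G \<omega> * (B u \<omega> - B s \<omega>))" "expectation (\<lambda>\<omega>. G \<omega> * (B u \<omega> - B s \<omega>)) = 0"
  using filt_increment_product[OF assms, of "\<lambda>x. x"] increment_moments[OF assms(1,2)] by auto

lemma increment_filt: "0 \<le> s \<Longrightarrow> s \<le> u \<Longrightarrow> u \<le> v \<Longrightarrow> (\<lambda>\<omega>. B u \<omega> - B s \<omega>) \<in> borel_measurable (\<F> v)"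
proof -
  assume *: "0 \<le> s" "s \<le> u" "u \<le> v"
  have "B t \<in> borel_measurable (\<F> v)" if "0 \<le> t" "t \<le> v" for t
  proof (rule measurableI)
    fix A :: "real set" assume "A \<in> sets borel"
    then have "B t -` A \<inter> space M \<in> cylinders M B {0..v}" using that unfolding cylinders_def by auto
    then show "B t -` A \<inter> space (\<F> v) \<in> sets (\<F> v)" using * by (auto simp: sets_filt)
  qed simp
  then show ?thesis using * by (intro borel_measurable_diff) auto
qed

text \<open>The later interval starts at \<open>c\<close>. The part of the first increment before
  \<open>c\<close> and the part of either increment beyond the overlap are orthogonal to what they
  are multiplied with; only the squared increment over the overlap survives, and its mean is the
  length of the overlap.\<close>

lemma elementary_product_aux:
  assumes e: "elementary a b \<eta>" "elementary c d \<theta>" and ac: "a \<le> c"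
  shows "integrable M (\<lambda>\<omega>. \<eta> \<omega> * (B b \<omega> - B a \<omega>) * (\<theta> \<omega> * (B d \<omega> - B c \<omega>))) \<and>
     expectation (\<lambda>\<omega>. \<eta> \<omega> * (B b \<omega> - B a \<omega>) * (\<theta> \<omega> * (B d \<omega> - B c \<omega>)))
     = expectation (\<lambda>\<omega>. \<eta> \<omega> * \<theta> \<omega>) * (LINT t|lborel. indicator {a<..b} t * indicator {c<..d} t)"
proof -
  have o: "0 \<le> a" "a \<le> b" "0 \<le> c" "c \<le> d" using e by (auto simp: elementary_def)
  obtain C1 C2 where C: "\<And>\<omega>. \<omega> \<in> space M \<Longrightarrow> \<bar>\<eta> \<omega>\<bar> \<le> C1" "\<And>\<omega>. \<omega> \<in> space M \<Longrightarrow> \<bar>\<theta> \<omega>\<bar> \<le> C2"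
    using e by (auto simp: elementary_def)
  have bd: "\<bar>\<eta> \<omega> * \<theta> \<omega>\<bar> \<le> C1 * C2" if "\<omega> \<in> space M" for \<omega>
    using mult_mono[OF C(1)[OF that] C(2)[OF that]] C(1)[OF that] by (auto simp: abs_mult)
  have m\<eta>: "\<eta> \<in> borel_measurable (\<F> v)" if "a \<le> v" for v
    using e that o by (auto simp: elementary_def intro: filt_measurable_mono)
  have m\<theta>: "\<theta> \<in> borel_measurable (\<F> v)" if "c \<le> v" for v
    using e that o by (auto simp: elementary_def intro: filt_measurable_mono)
  have m: "(\<lambda>\<omega>. \<eta> \<omega> * \<theta> \<omega>) \<in> borel_measurable (\<F> v)" if "c \<le> v" for v
    using m\<eta>[of v] m\<theta>[of v] ac that by (intro borel_measurable_times) auto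
  have mM: "(\<lambda>\<omega>. \<eta> \<omega> * \<theta> \<omega>) \<in> borel_measurable M" using m[of c] o by (intro filt_measurableD[of c]) auto
  have i\<eta>\<theta>: "integrable M (\<lambda>\<omega>. \<eta> \<omega> * \<theta> \<omega>)"
    using bd mM by (intro integrable_const_bound[where B="C1 * C2"]) auto
  have incr: "integrable M (\<lambda>\<omega>. \<eta> \<omega> * \<theta> \<omega> * (B v \<omega> - B u \<omega>))" if "0 \<le> u" "u \<le> v" for u v
    using mM bd increment_moments(1)[OF that] by (intro integrable_bounded_mult) auto
  have orth: "integrable M (\<lambda>\<omega>. \<eta> \<omega> * \<theta> \<omega> * (B v \<omega> - B u \<omega>) * (B w \<omega> - B v' \<omega>)) \<and>
     expectation (\<lambda>\<omega>. \<eta> \<omega> * \<theta> \<omega> * (B v \<omega> - B u \<omega>) * (B w \<omega> - B v' \<omega>)) = 0"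
    if "0 \<le> u" "u \<le> v" "v \<le> v'" "v' \<le> w" "c \<le> v'" for u v v' w
    using filt_increment_orthogonal[of v' w "\<lambda>\<omega>. \<eta> \<omega> * \<theta> \<omega> * (B v \<omega> - B u \<omega>)"] incr[of u v] that
      m[of v'] increment_filt[of u v v'] by auto
  show ?thesis
  proof (cases "b \<le> c")
    case True
    then have "(\<lambda>t::real. indicator {a<..b} t * indicator {c<..d} t) = (\<lambda>t. 0::real)"
      by (auto simp: fun_eq_iff indicator_def)
    then show ?thesis using orth[of a b c d] o True by (simp add: mult_ac)
  next
    case False
    \<comment> \<open>\<open>p\<close> ends the overlap \<open>(c, p]\<close>. The excess from
      \<open>p\<close> to \<open>q\<close> belongs to only one of the two factors, and
      \<open>split\<close> is the same whichever it is.\<close>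
    define p where "p = min b d"
    define q where "q = max b d"
    have pq: "c \<le> p" "p \<le> q" using False o by (auto simp: p_def q_def)
    have split: "\<eta> \<omega> * (B b \<omega> - B a \<omega>) * (\<theta> \<omega> * (B d \<omega> - B c \<omega>)) =
        \<eta> \<omega> * \<theta> \<omega> * (B c \<omega> - B a \<omega>) * (B d \<omega> - B c \<omega>) + (\<eta> \<omega> * \<theta> \<omega> * (B p \<omega> - B c \<omega>)\<^sup>2
         + \<eta> \<omega> * \<theta> \<omega> * (B p \<omega> - B c \<omega>) * (B q \<omega> - B p \<omega>))" for \<omega>
      by (auto simp: p_def q_def min_def max_def power2_eq_square algebra_simps)
    have sq: "integrable M (\<lambda>\<omega>. \<eta> \<omega> * \<theta> \<omega> * (B p \<omega> - B c \<omega>)\<^sup>2)"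
        "expectation (\<lambda>\<omega>. \<eta> \<omega> * \<theta> \<omega> * (B p \<omega> - B c \<omega>)\<^sup>2) = expectation (\<lambda>\<omega>. \<eta> \<omega> * \<theta> \<omega>) * (p - c)"
      using filt_increment_product[of c p "\<lambda>\<omega>. \<eta> \<omega> * \<theta> \<omega>" "\<lambda>x. x\<^sup>2"] increment_moments[of c p] m[of c] i\<eta>\<theta> o pq by auto
    have "{a<..b} \<inter> {c<..d} = {c<..p}" using ac False by (auto simp: p_def)
    then have "(\<lambda>t::real. indicator {a<..b} t * indicator {c<..d} t :: real) = indicator {c<..p}"
      by (simp add: fun_eq_iff indicator_inter_arith[symmetric])
    then have "(LINT t|lborel. indicator {a<..b} t * indicator {c<..d} t) = p - c"
      using pq by simp
    moreover note orth[of a c c d] orth[of c p p q]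
    ultimately show ?thesis
      unfolding split using sq o ac pq by simp
  qed
qed

lemma elementary_product:
  assumes e: "elementary a b \<eta>" "elementary c d \<theta>"
  shows "integrable M (\<lambda>\<omega>. \<eta> \<omega> * (B b \<omega> - B a \<omega>) * (\<theta> \<omega> * (B d \<omega> - B c \<omega>)))"
     "expectation (\<lambda>\<omega>. \<eta> \<omega> * (B b \<omega> - B a \<omega>) * (\<theta> \<omega> * (B d \<omega> - B c \<omega>)))
     = expectation (\<lambda>\<omega>. \<eta> \<omega> * \<theta> \<omega>) * (LINT t|lborel. indicator {a<..b} t * indicator {c<..d} t)"
  using elementary_product_aux[OF e] elementary_product_aux[OF e(2,1)] linear[of a c]
  by (auto simp: mult.commute)

text \<open>Expanded, both sides are the same double sum over pairs of indices, each pair weighted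
  by the overlap \<open>len i j\<close>. Off-diagonal terms are carried along rather than shown to
  vanish.\<close>

lemma elementary_isometry:
  fixes J :: "'i set"
  assumes J: "finite J" and e: "\<And>i. i \<in> J \<Longrightarrow> elementary (a i) (b i) (\<eta> i)"
  shows "(\<integral>\<^sup>+\<omega>. ennreal ((\<Sum>i\<in>J. \<eta> i \<omega> * (B (b i) \<omega> - B (a i) \<omega>))\<^sup>2) \<partial>M)
    = (\<integral>\<^sup>+\<omega>. (\<integral>\<^sup>+t. ennreal ((\<Sum>i\<in>J. \<eta> i \<omega> * indicator {a i<..b i} t)\<^sup>2) \<partial>lborel) \<partial>M)"
proof -
  have sq: "(\<Sum>i\<in>J. f i)\<^sup>2 = (\<Sum>i\<in>J. \<Sum>j\<in>J. f i * f j)" for f :: "'i \<Rightarrow> real"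
    by (simp add: power2_eq_square sum_product)
  define len where "len i j = (LINT t|lborel. indicator {a i<..b i} t * indicator {a j<..b j} t :: real)" for i j
  have m: "\<eta> i \<in> borel_measurable M" if "i \<in> J" for i
    using e[OF that] by (auto simp: elementary_def intro: filt_measurableD)
  have i\<eta>: "integrable M (\<lambda>\<omega>. \<eta> i \<omega> * \<eta> j \<omega>)" if ij: "i \<in> J" "j \<in> J" for i j
  proof -
    obtain C1 C2 where C: "\<And>\<omega>. \<omega> \<in> space M \<Longrightarrow> \<bar>\<eta> i \<omega>\<bar> \<le> C1" "\<And>\<omega>. \<omega> \<in> space M \<Longrightarrow> \<bar>\<eta> j \<omega>\<bar> \<le> C2"
      using e[OF ij(1)] e[OF ij(2)] by (auto simp: elementary_def)
    have "integrable M (\<eta> j)" using C m[OF ij(2)] by (intro integrable_const_bound[where B=C2]) auto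
    then show ?thesis using C m[OF ij(1)] by (intro integrable_bounded_mult) auto
  qed
  have "(\<integral>\<^sup>+\<omega>. ennreal ((\<Sum>i\<in>J. \<eta> i \<omega> * (B (b i) \<omega> - B (a i) \<omega>))\<^sup>2) \<partial>M)
     = ennreal (expectation (\<lambda>\<omega>. (\<Sum>i\<in>J. \<eta> i \<omega> * (B (b i) \<omega> - B (a i) \<omega>))\<^sup>2))"
    unfolding sq using elementary_product(1)[OF e e]
    by (intro nn_integral_eq_integral Bochner_Integration.integrable_sum AE_I2) (auto simp: sq[symmetric])
  also have "expectation (\<lambda>\<omega>. (\<Sum>i\<in>J. \<eta> i \<omega> * (B (b i) \<omega> - B (a i) \<omega>))\<^sup>2)
     = (\<Sum>i\<in>J. \<Sum>j\<in>J. expectation (\<lambda>\<omega>. \<eta> i \<omega> * \<eta> j \<omega>) * len i j)"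
  proof -
    define T where "T i j \<omega> = \<eta> i \<omega> * (B (b i) \<omega> - B (a i) \<omega>) * (\<eta> j \<omega> * (B (b j) \<omega> - B (a j) \<omega>))" for i j \<omega>
    have T: "integrable M (T i j)" "expectation (T i j) = expectation (\<lambda>\<omega>. \<eta> i \<omega> * \<eta> j \<omega>) * len i j"
      if "i \<in> J" "j \<in> J" for i j
      using elementary_product[OF e e, OF that] by (simp_all add: T_def[abs_def] len_def)
    have "expectation (\<lambda>\<omega>. \<Sum>i\<in>J. \<Sum>j\<in>J. T i j \<omega>) = (\<Sum>i\<in>J. expectation (\<lambda>\<omega>. \<Sum>j\<in>J. T i j \<omega>))"
      using T(1) by (intro Bochner_Integration.integral_sum Bochner_Integration.integrable_sum)
    also have "\<dots> = (\<Sum>i\<in>J. \<Sum>j\<in>J. expectation (T i j))"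
      using T(1) by (intro sum.cong refl Bochner_Integration.integral_sum)
    finally show ?thesis unfolding sq using T(2) by (simp add: T_def)
  qed
  also have "\<dots> = expectation (\<lambda>\<omega>. \<Sum>i\<in>J. \<Sum>j\<in>J. \<eta> i \<omega> * \<eta> j \<omega> * len i j)"
    using i\<eta> by (simp add: Bochner_Integration.integral_sum)
  also have inner: "(\<Sum>i\<in>J. \<Sum>j\<in>J. \<eta> i \<omega> * \<eta> j \<omega> * len i j) = (LINT t|lborel. (\<Sum>i\<in>J. \<eta> i \<omega> * indicator {a i<..b i} t)\<^sup>2)
      \<and> integrable lborel (\<lambda>t. (\<Sum>i\<in>J. \<eta> i \<omega> * indicator {a i<..b i} t)\<^sup>2)" for \<omega>
  proof -
    have *: "integrable lborel (\<lambda>t. indicator {a i<..b i} t * indicator {a j<..b j} t :: real)" for i j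
      by (cases "a i \<le> b i") (auto intro!: integrable_real_mult_indicator)
    have **: "(\<lambda>t. (\<Sum>i\<in>J. \<eta> i \<omega> * indicator {a i<..b i} t)\<^sup>2)
       = (\<lambda>t. \<Sum>i\<in>J. \<Sum>j\<in>J. \<eta> i \<omega> * \<eta> j \<omega> * (indicator {a i<..b i} t * indicator {a j<..b j} t))"
      unfolding sq by (intro ext sum.cong) (auto simp: mult_ac)
    show ?thesis unfolding ** using *
      by (simp add: Bochner_Integration.integral_sum len_def)
  qed
  then have "expectation (\<lambda>\<omega>. \<Sum>i\<in>J. \<Sum>j\<in>J. \<eta> i \<omega> * \<eta> j \<omega> * len i j)
     = expectation (\<lambda>\<omega>. LINT t|lborel. (\<Sum>i\<in>J. \<eta> i \<omega> * indicator {a i<..b i} t)\<^sup>2)" by simp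
  also have "ennreal \<dots> = (\<integral>\<^sup>+\<omega>. ennreal (LINT t|lborel. (\<Sum>i\<in>J. \<eta> i \<omega> * indicator {a i<..b i} t)\<^sup>2) \<partial>M)"
  proof (rule nn_integral_eq_integral[symmetric])
    have "integrable M (\<lambda>\<omega>. \<Sum>i\<in>J. \<Sum>j\<in>J. \<eta> i \<omega> * \<eta> j \<omega> * len i j)" using i\<eta> by simp
    then show "integrable M (\<lambda>\<omega>. LINT t|lborel. (\<Sum>i\<in>J. \<eta> i \<omega> * indicator {a i<..b i} t)\<^sup>2)"
      using inner by simp
  qed (intro AE_I2 Bochner_Integration.integral_nonneg zero_le_power2)
  also have "\<dots> = (\<integral>\<^sup>+\<omega>. (\<integral>\<^sup>+t. ennreal ((\<Sum>i\<in>J. \<eta> i \<omega> * indicator {a i<..b i} t)\<^sup>2) \<partial>lborel) \<partial>M)"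
    using inner by (simp add: nn_integral_eq_integral)
  finally show ?thesis .
qed


text \<open>The two integrands are merged into one finite family; as \<open>elementary_isometry\<close> admits overlapping
  intervals, no common refinement of the partitions is needed.\<close>

lemma simple_ito_diff_isometry:
  assumes S: "is_simple M \<F> S" and S': "is_simple M \<F> S'" and s: "0 \<le> s"
  shows "(\<integral>\<^sup>+\<omega>. ennreal ((simple_ito B S s \<omega> - simple_ito B S' s \<omega>)\<^sup>2) \<partial>M)
    = (\<integral>\<^sup>+\<omega>. (\<integral>\<^sup>+t\<in>{0..s}. ennreal ((simple_eval S t \<omega> - simple_eval S' t \<omega>)\<^sup>2) \<partial>lborel) \<partial>M)"
proof -
  obtain n \<tau> \<eta> where S_eq: "S = (n, \<tau>, \<eta>)" by (cases S)
  obtain n' \<tau>' \<eta>' where S'_eq: "S' = (n', \<tau>', \<eta>')" by (cases S')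
  \<comment> \<open>The disjoint sum keeps the index ranges of the two integrands apart; the second
    one enters with reversed sign.\<close>
  define J where "J = {..<n} <+> {..<n'}"
  define a where "a = case_sum (\<lambda>i. min s (\<tau> i)) (\<lambda>i. min s (\<tau>' i))"
  define b where "b = case_sum (\<lambda>i. min s (\<tau> (Suc i))) (\<lambda>i. min s (\<tau>' (Suc i)))"
  \<comment> \<open>A term starting after \<open>s\<close> must be replaced by 0: its truncated
    interval begins at \<open>s\<close>, whereas its coefficient is known only at the later time
    \<open>\<tau> i\<close>. The interval is then empty, so no value changes.\<close>
  define \<theta> where "\<theta> = case_sum (\<lambda>i \<omega>. if \<tau> i \<le> s then \<eta> i \<omega> else 0) (\<lambda>i \<omega>. if \<tau>' i \<le> s then - \<eta>' i \<omega> else 0)"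
  have \<tau>: "0 \<le> \<tau> i" "\<tau> i \<le> \<tau> (Suc i)" for i
    using S monoD[of \<tau> 0 i] monoD[of \<tau> i "Suc i"] by (auto simp: S_eq)
  have \<tau>': "0 \<le> \<tau>' i" "\<tau>' i \<le> \<tau>' (Suc i)" for i
    using S' monoD[of \<tau>' 0 i] monoD[of \<tau>' i "Suc i"] by (auto simp: S'_eq)
  have elem: "elementary (a k) (b k) (\<theta> k)" if "k \<in> J" for k
  proof (cases k)
    case (Inl i)
    then have "\<eta> i \<in> borel_measurable (\<F> (\<tau> i))" "\<exists>C. \<forall>\<omega>\<in>space M. \<bar>\<eta> i \<omega>\<bar> \<le> C"
      using S that by (auto simp: S_eq J_def)
    then show ?thesis using Inl \<tau>[of i] s
      by (cases "\<tau> i \<le> s") (auto simp: elementary_def a_def b_def \<theta>_def min_def)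
  next
    case (Inr i)
    then have "\<eta>' i \<in> borel_measurable (\<F> (\<tau>' i))" "\<exists>C. \<forall>\<omega>\<in>space M. \<bar>\<eta>' i \<omega>\<bar> \<le> C"
      using S' that by (auto simp: S'_eq J_def)
    then show ?thesis using Inr \<tau>'[of i] s
      by (cases "\<tau>' i \<le> s") (auto simp: elementary_def a_def b_def \<theta>_def min_def)
  qed
  have ito: "simple_ito B S s \<omega> - simple_ito B S' s \<omega> = (\<Sum>k\<in>J. \<theta> k \<omega> * (B (b k) \<omega> - B (a k) \<omega>))" for \<omega>
  proof -
    have 1: "(if \<tau> i \<le> s then \<eta> i \<omega> else 0) * (B (min s (\<tau> (Suc i))) \<omega> - B (min s (\<tau> i)) \<omega>)
       = \<eta> i \<omega> * (B (min s (\<tau> (Suc i))) \<omega> - B (min s (\<tau> i)) \<omega>)" for i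
      using \<tau>(2)[of i] by (cases "\<tau> i \<le> s") (auto simp: min_def)
    have 2: "(if \<tau>' i \<le> s then - \<eta>' i \<omega> else 0) * (B (min s (\<tau>' (Suc i))) \<omega> - B (min s (\<tau>' i)) \<omega>)
       = - (\<eta>' i \<omega> * (B (min s (\<tau>' (Suc i))) \<omega> - B (min s (\<tau>' i)) \<omega>))" for i
      using \<tau>'(2)[of i] by (cases "\<tau>' i \<le> s") (auto simp: min_def)
    show ?thesis
      unfolding J_def by (simp add: sum.Plus a_def b_def \<theta>_def 1 2 S_eq S'_eq sum_negf)
  qed
  have eval: "(\<Sum>k\<in>J. \<theta> k \<omega> * indicator {a k<..b k} t) =
      (simple_eval S t \<omega> - simple_eval S' t \<omega>) * indicator {0..s} t" for \<omega> t
  proof -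
    have 1: "(if \<tau> i \<le> s then \<eta> i \<omega> else 0) * indicator {min s (\<tau> i)<..min s (\<tau> (Suc i))} t
       = \<eta> i \<omega> * indicator {\<tau> i<..\<tau> (Suc i)} t * (indicator {0..s} t :: real)" for i
      using \<tau>[of i] by (auto simp: indicator_def min_def)
    have 2: "(if \<tau>' i \<le> s then - \<eta>' i \<omega> else 0) * indicator {min s (\<tau>' i)<..min s (\<tau>' (Suc i))} t
       = - (\<eta>' i \<omega> * indicator {\<tau>' i<..\<tau>' (Suc i)} t * (indicator {0..s} t :: real))" for i
      using \<tau>'[of i] by (auto simp: indicator_def min_def)
    show ?thesis
      unfolding J_def by (simp add: sum.Plus a_def b_def \<theta>_def 1 2 S_eq S'_eq sum_negf sum_distrib_right left_diff_distrib
          del: sum_mult_indicator)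
  qed
  have "finite J" by (simp add: J_def)
  from elementary_isometry[OF this, of a b \<theta>, OF elem]
  have "(\<integral>\<^sup>+\<omega>. ennreal ((simple_ito B S s \<omega> - simple_ito B S' s \<omega>)\<^sup>2) \<partial>M)
    = (\<integral>\<^sup>+\<omega>. (\<integral>\<^sup>+t. ennreal (((simple_eval S t \<omega> - simple_eval S' t \<omega>) * indicator {0..s} t)\<^sup>2) \<partial>lborel) \<partial>M)"
    by (simp only: ito eval)
  moreover have "ennreal (((simple_eval S t \<omega> - simple_eval S' t \<omega>) * indicator {0..s} t)\<^sup>2)
     = ennreal ((simple_eval S t \<omega> - simple_eval S' t \<omega>)\<^sup>2) * indicator {0..s} t" for t \<omega>
    by (auto simp: indicator_def)
  ultimately show ?thesis by simp
qed

lemma simple_ito_square_integrable: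
  assumes S: "is_simple M \<F> S" and s: "0 \<le> s"
  shows "simple_ito B S s \<in> borel_measurable M" "integrable M (\<lambda>\<omega>. (simple_ito B S s \<omega>)\<^sup>2)"
proof -
  obtain n \<tau> \<eta> where S_eq: "S = (n, \<tau>, \<eta>)" by (cases S)
  have \<tau>: "0 \<le> \<tau> i" "\<tau> i \<le> \<tau> (Suc i)" for i
    using S monoD[of \<tau> 0 i] monoD[of \<tau> i "Suc i"] by (auto simp: S_eq)
  have m: "\<eta> i \<in> borel_measurable M" if "i < n" for i
    using S that \<tau>(1)[of i] by (auto simp: S_eq intro: filt_measurableD)
  have mB: "(\<lambda>\<omega>. B (min s (\<tau> (Suc i))) \<omega> - B (min s (\<tau> i)) \<omega>) \<in> borel_measurable M" for i
    using s \<tau> by (intro borel_measurable_diff B_measurable) auto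
  have 1: "(\<lambda>\<omega>. \<Sum>i<k. \<eta> i \<omega> * (B (min s (\<tau> (Suc i))) \<omega> - B (min s (\<tau> i)) \<omega>)) \<in> borel_measurable M \<and>
     integrable M (\<lambda>\<omega>. (\<Sum>i<k. \<eta> i \<omega> * (B (min s (\<tau> (Suc i))) \<omega> - B (min s (\<tau> i)) \<omega>))\<^sup>2)" if "k \<le> n" for k
    using that
  proof (induction k)
    case (Suc k)
    have "\<exists>C. \<forall>\<omega>\<in>space M. \<bar>\<eta> k \<omega>\<bar> \<le> C" using S Suc.prems by (simp add: S_eq Suc_le_eq)
    then obtain C where C: "\<And>\<omega>. \<omega> \<in> space M \<Longrightarrow> \<bar>\<eta> k \<omega>\<bar> \<le> C" by blast
    have C2: "\<bar>(\<eta> k \<omega>)\<^sup>2\<bar> \<le> C\<^sup>2" if "\<omega> \<in> space M" for \<omega>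
      using C[OF that] by (simp add: abs_le_square_iff[symmetric])
    have "integrable M (\<lambda>\<omega>. (\<eta> k \<omega>)\<^sup>2 * (B (min s (\<tau> (Suc k))) \<omega> - B (min s (\<tau> k)) \<omega>)\<^sup>2)"
      using C2 m[of k] Suc.prems increment_moments(3)[of "min s (\<tau> k)" "min s (\<tau> (Suc k))"] s \<tau>
      by (intro integrable_bounded_mult) (auto simp: min_le_iff_disj min.coboundedI2)
    then show ?case unfolding sum.lessThan_Suc using Suc m[of k] mB[of k]
      by (intro conjI integrable_add_square borel_measurable_add borel_measurable_times) (auto simp: power_mult_distrib)
  qed simp
  then show "simple_ito B S s \<in> borel_measurable M" "integrable M (\<lambda>\<omega>. (simple_ito B S s \<omega>)\<^sup>2)"
    using 1[of n] by (simp_all add: S_eq simple_ito.simps[abs_def] cong: measurable_cong)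
qed

lemma simple_ito_martingale:
  assumes S: "is_simple M \<F> S" and s: "0 \<le> s" "s \<le> u"
    and G: "G \<in> borel_measurable (\<F> s)" "integrable M (\<lambda>\<omega>. (G \<omega>)\<^sup>2)"
  shows "expectation (\<lambda>\<omega>. G \<omega> * (simple_ito B S u \<omega> - simple_ito B S s \<omega>)) = 0"
proof -
  obtain n \<tau> \<eta> where S_eq: "S = (n, \<tau>, \<eta>)" by (cases S)
  have \<tau>: "0 \<le> \<tau> i" "\<tau> i \<le> \<tau> (Suc i)" for i
    using S monoD[of \<tau> 0 i] monoD[of \<tau> i "Suc i"] by (auto simp: S_eq)
  \<comment> \<open>The partition clamped to \<open>[s, u]\<close>; its increments are exactly those
    by which the integral grows between \<open>s\<close> and \<open>u\<close>.\<close>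
  define p where "p i = max s (min u (\<tau> i))" for i
  have p: "s \<le> p i" "p i \<le> u" "p i \<le> p (Suc i)" "0 \<le> p i" for i
    using s \<tau>(2)[of i] by (auto simp: p_def)
  have incr: "B (min u (\<tau> (Suc i))) \<omega> - B (min u (\<tau> i)) \<omega> - (B (min s (\<tau> (Suc i))) \<omega> - B (min s (\<tau> i)) \<omega>)
    = B (p (Suc i)) \<omega> - B (p i) \<omega>" for i \<omega>
    using s \<tau>(2)[of i] by (auto simp: p_def min_def max_def)
  have GM: "G \<in> borel_measurable M" using G s by (intro filt_measurableD)
  have Gi: "integrable M G" using GM G(2) by (rule square_integrable_imp_integrable)
  have orth: "integrable M (\<lambda>\<omega>. G \<omega> * (\<eta> i \<omega> * (B (p (Suc i)) \<omega> - B (p i) \<omega>))) \<and>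
     expectation (\<lambda>\<omega>. G \<omega> * (\<eta> i \<omega> * (B (p (Suc i)) \<omega> - B (p i) \<omega>))) = 0" if i: "i < n" for i
  \<comment> \<open>If \<open>\<tau> i \<le> u\<close>, then \<open>\<tau> i \<le> p i\<close> and
    the coefficient is known at the start of the clamped cell. Otherwise that cell is empty.\<close>
  proof (cases "\<tau> i \<le> u")
    case True
    have "\<exists>C. \<forall>\<omega>\<in>space M. \<bar>\<eta> i \<omega>\<bar> \<le> C" using S i by (simp add: S_eq)
    then obtain C where C: "\<And>\<omega>. \<omega> \<in> space M \<Longrightarrow> \<bar>\<eta> i \<omega>\<bar> \<le> C" by blast
    have "\<eta> i \<in> borel_measurable (\<F> (\<tau> i))" using S i by (auto simp: S_eq)
    then have m: "\<eta> i \<in> borel_measurable (\<F> (p i))" "G \<in> borel_measurable (\<F> (p i))"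
      using True G s \<tau>(1)[of i] by (auto intro: filt_measurable_mono simp: p_def)
    have mM: "\<eta> i \<in> borel_measurable M" using m(1) p by (intro filt_measurableD)
    have "integrable M (\<lambda>\<omega>. \<eta> i \<omega> * G \<omega>)" using C mM Gi by (intro integrable_bounded_mult) auto
    then show ?thesis
      using filt_increment_orthogonal[of "p i" "p (Suc i)" "\<lambda>\<omega>. \<eta> i \<omega> * G \<omega>"] p m
      by (simp add: mult_ac)
  next
    case False
    then have "p i = p (Suc i)" using \<tau>(2)[of i] by (simp add: p_def)
    then show ?thesis by simp
  qed
  have "(\<lambda>\<omega>. G \<omega> * (simple_ito B S u \<omega> - simple_ito B S s \<omega>))
    = (\<lambda>\<omega>. \<Sum>i<n. G \<omega> * (\<eta> i \<omega> * (B (p (Suc i)) \<omega> - B (p i) \<omega>)))"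
    by (simp add: S_eq sum_subtractf[symmetric] right_diff_distrib[symmetric] incr sum_distrib_left)
  then show ?thesis using orth by (simp add: Bochner_Integration.integral_sum)
qed

text \<open>\<open>has_ito_integral\<close> supplies an approximating sequence for each horizon
  separately, with no relation between the sequences. The identity involves two times, so the
  sequences for the horizons \<open>s\<close> and \<open>u\<close> have to be compared at time
  \<open>s\<close>. Both approximate \<open>Z\<close> on \<open>[0, s]\<close>, and the isometry
  turns this into closeness of their integrals.\<close>

lemma ito_martingale:
  assumes Z: "(\<lambda>(t, \<omega>). Z t \<omega>) \<in> borel_measurable (time_axis \<Otimes>\<^sub>M M)"
    and I: "has_ito_integral M \<F> B Z I"
  shows "0 \<le> s \<Longrightarrow> I s \<in> borel_measurable M" "0 \<le> s \<Longrightarrow> integrable M (\<lambda>\<omega>. (I s \<omega>)\<^sup>2)"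
    "0 \<le> s \<Longrightarrow> s \<le> u \<Longrightarrow> G \<in> borel_measurable (\<F> s) \<Longrightarrow> integrable M (\<lambda>\<omega>. (G \<omega>)\<^sup>2) \<Longrightarrow>
       expectation (\<lambda>\<omega>. G \<omega> * (I u \<omega> - I s \<omega>)) = 0"
proof -
  let ?err = "\<lambda>T S. \<integral>\<^sup>+\<omega>. (\<integral>\<^sup>+t\<in>{0..T}. ennreal ((Z t \<omega> - simple_eval S t \<omega>)\<^sup>2) \<partial>lborel) \<partial>M"
  let ?dif = "\<lambda>T S. \<integral>\<^sup>+\<omega>. ennreal ((I T \<omega> - simple_ito B S T \<omega>)\<^sup>2) \<partial>M"
  have ex: "\<exists>S. (\<forall>k. is_simple M \<F> (S k)) \<and> (\<lambda>k. ?err T (S k)) \<longlonglongrightarrow> 0 \<and> (\<lambda>k. ?dif T (S k)) \<longlonglongrightarrow> 0"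
    if "0 \<le> T" for T
    using I that by (auto simp: has_ito_integral_def)
  have mI: "I s \<in> borel_measurable M" if "0 \<le> s" for s
    using I that by (auto simp: has_ito_integral_def intro: filt_measurableD)
  then show "0 \<le> s \<Longrightarrow> I s \<in> borel_measurable M" .
  have I2: "integrable M (\<lambda>\<omega>. (I s \<omega>)\<^sup>2)" if s: "0 \<le> s" for s
  proof -
    obtain S where S: "\<And>k. is_simple M \<F> (S k)" "(\<lambda>k. ?dif s (S k)) \<longlonglongrightarrow> 0" using ex[OF s] by blast
    from S(2) have "\<forall>\<^sub>F k in sequentially. ?dif s (S k) < 1" by (rule order_tendstoD) simp
    then obtain k where k: "?dif s (S k) < 1" by (auto simp: eventually_sequentially)
    note m = simple_ito_square_integrable[OF S(1) s, of k]
    have "integrable M (\<lambda>\<omega>. (I s \<omega> - simple_ito B (S k) s \<omega>)\<^sup>2)"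
      using k m mI[OF s] by (intro integrableI_bounded) (auto intro: order_less_trans)
    from integrable_add_square[OF _ m(1) this m(2)] m mI[OF s] show ?thesis by simp
  qed
  then show "0 \<le> s \<Longrightarrow> integrable M (\<lambda>\<omega>. (I s \<omega>)\<^sup>2)" .
  assume s: "0 \<le> s" "s \<le> u" and G: "G \<in> borel_measurable (\<F> s)" "integrable M (\<lambda>\<omega>. (G \<omega>)\<^sup>2)"
  have u: "0 \<le> u" using s by simp
  obtain S where S: "\<And>k. is_simple M \<F> (S k)" "(\<lambda>k. ?err u (S k)) \<longlonglongrightarrow> 0" "(\<lambda>k. ?dif u (S k)) \<longlonglongrightarrow> 0"
    using ex[OF u] by blast
  obtain S' where S': "\<And>k. is_simple M \<F> (S' k)" "(\<lambda>k. ?err s (S' k)) \<longlonglongrightarrow> 0" "(\<lambda>k. ?dif s (S' k)) \<longlonglongrightarrow> 0"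
    using ex[OF s(1)] by blast
  \<comment> \<open>Using the sequence for horizon \<open>u\<close> at both times keeps the
    martingale identity exact. The price is the error at time \<open>s\<close>, which is controlled
    through \<open>S'\<close> and \<open>?mid\<close>.\<close>
  define R where "R k \<omega> = I u \<omega> - I s \<omega> - (simple_ito B (S k) u \<omega> - simple_ito B (S k) s \<omega>)" for k \<omega>
  let ?mid = "\<lambda>k. \<integral>\<^sup>+\<omega>. ennreal ((simple_ito B (S k) s \<omega> - simple_ito B (S' k) s \<omega>)\<^sup>2) \<partial>M"
  have GM: "G \<in> borel_measurable M" using G s by (intro filt_measurableD)
  note iS = simple_ito_square_integrable[OF S(1)] and iS' = simple_ito_square_integrable[OF S'(1)]
  have mR: "R k \<in> borel_measurable M" for k
    unfolding R_def using mI s u iS(1) by (intro borel_measurable_diff) auto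
  show "expectation (\<lambda>\<omega>. G \<omega> * (I u \<omega> - I s \<omega>)) = 0"
  proof (rule integral_zero_of_L2_approx[OF GM mR G(2)])
    fix k
    have i1: "integrable M (\<lambda>\<omega>. G \<omega> * (I u \<omega> - I s \<omega>))"
      using GM G mI I2 s u by (intro integrable_mult_square integrable_diff_square borel_measurable_diff) auto
    have i2: "integrable M (\<lambda>\<omega>. G \<omega> * (simple_ito B (S k) u \<omega> - simple_ito B (S k) s \<omega>))"
      using GM G iS s u by (intro integrable_mult_square integrable_diff_square borel_measurable_diff) auto
    show "expectation (\<lambda>\<omega>. G \<omega> * R k \<omega>) = expectation (\<lambda>\<omega>. G \<omega> * (I u \<omega> - I s \<omega>))"
      unfolding R_def using Bochner_Integration.integral_diff[OF i1 i2] simple_ito_martingale[OF S(1) s G, of k]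
      by (simp add: right_diff_distrib)
  next
    \<comment> \<open>\<open>Z\<close> is known to be measurable at nonnegative times only. Clamping
      time at 0 makes it measurable on the whole line and leaves the integrals over
      \<open>{0..T}\<close> unchanged.\<close>
    define Zp where "Zp t \<omega> = Z (max 0 t) \<omega>" for t \<omega>
    have Zp: "(\<lambda>(\<omega>, t). Zp t \<omega>) \<in> borel_measurable (M \<Otimes>\<^sub>M lborel)"
    proof -
      have "(\<lambda>(\<omega>, t). (max 0 t, \<omega>)) \<in> measurable (M \<Otimes>\<^sub>M lborel) (time_axis \<Otimes>\<^sub>M M)"
        by (auto intro!: measurable_Pair measurable_restrict_space2 simp: split_beta')
      from measurable_compose[OF this Z] show ?thesis by (simp add: Zp_def split_beta')
    qed
    have inner: "(\<lambda>(\<omega>, t). ennreal ((Z t \<omega> - simple_eval S t \<omega>)\<^sup>2) * indicator {0..T} t)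
       \<in> borel_measurable (M \<Otimes>\<^sub>M lborel)" if "is_simple M \<F> S" for S T
    proof -
      obtain n \<tau> \<eta> where S: "S = (n, \<tau>, \<eta>)" by (cases S)
      have "0 \<le> \<tau> i" for i using that monoD[of \<tau> 0 i] by (auto simp: S)
      then have "\<eta> i \<in> borel_measurable M" if "i < n" for i
        using \<open>is_simple M \<F> S\<close> that by (auto simp: S intro: filt_measurableD)
      then have "(\<lambda>(\<omega>, t). simple_eval S t \<omega>) \<in> borel_measurable (M \<Otimes>\<^sub>M lborel)"
        unfolding S simple_eval.simps split_beta'
        by (intro borel_measurable_sum borel_measurable_times) auto
      with Zp have "(\<lambda>z. ennreal ((Zp (snd z) (fst z) - simple_eval S (snd z) (fst z))\<^sup>2) * indicator {0..T} (snd z))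
         \<in> borel_measurable (M \<Otimes>\<^sub>M lborel)" unfolding split_beta' by measurable
      moreover have "(\<lambda>z. ennreal ((Zp (snd z) (fst z) - simple_eval S (snd z) (fst z))\<^sup>2) * indicator {0..T} (snd z))
         = (\<lambda>(\<omega>, t). ennreal ((Z t \<omega> - simple_eval S t \<omega>)\<^sup>2) * indicator {0..T} t)"
        by (auto simp: fun_eq_iff Zp_def indicator_def)
      ultimately show ?thesis by simp
    qed
    have outer: "(\<lambda>\<omega>. \<integral>\<^sup>+t\<in>{0..T}. ennreal ((Z t \<omega> - simple_eval S t \<omega>)\<^sup>2) \<partial>lborel) \<in> borel_measurable M"
      if "is_simple M \<F> S" for S T
      using lborel.borel_measurable_nn_integral[OF inner[OF that, of T]] by simp
    have mid: "?mid k \<le> 2 * ?err u (S k) + 2 * ?err s (S' k)" for k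
    proof -
      let ?e = "\<lambda>T S \<omega>. \<integral>\<^sup>+t\<in>{0..T}. ennreal ((Z t \<omega> - simple_eval S t \<omega>)\<^sup>2) \<partial>lborel"
      have pt: "ennreal ((x - y)\<^sup>2) \<le> 2 * ennreal ((z - x)\<^sup>2) + 2 * ennreal ((z - y)\<^sup>2)" for x y z :: real
      proof -
        have "(x - y)\<^sup>2 \<le> 2 * (z - x)\<^sup>2 + 2 * (z - y)\<^sup>2"
          using square_diff_le[of x y z] by (simp add: power2_commute)
        then have "ennreal ((x - y)\<^sup>2) \<le> ennreal (2 * (z - x)\<^sup>2 + 2 * (z - y)\<^sup>2)" by (rule ennreal_leI)
        also have "\<dots> = 2 * ennreal ((z - x)\<^sup>2) + 2 * ennreal ((z - y)\<^sup>2)"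
          by (simp add: ennreal_plus ennreal_mult)
        finally show ?thesis .
      qed
      have "(\<integral>\<^sup>+t\<in>{0..s}. ennreal ((simple_eval (S k) t \<omega> - simple_eval (S' k) t \<omega>)\<^sup>2) \<partial>lborel)
        \<le> 2 * ?e u (S k) \<omega> + 2 * ?e s (S' k) \<omega>" if "\<omega> \<in> space M" for \<omega>
      proof -
        have m: "(\<lambda>t. ennreal ((Z t \<omega> - simple_eval S t \<omega>)\<^sup>2) * indicator {0..T} t) \<in> borel_measurable lborel"
          if "is_simple M \<F> S" for S T
          using measurable_compose[OF measurable_Pair1'[OF \<open>\<omega> \<in> space M\<close>, of lborel] inner[OF that, of T]] by simp
        have "(\<integral>\<^sup>+t\<in>{0..s}. ennreal ((simple_eval (S k) t \<omega> - simple_eval (S' k) t \<omega>)\<^sup>2) \<partial>lborel)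
          \<le> (\<integral>\<^sup>+t. 2 * (ennreal ((Z t \<omega> - simple_eval (S k) t \<omega>)\<^sup>2) * indicator {0..u} t)
             + 2 * (ennreal ((Z t \<omega> - simple_eval (S' k) t \<omega>)\<^sup>2) * indicator {0..s} t) \<partial>lborel)"
          using pt s by (intro nn_integral_mono) (auto simp: indicator_def)
        also have "\<dots> = 2 * ?e u (S k) \<omega> + 2 * ?e s (S' k) \<omega>"
          using m[OF S(1)] m[OF S'(1)] by (simp add: nn_integral_add nn_integral_cmult)
        finally show ?thesis .
      qed
      then have "?mid k \<le> (\<integral>\<^sup>+\<omega>. 2 * ?e u (S k) \<omega> + 2 * ?e s (S' k) \<omega> \<partial>M)"
        unfolding simple_ito_diff_isometry[OF S(1) S'(1) s(1)] by (intro nn_integral_mono)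
      also have "\<dots> = 2 * ?err u (S k) + 2 * ?err s (S' k)"
        using outer[OF S(1)] outer[OF S'(1)] by (simp add: nn_integral_add nn_integral_cmult)
      finally show ?thesis .
    qed
    have "(\<integral>\<^sup>+\<omega>. ennreal ((R k \<omega>)\<^sup>2) \<partial>M) \<le> 3 * ?dif u (S k) + 3 * ?mid k + 3 * ?dif s (S' k)" for k
    proof -
      have *: "ennreal ((R k \<omega>)\<^sup>2) \<le> 3 * ennreal ((I u \<omega> - simple_ito B (S k) u \<omega>)\<^sup>2)
         + 3 * ennreal ((simple_ito B (S k) s \<omega> - simple_ito B (S' k) s \<omega>)\<^sup>2)
         + 3 * ennreal ((I s \<omega> - simple_ito B (S' k) s \<omega>)\<^sup>2)" for \<omega>
      proof -
        have sq3: "(x + y - z)\<^sup>2 \<le> 3 * x\<^sup>2 + 3 * y\<^sup>2 + 3 * z\<^sup>2" for x y z :: real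
        proof -
          have "3 * x\<^sup>2 + 3 * y\<^sup>2 + 3 * z\<^sup>2 - (x + y - z)\<^sup>2 = (x - y)\<^sup>2 + (x + z)\<^sup>2 + (y + z)\<^sup>2"
            by (simp add: power2_eq_square algebra_simps)
          then show ?thesis using zero_le_power2[of "x - y"] zero_le_power2[of "x + z"] zero_le_power2[of "y + z"] by linarith
        qed
        have "R k \<omega> = (I u \<omega> - simple_ito B (S k) u \<omega>)
          + (simple_ito B (S k) s \<omega> - simple_ito B (S' k) s \<omega>) - (I s \<omega> - simple_ito B (S' k) s \<omega>)"
          by (simp add: R_def)
        then have "(R k \<omega>)\<^sup>2 \<le> 3 * (I u \<omega> - simple_ito B (S k) u \<omega>)\<^sup>2
         + 3 * (simple_ito B (S k) s \<omega> - simple_ito B (S' k) s \<omega>)\<^sup>2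
         + 3 * (I s \<omega> - simple_ito B (S' k) s \<omega>)\<^sup>2" by (simp only: sq3)
        then have "ennreal ((R k \<omega>)\<^sup>2) \<le> ennreal (3 * (I u \<omega> - simple_ito B (S k) u \<omega>)\<^sup>2
         + 3 * (simple_ito B (S k) s \<omega> - simple_ito B (S' k) s \<omega>)\<^sup>2
         + 3 * (I s \<omega> - simple_ito B (S' k) s \<omega>)\<^sup>2)" by (rule ennreal_leI)
        then show ?thesis by (simp add: ennreal_plus ennreal_mult)
      qed
      have "(\<integral>\<^sup>+\<omega>. ennreal ((R k \<omega>)\<^sup>2) \<partial>M) \<le> (\<integral>\<^sup>+\<omega>. 3 * ennreal ((I u \<omega> - simple_ito B (S k) u \<omega>)\<^sup>2)
         + 3 * ennreal ((simple_ito B (S k) s \<omega> - simple_ito B (S' k) s \<omega>)\<^sup>2)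
         + 3 * ennreal ((I s \<omega> - simple_ito B (S' k) s \<omega>)\<^sup>2) \<partial>M)"
        by (intro nn_integral_mono *)
      also have "\<dots> = 3 * ?dif u (S k) + 3 * ?mid k + 3 * ?dif s (S' k)"
        using mI[OF s(1)] mI[OF u] iS(1)[OF s(1)] iS(1)[OF u] iS'(1)[OF s(1)]
        by (simp add: nn_integral_add nn_integral_cmult)
      finally show ?thesis .
    qed
    also have "\<dots> k \<le> 3 * ?dif u (S k) + 3 * (2 * ?err u (S k) + 2 * ?err s (S' k)) + 3 * ?dif s (S' k)" for k
      using mid by (intro add_mono mult_left_mono) auto
    finally have le: "(\<integral>\<^sup>+\<omega>. ennreal ((R k \<omega>)\<^sup>2) \<partial>M) \<le>
        3 * ?dif u (S k) + 3 * (2 * ?err u (S k) + 2 * ?err s (S' k)) + 3 * ?dif s (S' k)" for k .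
    have "(\<lambda>k. 3 * ?dif u (S k) + 3 * (2 * ?err u (S k) + 2 * ?err s (S' k)) + 3 * ?dif s (S' k))
      \<longlonglongrightarrow> 3 * 0 + 3 * (2 * 0 + 2 * 0) + 3 * 0"
      by (intro tendsto_add tendsto_mult_ennreal tendsto_const S S') auto
    then have z: "(\<lambda>k. 3 * ?dif u (S k) + 3 * (2 * ?err u (S k) + 2 * ?err s (S' k)) + 3 * ?dif s (S' k)) \<longlonglongrightarrow> 0"
      by simp
    show "(\<lambda>k. \<integral>\<^sup>+\<omega>. ennreal ((R k \<omega>)\<^sup>2) \<partial>M) \<longlonglongrightarrow> 0"
      using le by (intro tendsto_sandwich[OF _ _ tendsto_const z] always_eventually allI) auto
  qed
qed

end

section \<open>Wasserstein distance, localization and integration by parts\<close>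

text \<open>The joint law of \<open>U\<close> and \<open>V\<close> is one admissible coupling, and
  the costs are bounded below by 0.\<close>

lemma W2_distr_le:
  assumes [measurable]: "U \<in> borel_measurable M" "V \<in> borel_measurable M"
  shows "W2 (distr M borel U) (distr M borel V) \<le> sqrt (\<integral>\<omega>. (U \<omega> - V \<omega>)\<^sup>2 \<partial>M)"
proof -
  let ?\<pi> = "distr M (borel \<Otimes>\<^sub>M borel) (\<lambda>\<omega>. (U \<omega>, V \<omega>))"
  have "?\<pi> \<in> couplings (distr M borel U) (distr M borel V)"
    by (auto simp: couplings_def distr_distr comp_def)
  then have "(INF \<pi>\<in>couplings (distr M borel U) (distr M borel V). \<integral>z. \<bar>fst z - snd z\<bar>\<^sup>2 \<partial>\<pi>) \<le> (\<integral>z. \<bar>fst z - snd z\<bar>\<^sup>2 \<partial>?\<pi>)"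
    by (intro cINF_lower bdd_belowI[of _ 0]) auto
  also have "\<dots> = (\<integral>\<omega>. (U \<omega> - V \<omega>)\<^sup>2 \<partial>M)" by (subst integral_distr) auto
  finally show ?thesis unfolding W2_def by (rule real_sqrt_le_mono)
qed

text \<open>The diagonal coupling has cost 0. It also shows that there is a coupling at all, without
  which the infimum would have no lower bound of the required kind.\<close>

lemma W2_self:
  assumes "sets \<mu> = sets borel"
  shows "W2 \<mu> \<mu> = 0"
proof -
  have [measurable]: "(\<lambda>x. x) \<in> borel_measurable \<mu>"
    using assms by (simp add: measurable_ident_sets)
  have \<mu>: "distr \<mu> borel (\<lambda>x. x) = \<mu>" using assms by (intro distr_id2) simp
  have "distr \<mu> (borel \<Otimes>\<^sub>M borel) (\<lambda>x. (x, x)) \<in> couplings \<mu> \<mu>"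
    using \<mu> by (auto simp: couplings_def distr_distr comp_def)
  then have "(INF \<pi>\<in>couplings \<mu> \<mu>. \<integral>z. \<bar>fst z - snd z\<bar>\<^sup>2 \<partial>\<pi>) \<ge> 0"
    by (intro cINF_greatest) auto
  moreover have "W2 \<mu> \<mu> \<le> 0" using W2_distr_le[of "\<lambda>x. x" \<mu> "\<lambda>x. x"] \<mu> by simp
  ultimately show ?thesis unfolding W2_def by (simp add: order_antisym)
qed

text \<open>The slabs of width \<open>\<delta>\<close> partition the space, so bounds proportional
  to their probabilities add up to \<open>C * \<delta>\<close> times the total mass 1, although the
  slabs are infinitely many.\<close>

lemma AE_zero_of_slab_bounds:
  fixes f :: "'a \<Rightarrow> ennreal" and \<xi> :: "'a \<Rightarrow> real"
  assumes M: "prob_space M" and f [measurable]: "f \<in> borel_measurable M" and \<xi> [measurable]: "\<xi> \<in> borel_measurable M"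
    and bound: "\<And>x \<delta>. 0 < \<delta> \<Longrightarrow> \<delta> \<le> 1 \<Longrightarrow>
      (\<integral>\<^sup>+\<omega>\<in>{\<omega>\<in>space M. x \<le> \<xi> \<omega> \<and> \<xi> \<omega> < x + \<delta>}. f \<omega> \<partial>M) \<le> ennreal (C * \<delta>) * emeasure M {\<omega>\<in>space M. x \<le> \<xi> \<omega> \<and> \<xi> \<omega> < x + \<delta>}"
  shows "AE \<omega> in M. f \<omega> = 0"
proof -
  interpret prob_space M by fact
  have le: "(\<integral>\<^sup>+\<omega>. f \<omega> \<partial>M) \<le> ennreal (C * \<delta>)" if \<delta>: "0 < \<delta>" "\<delta> \<le> 1" for \<delta>
  proof -
    define A where "A k = {\<omega>\<in>space M. of_int k * \<delta> \<le> \<xi> \<omega> \<and> \<xi> \<omega> < of_int k * \<delta> + \<delta>}" for k :: int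
    have A[measurable]: "A k \<in> sets M" for k unfolding A_def by measurable
    have eqA: "\<omega> \<in> A k \<longleftrightarrow> \<omega> \<in> space M \<and> k = \<lfloor>\<xi> \<omega> / \<delta>\<rfloor>" for \<omega> k
      using \<delta> floor_eq_iff[of "\<xi> \<omega> / \<delta>" k] by (auto simp: A_def field_simps)
    have disj: "disjoint_family A" by (auto simp: disjoint_family_on_def eqA)
    have un: "(\<Union>k. A k) = space M" by (auto simp: eqA)
    \<comment> \<open>With \<open>f\<close> as a density, summing over slabs is countable additivity
      of a measure.\<close>
    have "(\<integral>\<^sup>+\<omega>. f \<omega> \<partial>M) = emeasure (density M f) (\<Union>k\<in>UNIV. A k)"
      by (simp add: un emeasure_density cong: nn_integral_cong)
    also have "\<dots> = (\<integral>\<^sup>+k. emeasure (density M f) (A k) \<partial>count_space UNIV)"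
      using disj by (intro emeasure_UN_countable) auto
    also have "\<dots> \<le> (\<integral>\<^sup>+k. ennreal (C * \<delta>) * emeasure M (A k) \<partial>count_space UNIV)"
      using bound[OF \<delta>] by (intro nn_integral_mono) (simp add: emeasure_density A_def)
    also have "\<dots> = ennreal (C * \<delta>) * (\<integral>\<^sup>+k. emeasure M (A k) \<partial>count_space UNIV)"
      by (rule nn_integral_cmult) simp
    also have "(\<integral>\<^sup>+k. emeasure M (A k) \<partial>count_space UNIV) = emeasure M (\<Union>k\<in>UNIV. A k)"
      using disj by (intro emeasure_UN_countable[symmetric]) auto
    finally show ?thesis by (simp add: un emeasure_space_1)
  qed
  have "(\<lambda>n. ennreal (C * inverse (real (Suc n)))) \<longlonglongrightarrow> ennreal (C * 0)"
    by (intro tendsto_ennrealI tendsto_mult tendsto_const LIMSEQ_inverse_real_of_nat)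
  then have "(\<integral>\<^sup>+\<omega>. f \<omega> \<partial>M) \<le> 0"
    using le[of "inverse (real (Suc n))" for n] by (intro LIMSEQ_le_const) (auto simp: inverse_le_1_iff)
  then show ?thesis by (simp add: nn_integral_0_iff_AE)
qed

text \<open>\<open>F\<close> and \<open>G\<close> are merely integrals of integrable functions, so
  no pointwise derivative is at hand. The product of the two integrals is an integral over a square;
  splitting the square along the diagonal and applying Fubini to each half gives the two
  terms.\<close>

lemma lebesgue_integration_by_parts:
  fixes f g F G :: "real \<Rightarrow> real"
  assumes T: "0 \<le> T" and f: "set_integrable lborel {0..T} f" and g: "set_integrable lborel {0..T} g"
    and F: "\<And>t. 0 \<le> t \<Longrightarrow> t \<le> T \<Longrightarrow> F t = F0 + (LBINT s:{0..t}. f s)"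
    and G: "\<And>t. 0 \<le> t \<Longrightarrow> t \<le> T \<Longrightarrow> G t = G0 + (LBINT s:{0..t}. g s)"
  shows "set_integrable lborel {0..T} (\<lambda>s. f s * G s)" "set_integrable lborel {0..T} (\<lambda>s. F s * g s)"
    "F T * G T = F0 * G0 + (LBINT s:{0..T}. f s * G s + F s * g s)"
proof -
  define f1 where "f1 s = indicator {0..T} s * f s" for s
  define g1 where "g1 s = indicator {0..T} s * g s" for s
  have f1: "integrable lborel f1" and g1: "integrable lborel g1"
    using f g by (simp_all add: set_integrable_def f1_def[abs_def] g1_def[abs_def])
  have [measurable]: "f1 \<in> borel_measurable borel" "g1 \<in> borel_measurable borel"
    using f1 g1 by (auto dest: borel_measurable_integrable)
  have If: "(\<integral>s. f1 s * indicator {..t} s \<partial>lborel) = F t - F0" if "0 \<le> t" "t \<le> T" for t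
  proof -
    have "(\<integral>s. f1 s * indicator {..t} s \<partial>lborel) = (LBINT s:{0..t}. f s)"
      unfolding set_lebesgue_integral_def f1_def
      using that by (intro Bochner_Integration.integral_cong) (auto simp: indicator_def)
    then show ?thesis using F[OF that] by simp
  qed
  have Ig: "(\<integral>s. g1 s * indicator {..t} s \<partial>lborel) = G t - G0" if "0 \<le> t" "t \<le> T" for t
  proof -
    have "(\<integral>s. g1 s * indicator {..t} s \<partial>lborel) = (LBINT s:{0..t}. g s)"
      unfolding set_lebesgue_integral_def g1_def
      using that by (intro Bochner_Integration.integral_cong) (auto simp: indicator_def)
    then show ?thesis using G[OF that] by simp
  qed
  \<comment> \<open>The halves are \<open>u \<le> s\<close> and \<open>s < u\<close>, so that the
    diagonal is counted once. The open endpoint in the second half costs only a null set.\<close>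
  have If': "(\<integral>s. f1 s * indicator {..<t} s \<partial>lborel) = F t - F0" if "0 \<le> t" "t \<le> T" for t
  proof -
    have "AE s in lborel. f1 s * indicator {..<t} s = f1 s * indicator {..t} s"
      using AE_lborel_singleton[of t] by eventually_elim (auto simp: indicator_def)
    then have "(\<integral>s. f1 s * indicator {..<t} s \<partial>lborel) = (\<integral>s. f1 s * indicator {..t} s \<partial>lborel)"
      by (intro integral_cong_AE) auto
    then show ?thesis using If[OF that] by simp
  qed
  define h where "h = (\<lambda>(s, u). f1 s * g1 u)"
  have h: "integrable (lborel \<Otimes>\<^sub>M lborel) h"
  proof (rule lborel_pair.Fubini_integrable)
    show "h \<in> borel_measurable (lborel \<Otimes>\<^sub>M lborel)" unfolding h_def by measurable
    show "integrable lborel (\<lambda>x. LINT y|lborel. norm (h (x, y)))"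
      using f1 g1 by (simp add: h_def abs_mult)
    show "AE x in lborel. integrable lborel (\<lambda>y. h (x, y))" using g1 by (simp add: h_def)
  qed
  define h1 where "h1 = (\<lambda>(s, u). f1 s * (g1 u * indicator {..s} u))"
  define h2 where "h2 = (\<lambda>(s, u). g1 u * (f1 s * indicator {..<u} s))"
  have mh1: "h1 \<in> borel_measurable (lborel \<Otimes>\<^sub>M lborel)"
  proof -
    have "h1 = (\<lambda>z. f1 (fst z) * (g1 (snd z) * (if snd z \<le> fst z then 1 else 0)))"
      by (auto simp: h1_def fun_eq_iff)
    then show ?thesis by simp
  qed
  have mh2: "h2 \<in> borel_measurable (lborel \<Otimes>\<^sub>M lborel)"
  proof -
    have "h2 = (\<lambda>z. g1 (snd z) * (f1 (fst z) * (if fst z < snd z then 1 else 0)))"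
      by (auto simp: h2_def fun_eq_iff)
    then show ?thesis by simp
  qed
  have h1: "integrable (lborel \<Otimes>\<^sub>M lborel) h1"
    using h mh1 by (rule Bochner_Integration.integrable_bound) (auto simp: h_def h1_def indicator_def abs_mult)
  have h2: "integrable (lborel \<Otimes>\<^sub>M lborel) h2"
    using h mh2 by (rule Bochner_Integration.integrable_bound) (auto simp: h_def h2_def indicator_def abs_mult)
  have h12: "h = (\<lambda>z. h1 z + h2 z)"
    by (auto simp: h_def h1_def h2_def fun_eq_iff indicator_def)
  have e1: "(\<integral>u. h1 (s, u) \<partial>lborel) = indicator {0..T} s * (f s * (G s - G0))" for s
    using Ig[of s] by (auto simp: h1_def f1_def indicator_def)
  have e2: "(\<integral>s. h2 (s, u) \<partial>lborel) = indicator {0..T} u * (g u * (F u - F0))" for u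
    using If'[of u] by (auto simp: h2_def g1_def indicator_def)
  have i1: "set_integrable lborel {0..T} (\<lambda>s. f s * (G s - G0))"
    using lborel_pair.integrable_fst'[OF h1] by (simp add: e1 set_integrable_def)
  have i2: "set_integrable lborel {0..T} (\<lambda>u. g u * (F u - F0))"
    using lborel_pair.integrable_snd[of "\<lambda>s u. h2 (s, u)"] h2 by (simp add: e2 set_integrable_def)
  have s1: "set_integrable lborel {0..T} (\<lambda>s. f s * G0)" and s2: "set_integrable lborel {0..T} (\<lambda>u. g u * F0)"
    using f g by auto
  show fG: "set_integrable lborel {0..T} (\<lambda>s. f s * G s)"
    using set_integral_add(1)[OF i1 s1] by (simp add: algebra_simps)
  show Fg: "set_integrable lborel {0..T} (\<lambda>s. F s * g s)"
    using set_integral_add(1)[OF i2 s2] by (simp add: algebra_simps)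
  have "(F T - F0) * (G T - G0) = (\<integral>z. h z \<partial>(lborel \<Otimes>\<^sub>M lborel))"
  proof -
    have "(\<integral>z. h z \<partial>(lborel \<Otimes>\<^sub>M lborel)) = (\<integral>s. (\<integral>u. h (s, u) \<partial>lborel) \<partial>lborel)"
      using lborel_pair.integral_fst'[OF h] by simp
    also have "\<dots> = (\<integral>s. f1 s \<partial>lborel) * (\<integral>u. g1 u \<partial>lborel)" by (simp add: h_def)
    also have "(\<integral>s. f1 s \<partial>lborel) = (\<integral>s. f1 s * indicator {..T} s \<partial>lborel)"
      by (intro Bochner_Integration.integral_cong) (auto simp: f1_def indicator_def)
    also have "\<dots> = F T - F0" using If[of T] T by simp
    also have "(\<integral>s. g1 s \<partial>lborel) = (\<integral>s. g1 s * indicator {..T} s \<partial>lborel)"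
      by (intro Bochner_Integration.integral_cong) (auto simp: g1_def indicator_def)
    also have "\<dots> = G T - G0" using Ig[of T] T by simp
    finally show ?thesis by simp
  qed
  also have "\<dots> = (\<integral>z. h1 z \<partial>(lborel \<Otimes>\<^sub>M lborel)) + (\<integral>z. h2 z \<partial>(lborel \<Otimes>\<^sub>M lborel))"
    unfolding h12 using h1 h2 by (rule Bochner_Integration.integral_add)
  also have "(\<integral>z. h1 z \<partial>(lborel \<Otimes>\<^sub>M lborel)) = (LBINT s:{0..T}. f s * (G s - G0))"
    using lborel_pair.integral_fst'[OF h1] by (simp add: e1 set_lebesgue_integral_def)
  also have "(\<integral>z. h2 z \<partial>(lborel \<Otimes>\<^sub>M lborel)) = (LBINT u:{0..T}. g u * (F u - F0))"
    using lborel_pair.integral_snd[of "\<lambda>s u. h2 (s, u)"] h2 by (simp add: e2 set_lebesgue_integral_def)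
  finally have *: "(F T - F0) * (G T - G0) = (LBINT s:{0..T}. f s * (G s - G0)) + (LBINT u:{0..T}. g u * (F u - F0))" .
  have a: "(LBINT s:{0..T}. f s * (G s - G0)) = (LBINT s:{0..T}. f s * G s) - (F T - F0) * G0"
    using set_integral_diff(2)[OF fG s1] F[of T] T by (simp add: algebra_simps)
  have b: "(LBINT u:{0..T}. g u * (F u - F0)) = (LBINT u:{0..T}. F u * g u) - (G T - G0) * F0"
    using set_integral_diff(2)[OF Fg s2] G[of T] T by (simp add: algebra_simps)
  show "F T * G T = F0 * G0 + (LBINT s:{0..T}. f s * G s + F s * g s)"
    using * unfolding a b set_integral_add(2)[OF fG Fg] by (simp add: algebra_simps)
qed

section \<open>Processes locally square integrable on time and probability space\<close>

text \<open>A class closed under sums, time integrals and Lipschitz coefficients, in which products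
  are integrable over \<open>[0,T]\<close> and the sample space; every exchange of time and
  expectation rests on it. Measurability is asked on the whole line, integrability on
  \<open>[0,T]\<close> only.\<close>

definition loc_L2 :: "'a measure \<Rightarrow> (real \<Rightarrow> 'a \<Rightarrow> real) \<Rightarrow> bool" where
  "loc_L2 M v \<longleftrightarrow> (\<lambda>(t, \<omega>). v t \<omega>) \<in> borel_measurable (borel \<Otimes>\<^sub>M M) \<and>
     (\<forall>T\<ge>0. integrable (lborel \<Otimes>\<^sub>M M) (\<lambda>(t, \<omega>). indicator {0..T} t * (v t \<omega>)\<^sup>2))"

lemma measurable_lborel_pair: "measurable (lborel \<Otimes>\<^sub>M M) N = measurable (borel \<Otimes>\<^sub>M M) N"
  by (intro measurable_cong_sets sets_pair_measure_cong) auto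

lemma set_integral_singleton:
  fixes f :: "real \<Rightarrow> real"
  shows "(LBINT s:{t}. f s) = 0"
  unfolding set_lebesgue_integral_def
  by (intro integral_eq_zero_AE eventually_mono[OF AE_lborel_singleton[of t]]) (auto simp: indicator_def)

lemma integrable_indicator_Icc [simp]: "integrable lborel (indicator {a..b::real} :: real \<Rightarrow> real)"
  by (cases "a \<le> b") auto

lemma borel_measurable_section:
  assumes "(\<lambda>(t, \<omega>). v t \<omega>) \<in> borel_measurable (N \<Otimes>\<^sub>M M)"
  shows "t \<in> space N \<Longrightarrow> v t \<in> borel_measurable M" "\<omega> \<in> space M \<Longrightarrow> (\<lambda>t. v t \<omega>) \<in> borel_measurable N"
  using measurable_compose[OF measurable_Pair1' assms] measurable_compose[OF measurable_Pair2' assms] by auto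

lemma abs_set_integral_Icc_le:
  fixes g :: "real \<Rightarrow> real"
  assumes g: "set_integrable lborel {0..T} g" and t: "0 \<le> t" "t \<le> T"
  shows "\<bar>LBINT s:{0..t}. g s\<bar> \<le> (LBINT s:{0..T}. \<bar>g s\<bar>)"
proof -
  have i: "set_integrable lborel {0..T} (\<lambda>s. \<bar>g s\<bar>)" "set_integrable lborel {0..t} (\<lambda>s. \<bar>g s\<bar>)"
    using set_integrable_abs[OF g] t by (auto intro: set_integrable_subset)
  have "\<bar>LBINT s:{0..t}. g s\<bar> \<le> (LBINT s:{0..t}. \<bar>g s\<bar>)"
    using integral_norm_bound[of lborel "\<lambda>s. indicator {0..t} s *\<^sub>R g s"]
    by (simp add: set_lebesgue_integral_def abs_mult)
  also have "\<dots> \<le> (LBINT s:{0..T}. \<bar>g s\<bar>)"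
    using i t unfolding set_lebesgue_integral_def set_integrable_def
    by (intro integral_mono) (auto simp: indicator_def)
  finally show ?thesis .
qed

section \<open>Exchange of time integrals and expectations\<close>

context prob_space
begin

interpretation P: pair_sigma_finite lborel M ..

text \<open>The last clause leads back to the product space, where integrands can be added or
  compared at once without discussing which of their sections are integrable.\<close>

lemma fubini_time:
  fixes w :: "real \<Rightarrow> 'a \<Rightarrow> real"
  assumes w: "integrable (lborel \<Otimes>\<^sub>M M) (\<lambda>(t, \<omega>). indicator A t * w t \<omega>)"
  shows "AE \<omega> in M. set_integrable lborel A (\<lambda>t. w t \<omega>)"
    "AE t in lborel. t \<in> A \<longrightarrow> integrable M (w t)"
    "integrable M (\<lambda>\<omega>. LBINT t:A. w t \<omega>)"
    "set_integrable lborel A (\<lambda>t. expectation (w t))"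
    "expectation (\<lambda>\<omega>. LBINT t:A. w t \<omega>) = (LBINT t:A. expectation (w t))"
    "(\<integral>(t, \<omega>). indicator A t * w t \<omega> \<partial>(lborel \<Otimes>\<^sub>M M)) = (LBINT t:A. expectation (w t))"
proof -
  show "AE \<omega> in M. set_integrable lborel A (\<lambda>t. w t \<omega>)"
    using P.AE_integrable_snd[OF w] by (simp add: set_integrable_def)
  show "AE t in lborel. t \<in> A \<longrightarrow> integrable M (w t)"
    using P.AE_integrable_fst'[OF w] by eventually_elim auto
  show "integrable M (\<lambda>\<omega>. LBINT t:A. w t \<omega>)"
    using P.integrable_snd[OF w] by (simp add: set_lebesgue_integral_def)
  show "set_integrable lborel A (\<lambda>t. expectation (w t))"
    using P.integrable_fst'[OF w] by (simp add: set_integrable_def)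
  show "expectation (\<lambda>\<omega>. LBINT t:A. w t \<omega>) = (LBINT t:A. expectation (w t))"
    using P.Fubini_integral[OF w] by (simp add: set_lebesgue_integral_def)
  show "(\<integral>(t, \<omega>). indicator A t * w t \<omega> \<partial>(lborel \<Otimes>\<^sub>M M)) = (LBINT t:A. expectation (w t))"
    using P.integral_fst'[OF w] by (simp add: set_lebesgue_integral_def)
qed

lemma loc_L2_measurable:
  assumes "loc_L2 M v"
  shows "(\<lambda>(t, \<omega>). v t \<omega>) \<in> borel_measurable (borel \<Otimes>\<^sub>M M)" "v t \<in> borel_measurable M"
    "\<omega> \<in> space M \<Longrightarrow> (\<lambda>t. v t \<omega>) \<in> borel_measurable borel"
  using assms borel_measurable_section[of v borel M] by (auto simp: loc_L2_def)

lemma loc_L2_prod: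
  assumes "loc_L2 M u" "loc_L2 M v" "0 \<le> T"
  shows "integrable (lborel \<Otimes>\<^sub>M M) (\<lambda>(t, \<omega>). indicator {0..T} t * (u t \<omega> * v t \<omega>))"
proof -
  have m: "(\<lambda>z. u (fst z) (snd z)) \<in> borel_measurable (lborel \<Otimes>\<^sub>M M)" "(\<lambda>z. v (fst z) (snd z)) \<in> borel_measurable (lborel \<Otimes>\<^sub>M M)"
    using assms loc_L2_measurable(1) unfolding measurable_lborel_pair by (auto simp: split_beta')
  have "integrable (lborel \<Otimes>\<^sub>M M) (\<lambda>z. (indicator {0..T} (fst z) * u (fst z) (snd z)) * (indicator {0..T} (fst z) * v (fst z) (snd z)))"
  proof (intro integrable_mult_square)
    have "(indicator {0..T} s :: real)\<^sup>2 = indicator {0..T} s" for s by (simp add: indicator_def)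
    then show "integrable (lborel \<Otimes>\<^sub>M M) (\<lambda>z. (indicator {0..T} (fst z) * u (fst z) (snd z))\<^sup>2)"
      "integrable (lborel \<Otimes>\<^sub>M M) (\<lambda>z. (indicator {0..T} (fst z) * v (fst z) (snd z))\<^sup>2)"
      using assms by (auto simp: loc_L2_def split_beta' power_mult_distrib)
  qed (use m in auto)
  moreover have "(\<lambda>z. (indicator {0..T} (fst z) * u (fst z) (snd z)) * (indicator {0..T} (fst z) * v (fst z) (snd z)))
     = (\<lambda>(t, \<omega>). indicator {0..T} t * (u t \<omega> * v t \<omega>))"
    by (auto simp: fun_eq_iff indicator_def)
  ultimately show ?thesis by simp
qed

lemma loc_L2_bound:
  assumes v: "(\<lambda>(t, \<omega>). v t \<omega>) \<in> borel_measurable (borel \<Otimes>\<^sub>M M)" and w: "loc_L2 M w"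
    and le: "\<And>t \<omega>. 0 \<le> t \<Longrightarrow> \<omega> \<in> space M \<Longrightarrow> \<bar>v t \<omega>\<bar> \<le> \<bar>w t \<omega>\<bar>"
  shows "loc_L2 M v"
  unfolding loc_L2_def
proof (intro conjI allI impI v)
  fix T :: real assume "0 \<le> T"
  then have "integrable (lborel \<Otimes>\<^sub>M M) (\<lambda>(t, \<omega>). indicator {0..T} t * (w t \<omega>)\<^sup>2)" using w by (auto simp: loc_L2_def)
  then show "integrable (lborel \<Otimes>\<^sub>M M) (\<lambda>(t, \<omega>). indicator {0..T} t * (v t \<omega>)\<^sup>2)"
  proof (rule Bochner_Integration.integrable_bound)
    have "(\<lambda>z. v (fst z) (snd z)) \<in> borel_measurable (lborel \<Otimes>\<^sub>M M)"
      using v unfolding measurable_lborel_pair by (simp add: split_beta')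
    then show "(\<lambda>(t, \<omega>). indicator {0..T} t * (v t \<omega>)\<^sup>2) \<in> borel_measurable (lborel \<Otimes>\<^sub>M M)"
      by (simp add: split_beta')
    show "AE z in lborel \<Otimes>\<^sub>M M. norm (case z of (t, \<omega>) \<Rightarrow> indicator {0..T} t * (v t \<omega>)\<^sup>2)
        \<le> norm (case z of (t, \<omega>) \<Rightarrow> indicator {0..T} t * (w t \<omega>)\<^sup>2)"
      using le by (intro AE_I2) (auto simp: indicator_def abs_le_square_iff space_pair_measure split: prod.splits)
  qed
qed

lemma loc_L2_const:
  assumes [measurable]: "G \<in> borel_measurable M" and G: "integrable M (\<lambda>\<omega>. (G \<omega>)\<^sup>2)"
  shows "loc_L2 M (\<lambda>t. G)"
  unfolding loc_L2_def
proof (intro conjI allI impI)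
  show "(\<lambda>(t, \<omega>). G \<omega>) \<in> borel_measurable (borel \<Otimes>\<^sub>M M)" by measurable
  fix T :: real assume "0 \<le> T"
  show "integrable (lborel \<Otimes>\<^sub>M M) (\<lambda>(t, \<omega>). indicator {0..T} t * (G \<omega>)\<^sup>2)"
  proof (rule P.Fubini_integrable)
    show "(\<lambda>(t, \<omega>). indicator {0..T} t * (G \<omega>)\<^sup>2) \<in> borel_measurable (lborel \<Otimes>\<^sub>M M)" by measurable
    show "integrable lborel (\<lambda>t. LINT \<omega>|M. norm (case (t, \<omega>) of (t, \<omega>) \<Rightarrow> indicator {0..T} t * (G \<omega>)\<^sup>2))"
      by (auto simp: abs_mult)
    show "AE t in lborel. integrable M (\<lambda>\<omega>. case (t, \<omega>) of (t, \<omega>) \<Rightarrow> indicator {0..T} t * (G \<omega>)\<^sup>2)"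
      using G by auto
  qed
qed

lemma loc_L2_deterministic:
  assumes [measurable]: "h \<in> borel_measurable borel" and h: "\<And>T. 0 \<le> T \<Longrightarrow> set_integrable lborel {0..T} (\<lambda>t. (h t)\<^sup>2)"
  shows "loc_L2 M (\<lambda>t \<omega>. h t)"
  unfolding loc_L2_def
proof (intro conjI allI impI)
  show "(\<lambda>(t, \<omega>). h t) \<in> borel_measurable (borel \<Otimes>\<^sub>M M)" by measurable
  fix T :: real assume "0 \<le> T"
  show "integrable (lborel \<Otimes>\<^sub>M M) (\<lambda>(t, \<omega>). indicator {0..T} t * (h t)\<^sup>2)"
  proof (rule P.Fubini_integrable)
    show "(\<lambda>(t, \<omega>). indicator {0..T} t * (h t)\<^sup>2) \<in> borel_measurable (lborel \<Otimes>\<^sub>M M)" by measurable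
    show "integrable lborel (\<lambda>t. LINT \<omega>|M. norm (case (t, \<omega>) of (t, \<omega>) \<Rightarrow> indicator {0..T} t * (h t)\<^sup>2))"
      using h[OF \<open>0 \<le> T\<close>] by (simp add: abs_mult set_integrable_def prob_space)
  qed simp
qed

lemma loc_L2_continuous:
  assumes "continuous_on UNIV h"
  shows "loc_L2 M (\<lambda>t \<omega>. h t)"
proof (rule loc_L2_deterministic)
  show "h \<in> borel_measurable borel" using assms by (rule borel_measurable_continuous_onI)
  show "set_integrable lborel {0..T} (\<lambda>t. (h t)\<^sup>2)" for T
    unfolding set_integrable_def
    by (intro borel_integrable_compact continuous_intros continuous_on_subset[OF assms]) auto
qed

lemma loc_L2_add:
  assumes "loc_L2 M u" "loc_L2 M v"
  shows "loc_L2 M (\<lambda>t \<omega>. u t \<omega> + v t \<omega>)"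
  unfolding loc_L2_def
proof (intro conjI allI impI)
  show "(\<lambda>(t, \<omega>). u t \<omega> + v t \<omega>) \<in> borel_measurable (borel \<Otimes>\<^sub>M M)"
    using loc_L2_measurable(1)[OF assms(1)] loc_L2_measurable(1)[OF assms(2)]
    by (simp add: split_beta')
  fix T :: real assume T: "0 \<le> T"
  have "integrable (lborel \<Otimes>\<^sub>M M) (\<lambda>z. (case z of (t, \<omega>) \<Rightarrow> indicator {0..T} t * (u t \<omega> * u t \<omega>))
     + 2 * (case z of (t, \<omega>) \<Rightarrow> indicator {0..T} t * (u t \<omega> * v t \<omega>)) + (case z of (t, \<omega>) \<Rightarrow> indicator {0..T} t * (v t \<omega> * v t \<omega>)))"
    using loc_L2_prod[OF _ _ T] assms by (intro Bochner_Integration.integrable_add integrable_mult_right) auto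
  then show "integrable (lborel \<Otimes>\<^sub>M M) (\<lambda>(t, \<omega>). indicator {0..T} t * (u t \<omega> + v t \<omega>)\<^sup>2)"
    by (simp add: split_beta' power2_eq_square algebra_simps)
qed

lemma loc_L2_cmult:
  assumes "loc_L2 M v" shows "loc_L2 M (\<lambda>t \<omega>. k * v t \<omega>)"
  unfolding loc_L2_def
proof (intro conjI allI impI)
  show "(\<lambda>(t, \<omega>). k * v t \<omega>) \<in> borel_measurable (borel \<Otimes>\<^sub>M M)"
    using loc_L2_measurable(1)[OF assms] by (simp add: split_beta')
  fix T :: real assume T: "0 \<le> T"
  have "integrable (lborel \<Otimes>\<^sub>M M) (\<lambda>z. k\<^sup>2 * (case z of (t, \<omega>) \<Rightarrow> indicator {0..T} t * (v t \<omega> * v t \<omega>)))"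
    using loc_L2_prod[OF assms assms T] by (intro integrable_mult_right) auto
  then show "integrable (lborel \<Otimes>\<^sub>M M) (\<lambda>(t, \<omega>). indicator {0..T} t * (k * v t \<omega>)\<^sup>2)"
    by (simp add: split_beta' power2_eq_square algebra_simps)
qed

lemma loc_L2_diff: "loc_L2 M u \<Longrightarrow> loc_L2 M v \<Longrightarrow> loc_L2 M (\<lambda>t \<omega>. u t \<omega> - v t \<omega>)"
  using loc_L2_add[OF _ loc_L2_cmult[of v "-1"]] by simp

lemma loc_L2_abs: "loc_L2 M v \<Longrightarrow> loc_L2 M (\<lambda>t \<omega>. \<bar>v t \<omega>\<bar>)"
  by (rule loc_L2_bound) (auto dest!: loc_L2_measurable(1) simp: split_beta')

lemma loc_L2_integrable:
  assumes "loc_L2 M v" "0 \<le> T"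
  shows "integrable (lborel \<Otimes>\<^sub>M M) (\<lambda>(t, \<omega>). indicator {0..T} t * v t \<omega>)"
  using loc_L2_prod[OF assms(1) loc_L2_const[of "\<lambda>_. 1"] assms(2)] by simp

text \<open>Each horizon \<open>n\<close> contributes one null set of times, and countably many
  horizons exhaust the half-line.\<close>

lemma loc_L2_AE_square:
  assumes "loc_L2 M v"
  shows "AE t in lborel. 0 \<le> t \<longrightarrow> integrable M (\<lambda>\<omega>. (v t \<omega>)\<^sup>2)"
proof -
  have "AE t in lborel. t \<in> {0..real n} \<longrightarrow> integrable M (\<lambda>\<omega>. (v t \<omega>)\<^sup>2)" for n
    using assms by (intro fubini_time(2)) (auto simp: loc_L2_def)
  then have "AE t in lborel. \<forall>n. t \<in> {0..real n} \<longrightarrow> integrable M (\<lambda>\<omega>. (v t \<omega>)\<^sup>2)"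
    unfolding AE_all_countable by blast
  then show ?thesis
  proof eventually_elim
    case (elim t)
    obtain n where "t \<le> real n" using real_arch_simple by blast
    then show ?case using elim by auto
  qed
qed

text \<open>Cauchy-Schwarz in time, obtained as nonnegativity of a variance: \<open>m\<close> is the
  mean of \<open>f\<close> over the interval.\<close>

lemma set_integral_square_le:
  fixes f :: "real \<Rightarrow> real"
  assumes st: "s \<le> t" and f: "set_integrable lborel {s..t} f" and f2: "set_integrable lborel {s..t} (\<lambda>u. (f u)\<^sup>2)"
  shows "(LBINT u:{s..t}. f u)\<^sup>2 \<le> (t - s) * (LBINT u:{s..t}. (f u)\<^sup>2)"
proof (cases "s = t")
  case True
  then show ?thesis by (simp add: set_integral_singleton)
next
  case False
  then have T: "0 < t - s" using st by simp
  define m where "m = (LBINT u:{s..t}. f u) / (t - s)"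
  have c: "set_integrable lborel {s..t} (\<lambda>t. k)" for k :: real
    by (simp add: set_integrable_def)
  have "0 \<le> (LBINT u:{s..t}. (f u - m)\<^sup>2)"
    unfolding set_lebesgue_integral_def by (intro Bochner_Integration.integral_nonneg) auto
  also have "\<dots> = (LBINT u:{s..t}. (f u)\<^sup>2 - 2 * m * f u + m\<^sup>2)"
    by (intro set_lebesgue_integral_cong) (auto simp: power2_diff)
  also have "\<dots> = (LBINT u:{s..t}. (f u)\<^sup>2) - 2 * m * (LBINT u:{s..t}. f u) + m\<^sup>2 * (t - s)"
    using f f2 c T by (simp add: set_integral_add set_integral_diff set_integral_const)
  also have "\<dots> = (LBINT u:{s..t}. (f u)\<^sup>2) - (LBINT u:{s..t}. f u)\<^sup>2 / (t - s)"
    using T by (simp add: m_def power2_eq_square)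
  finally show ?thesis using T by (simp add: field_simps)
qed

text \<open>Up to time \<open>T\<close> the integral is dominated along almost every path by the
  integral of \<open>\<bar>g\<bar>\<close> over \<open>{0..T}\<close>, a random variable free of
  \<open>t\<close>, whose square is integrable by Cauchy-Schwarz in time.\<close>

lemma loc_L2_time_integral:
  assumes g: "loc_L2 M g"
  shows "loc_L2 M (\<lambda>t \<omega>. LBINT s:{0..t}. g s \<omega>)"
    "0 \<le> T \<Longrightarrow> integrable M (\<lambda>\<omega>. (LBINT s:{0..T}. g s \<omega>)\<^sup>2)"
proof -
  have m: "(\<lambda>z. g (fst z) (snd z)) \<in> borel_measurable (borel \<Otimes>\<^sub>M M)"
    using loc_L2_measurable(1)[OF g] by (simp add: split_beta')
  have meas: "(\<lambda>(t, \<omega>). LBINT s:{0..t}. h (g s \<omega>)) \<in> borel_measurable (borel \<Otimes>\<^sub>M M)"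
    if [measurable]: "h \<in> borel_measurable borel" for h :: "real \<Rightarrow> real"
  proof -
    \<comment> \<open>Writing the variable upper limit as a condition on a jointly measurable
      integrand makes the integral measurable in \<open>(t, \<omega>)\<close>.\<close>
    have "(\<lambda>(z, s). if 0 \<le> s \<and> s \<le> fst z then h (g s (snd z)) else 0) \<in> borel_measurable ((borel \<Otimes>\<^sub>M M) \<Otimes>\<^sub>M lborel)"
    proof -
      have "(\<lambda>w. (snd w, snd (fst w))) \<in> measurable ((borel \<Otimes>\<^sub>M M) \<Otimes>\<^sub>M lborel) (borel \<Otimes>\<^sub>M M)" by measurable
      from measurable_compose[OF this m] have [measurable]:
        "(\<lambda>w. g (snd w) (snd (fst w))) \<in> borel_measurable ((borel \<Otimes>\<^sub>M M) \<Otimes>\<^sub>M (lborel :: real measure))" by simp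
      show ?thesis unfolding split_beta' by measurable
    qed
    from lborel.borel_measurable_lebesgue_integral[OF this]
    have "(\<lambda>z. LBINT s. if 0 \<le> s \<and> s \<le> fst z then h (g s (snd z)) else 0) \<in> borel_measurable (borel \<Otimes>\<^sub>M M)" .
    moreover have "(\<lambda>z. LBINT s. if 0 \<le> s \<and> s \<le> fst z then h (g s (snd z)) else 0) = (\<lambda>(t, \<omega>). LBINT s:{0..t}. h (g s \<omega>))"
      by (auto simp: fun_eq_iff set_lebesgue_integral_def indicator_def intro!: Bochner_Integration.integral_cong)
    ultimately show ?thesis by simp
  qed
  have sq: "integrable M (\<lambda>\<omega>. (LBINT s:{0..T}. \<bar>g s \<omega>\<bar>)\<^sup>2)" if T: "0 \<le> T" for T
  proof (rule Bochner_Integration.integrable_bound)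
    have i2: "integrable (lborel \<Otimes>\<^sub>M M) (\<lambda>(t, \<omega>). indicator {0..T} t * (g t \<omega>)\<^sup>2)" using g T by (auto simp: loc_L2_def)
    show "integrable M (\<lambda>\<omega>. T * (LBINT s:{0..T}. (g s \<omega>)\<^sup>2))"
      using fubini_time(3)[OF i2] by simp
    show "(\<lambda>\<omega>. (LBINT s:{0..T}. \<bar>g s \<omega>\<bar>)\<^sup>2) \<in> borel_measurable M"
      using borel_measurable_section(1)[OF meas[of abs], of T] by simp
    show "AE \<omega> in M. norm ((LBINT s:{0..T}. \<bar>g s \<omega>\<bar>)\<^sup>2) \<le> norm (T * (LBINT s:{0..T}. (g s \<omega>)\<^sup>2))"
      using fubini_time(1)[OF i2] fubini_time(1)[OF loc_L2_integrable[OF loc_L2_abs[OF g] T]]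
    proof eventually_elim
      case (elim \<omega>)
      then have "(LBINT s:{0..T}. \<bar>g s \<omega>\<bar>)\<^sup>2 \<le> (T - 0) * (LBINT s:{0..T}. (g s \<omega>)\<^sup>2)"
        using set_integral_square_le[OF T, of "\<lambda>t. \<bar>g t \<omega>\<bar>"] by simp
      then show ?case using T by auto
    qed
  qed
  have le: "AE \<omega> in M. \<forall>t. 0 \<le> t \<and> t \<le> T \<longrightarrow> \<bar>LBINT s:{0..t}. g s \<omega>\<bar> \<le> (LBINT s:{0..T}. \<bar>g s \<omega>\<bar>)" if T: "0 \<le> T" for T
    using fubini_time(1)[OF loc_L2_integrable[OF g T]]
    by eventually_elim (auto intro: abs_set_integral_Icc_le)
  show "integrable M (\<lambda>\<omega>. (LBINT s:{0..T}. g s \<omega>)\<^sup>2)" if T: "0 \<le> T"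
  proof (rule Bochner_Integration.integrable_bound[OF sq[OF T]])
    show "(\<lambda>\<omega>. (LBINT s:{0..T}. g s \<omega>)\<^sup>2) \<in> borel_measurable M"
      using borel_measurable_section(1)[OF meas[of "\<lambda>x. x"], of T] by simp
    show "AE \<omega> in M. norm ((LBINT s:{0..T}. g s \<omega>)\<^sup>2) \<le> norm ((LBINT s:{0..T}. \<bar>g s \<omega>\<bar>)\<^sup>2)"
      using le[OF T]
    proof eventually_elim
      case (elim \<omega>)
      then have "\<bar>LBINT s:{0..T}. g s \<omega>\<bar> \<le> \<bar>LBINT s:{0..T}. \<bar>g s \<omega>\<bar>\<bar>" using T by force
      then show ?case by (simp add: abs_le_square_iff)
    qed
  qed
  show "loc_L2 M (\<lambda>t \<omega>. LBINT s:{0..t}. g s \<omega>)"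
    unfolding loc_L2_def
  proof (intro conjI allI impI)
    show mJ: "(\<lambda>(t, \<omega>). LBINT s:{0..t}. g s \<omega>) \<in> borel_measurable (borel \<Otimes>\<^sub>M M)"
      using meas[of "\<lambda>x. x"] by simp
    fix T :: real assume T: "0 \<le> T"
    have "loc_L2 M (\<lambda>t \<omega>. LBINT s:{0..T}. \<bar>g s \<omega>\<bar>)"
      using borel_measurable_section(1)[OF meas[of abs], of T] sq[OF T] by (intro loc_L2_const) auto
    then have i: "integrable (lborel \<Otimes>\<^sub>M M) (\<lambda>(t, \<omega>). indicator {0..T} t * (LBINT s:{0..T}. \<bar>g s \<omega>\<bar>)\<^sup>2)"
      using T by (auto simp: loc_L2_def)
    show "integrable (lborel \<Otimes>\<^sub>M M) (\<lambda>(t, \<omega>). indicator {0..T} t * (LBINT s:{0..t}. g s \<omega>)\<^sup>2)"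
    proof (rule Bochner_Integration.integrable_bound[OF i])
      have "(\<lambda>z. LBINT s:{0..fst z}. g s (snd z)) \<in> borel_measurable (lborel \<Otimes>\<^sub>M M)"
        using mJ by (simp add: split_beta' measurable_lborel_pair)
      then show "(\<lambda>(t, \<omega>). indicator {0..T} t * (LBINT s:{0..t}. g s \<omega>)\<^sup>2) \<in> borel_measurable (lborel \<Otimes>\<^sub>M M)"
        by (simp add: split_beta')
      have "AE \<omega> in M. \<forall>t. 0 \<le> t \<and> t \<le> T \<longrightarrow> \<bar>LBINT s:{0..t}. g s \<omega>\<bar> \<le> (LBINT s:{0..T}. \<bar>g s \<omega>\<bar>)" using le[OF T] .
      then obtain N where N: "N \<in> null_sets M" "{\<omega>\<in>space M. \<not> (\<forall>t. 0 \<le> t \<and> t \<le> T \<longrightarrow> \<bar>LBINT s:{0..t}. g s \<omega>\<bar> \<le> (LBINT s:{0..T}. \<bar>g s \<omega>\<bar>))} \<subseteq> N"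
        by (auto elim!: AE_E simp: null_sets_def)
      \<comment> \<open>The exceptional set consists of whole paths, so the domination holds almost
        everywhere on the product as well.\<close>
      have "UNIV \<times> N \<in> null_sets (lborel \<Otimes>\<^sub>M M)"
        using N(1) by (auto simp: null_sets_def emeasure_pair_measure_Times)
      then have "AE z in lborel \<Otimes>\<^sub>M M. z \<notin> UNIV \<times> N" by (rule AE_not_in)
      then show "AE z in lborel \<Otimes>\<^sub>M M. norm (case z of (t, \<omega>) \<Rightarrow> indicator {0..T} t * (LBINT s:{0..t}. g s \<omega>)\<^sup>2)
         \<le> norm (case z of (t, \<omega>) \<Rightarrow> indicator {0..T} t * (LBINT s:{0..T}. \<bar>g s \<omega>\<bar>)\<^sup>2)"
        using AE_space
      proof eventually_elim
        case (elim z)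
        obtain t \<omega> where z: "z = (t, \<omega>)" by (cases z)
        have "\<omega> \<in> space M" "\<omega> \<notin> N" using elim by (auto simp: z space_pair_measure)
        then have "\<forall>t. 0 \<le> t \<and> t \<le> T \<longrightarrow> \<bar>LBINT s:{0..t}. g s \<omega>\<bar> \<le> (LBINT s:{0..T}. \<bar>g s \<omega>\<bar>)" using N by blast
        then have "0 \<le> t \<and> t \<le> T \<longrightarrow> \<bar>LBINT s:{0..t}. g s \<omega>\<bar> \<le> \<bar>LBINT s:{0..T}. \<bar>g s \<omega>\<bar>\<bar>" by force
        then show ?case by (auto simp: z indicator_def abs_le_square_iff)
      qed
    qed
  qed
qed

end

section \<open>A priori estimates for the difference of two solutions\<close>

lemma young_inequality_scaled:
  fixes A b c :: real
  assumes "0 < A"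
  shows "b * c \<le> A / 2 * c\<^sup>2 + b\<^sup>2 / (2 * A)"
proof -
  have "0 \<le> (A * c - b)\<^sup>2 / (2 * A)" using assms by simp
  also have "\<dots> = A / 2 * c\<^sup>2 + b\<^sup>2 / (2 * A) - b * c"
    using assms by (simp add: field_simps power2_eq_square)
  finally show ?thesis by simp
qed

text \<open>On \<open>[0,T]\<close> the discount factor is at least
  \<open>exp (- r * T)\<close>.\<close>

lemma (in prob_space) loc_L2_of_weighted:
  assumes r: "0 < r" and m: "(\<lambda>(t, \<omega>). v t \<omega>) \<in> borel_measurable (borel \<Otimes>\<^sub>M M)"
    and i: "integrable (lborel \<Otimes>\<^sub>M M) (\<lambda>(t, \<omega>). indicator {0..} t * (exp (- r * t) * (v t \<omega>)\<^sup>2))"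
  shows "loc_L2 M v"
  unfolding loc_L2_def
proof (intro conjI allI impI m)
  fix T :: real assume T: "0 \<le> T"
  show "integrable (lborel \<Otimes>\<^sub>M M) (\<lambda>(t, \<omega>). indicator {0..T} t * (v t \<omega>)\<^sup>2)"
  proof (rule Bochner_Integration.integrable_bound)
    show "integrable (lborel \<Otimes>\<^sub>M M) (\<lambda>z. exp (r * T) * (case z of (t, \<omega>) \<Rightarrow> indicator {0..} t * (exp (- r * t) * (v t \<omega>)\<^sup>2)))"
      using i by simp
    have "(\<lambda>z. v (fst z) (snd z)) \<in> borel_measurable (lborel \<Otimes>\<^sub>M M)"
      using m unfolding measurable_lborel_pair by (simp add: split_beta')
    then show "(\<lambda>(t, \<omega>). indicator {0..T} t * (v t \<omega>)\<^sup>2) \<in> borel_measurable (lborel \<Otimes>\<^sub>M M)"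
      by (simp add: split_beta')
    have "(v t \<omega>)\<^sup>2 \<le> exp (r * T) * (exp (- r * t) * (v t \<omega>)\<^sup>2)" if "t \<le> T" for t \<omega>
    proof -
      have "1 \<le> exp (r * T) * exp (- r * t)" using that r by (simp flip: exp_add)
      then have "1 * (v t \<omega>)\<^sup>2 \<le> exp (r * T) * exp (- r * t) * (v t \<omega>)\<^sup>2" by (intro mult_right_mono) auto
      then show ?thesis by simp
    qed
    then show "AE z in lborel \<Otimes>\<^sub>M M. norm (case z of (t, \<omega>) \<Rightarrow> indicator {0..T} t * (v t \<omega>)\<^sup>2)
       \<le> norm (exp (r * T) * (case z of (t, \<omega>) \<Rightarrow> indicator {0..} t * (exp (- r * t) * (v t \<omega>)\<^sup>2)))"
      by (intro AE_I2) (auto simp: indicator_def)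
  qed
qed

text \<open>\<open>x\<close> and \<open>y\<close> stand for the differences of the forward and backward components of two solutions, \<open>a\<close> and
  \<open>c\<close> for those of \<open>\<partial>\<^sub>yH\<close> and \<open>\<partial>\<^sub>xH\<close> along them. The integrand \<open>Z\<close> is present only through the
  orthogonality \<open>martingale\<close>.\<close>

locale linear_difference = prob_space M for M :: "'a measure" +
  fixes F :: "real \<Rightarrow> 'a measure" and x y a c :: "real \<Rightarrow> 'a \<Rightarrow> real" and \<zeta> :: "'a \<Rightarrow> real"
    and r l \<kappa> :: real
  assumes r: "0 < r" and l: "0 \<le> l" and \<kappa>: "0 < \<kappa>"
    and x_meas: "(\<lambda>(t, \<omega>). x t \<omega>) \<in> borel_measurable (borel \<Otimes>\<^sub>M M)"
    and y_meas: "(\<lambda>(t, \<omega>). y t \<omega>) \<in> borel_measurable (borel \<Otimes>\<^sub>M M)"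
    and a_meas: "(\<lambda>(t, \<omega>). a t \<omega>) \<in> borel_measurable (borel \<Otimes>\<^sub>M M)"
    and c_meas: "(\<lambda>(t, \<omega>). c t \<omega>) \<in> borel_measurable (borel \<Otimes>\<^sub>M M)"
    and x_weighted: "integrable (lborel \<Otimes>\<^sub>M M) (\<lambda>(t, \<omega>). indicator {0..} t * (exp (- r * t) * (x t \<omega>)\<^sup>2))"
    and y_weighted: "integrable (lborel \<Otimes>\<^sub>M M) (\<lambda>(t, \<omega>). indicator {0..} t * (exp (- r * t) * (y t \<omega>)\<^sup>2))"
    and subalg: "subalgebra M (F 0)"
    and a_adapted: "0 \<le> t \<Longrightarrow> a t \<in> borel_measurable (F t)"
    and y0_adapted: "y 0 \<in> borel_measurable (F 0)"
    and \<zeta>_adapted: "\<zeta> \<in> borel_measurable (F 0)"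
    and \<zeta>_square: "integrable M (\<lambda>\<omega>. (\<zeta> \<omega>)\<^sup>2)"
    and y_square: "0 \<le> t \<Longrightarrow> integrable M (\<lambda>\<omega>. (y t \<omega>)\<^sup>2)"
    and x_eq: "AE \<omega> in M. \<forall>t\<ge>0. x t \<omega> = \<zeta> \<omega> + (LBINT s:{0..t}. a s \<omega>)"
    and martingale: "\<lbrakk>0 \<le> s; s \<le> t; G \<in> borel_measurable (F s); integrable M (\<lambda>\<omega>. (G \<omega>)\<^sup>2)\<rbrakk> \<Longrightarrow>
       expectation (\<lambda>\<omega>. G \<omega> * (y t \<omega> - (LBINT u:{0..t}. r * y u \<omega> - c u \<omega>))) =
       expectation (\<lambda>\<omega>. G \<omega> * (y s \<omega> - (LBINT u:{0..s}. r * y u \<omega> - c u \<omega>)))"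
    and a_bound: "\<lbrakk>0 \<le> t; \<omega> \<in> space M\<rbrakk> \<Longrightarrow> \<bar>a t \<omega>\<bar> \<le> l * (\<bar>x t \<omega>\<bar> + \<bar>y t \<omega>\<bar>)"
    and c_bound: "\<lbrakk>0 \<le> t; \<omega> \<in> space M\<rbrakk> \<Longrightarrow> \<bar>c t \<omega>\<bar> \<le> l * (\<bar>x t \<omega>\<bar> + \<bar>y t \<omega>\<bar>)"
    and monotone: "\<lbrakk>0 \<le> t; \<omega> \<in> space M\<rbrakk> \<Longrightarrow>
       a t \<omega> * y t \<omega> - x t \<omega> * c t \<omega> \<le> - \<kappa> * ((x t \<omega>)\<^sup>2 + (y t \<omega>)\<^sup>2)"
begin

interpretation P: pair_sigma_finite lborel M ..

text \<open>\<open>g\<close> is the drift of \<open>y\<close>. Removing its integral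
  \<open>J\<close> leaves \<open>N\<close>, which starts at \<open>y 0\<close> and is, by the
  assumption \<open>martingale\<close>, orthogonal in its increments to the past.\<close>

definition "g t \<omega> = r * y t \<omega> - c t \<omega>"
definition "J t \<omega> = (LBINT s:{0..t}. g s \<omega>)"
definition "N t \<omega> = y t \<omega> - J t \<omega>"
definition "w t = expectation (\<lambda>\<omega>. exp (- r * t) * ((x t \<omega>)\<^sup>2 + (y t \<omega>)\<^sup>2))"
definition "energy = (LBINT t:{0..}. w t)"
text \<open>Chosen so that \<open>\<bar>y\<bar> + \<bar>g\<bar> \<le> K * (\<bar>x\<bar> +
  \<bar>y\<bar>)\<close> at nonnegative times: 1 for \<open>y\<close> itself, \<open>r\<close> for
  the discount term of \<open>g\<close>, \<open>l\<close> for \<open>c\<close>.\<close>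

definition "K = 1 + l + r"

lemma K_pos: "0 < K" using l r by (simp add: K_def)

lemma x_L2: "loc_L2 M x" and y_L2: "loc_L2 M y"
  by (rule loc_L2_of_weighted[OF r x_meas x_weighted], rule loc_L2_of_weighted[OF r y_meas y_weighted])

lemma xy_L2: "loc_L2 M (\<lambda>t \<omega>. l * (\<bar>x t \<omega>\<bar> + \<bar>y t \<omega>\<bar>))"
  by (intro loc_L2_cmult loc_L2_add loc_L2_abs x_L2 y_L2)

lemma a_L2: "loc_L2 M a"
  using a_bound l by (intro loc_L2_bound[OF a_meas xy_L2]) (force simp: abs_mult)

lemma c_L2: "loc_L2 M c"
  using c_bound l by (intro loc_L2_bound[OF c_meas xy_L2]) (force simp: abs_mult)

lemma g_L2: "loc_L2 M g"
  unfolding g_def[abs_def] by (intro loc_L2_diff loc_L2_cmult y_L2 c_L2)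

lemma J_L2: "loc_L2 M J" and J_square: "0 \<le> t \<Longrightarrow> integrable M (\<lambda>\<omega>. (J t \<omega>)\<^sup>2)"
  unfolding J_def[abs_def] using loc_L2_time_integral[OF g_L2] by auto

lemma N_L2: "loc_L2 M N"
  unfolding N_def[abs_def] by (intro loc_L2_diff y_L2 J_L2)

lemma N_square: "0 \<le> t \<Longrightarrow> integrable M (\<lambda>\<omega>. (N t \<omega>)\<^sup>2)"
  unfolding N_def by (intro integrable_diff_square loc_L2_measurable(2)[OF y_L2] loc_L2_measurable(2)[OF J_L2] y_square J_square)

lemma N_0: "N 0 = y 0"
  by (simp add: N_def[abs_def] J_def set_integral_singleton)

lemma \<zeta>_measurable: "\<zeta> \<in> borel_measurable M"
  using \<zeta>_adapted subalg by (rule measurable_from_subalg[rotated])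

text \<open>The weighted norm yields this for almost every time; the forward equation upgrades it to
  every time.\<close>

lemma x_square:
  assumes t: "0 \<le> t"
  shows "integrable M (\<lambda>\<omega>. (x t \<omega>)\<^sup>2)"
proof -
  have "integrable M (\<lambda>\<omega>. (\<zeta> \<omega> + (LBINT s:{0..t}. a s \<omega>))\<^sup>2)"
    using loc_L2_time_integral(2)[OF a_L2 t] \<zeta>_measurable \<zeta>_square
      loc_L2_measurable(2)[OF loc_L2_time_integral(1)[OF a_L2], of t]
    by (intro integrable_add_square)
  moreover have "(\<lambda>\<omega>. (x t \<omega>)\<^sup>2) \<in> borel_measurable M"
    using loc_L2_measurable(2)[OF x_L2] by (rule borel_measurable_power)
  moreover have "AE \<omega> in M. (\<zeta> \<omega> + (LBINT s:{0..t}. a s \<omega>))\<^sup>2 = (x t \<omega>)\<^sup>2"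
    using x_eq by eventually_elim (use t in simp)
  ultimately show ?thesis by (rule integrable_cong_AE_imp)
qed

lemma orthogonality:
  assumes "0 \<le> s" "s \<le> t" "G \<in> borel_measurable (F s)" "integrable M (\<lambda>\<omega>. (G \<omega>)\<^sup>2)"
  shows "expectation (\<lambda>\<omega>. G \<omega> * N t \<omega>) = expectation (\<lambda>\<omega>. G \<omega> * N s \<omega>)"
  using martingale[OF assms] by (simp add: N_def J_def g_def)

text \<open>Split \<open>y = N + J\<close>. Both \<open>x\<close> and \<open>J\<close> are integrals
  along almost every path, so their product is treated path by path. In \<open>x * N\<close> only
  \<open>x\<close> is expanded and \<open>N\<close> stays at the final time \<open>T\<close>; under
  the expectation \<open>N T\<close> next to \<open>a s\<close> may then be replaced by
  \<open>N s\<close>, because \<open>a s\<close> is known at time \<open>s\<close>.\<close>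

lemma expectation_xy:
  assumes T: "0 \<le> T"
  shows "expectation (\<lambda>\<omega>. x T \<omega> * y T \<omega>) = expectation (\<lambda>\<omega>. \<zeta> \<omega> * y 0 \<omega>)
    + (LBINT s:{0..T}. expectation (\<lambda>\<omega>. a s \<omega> * y s \<omega> + x s \<omega> * g s \<omega>))"
proof -
  note pa = fubini_time(1)[OF loc_L2_integrable[OF a_L2 T]]
  note pg = fubini_time(1)[OF loc_L2_integrable[OF g_L2 T]]
  have NT: "loc_L2 M (\<lambda>t. N T)" using N_square[OF T] by (intro loc_L2_const loc_L2_measurable(2)[OF N_L2])
  have iaN: "integrable (lborel \<Otimes>\<^sub>M M) (\<lambda>(t, \<omega>). indicator {0..T} t * (a t \<omega> * N T \<omega>))"
    by (rule loc_L2_prod[OF a_L2 NT T])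
  have iaN': "integrable (lborel \<Otimes>\<^sub>M M) (\<lambda>(t, \<omega>). indicator {0..T} t * (a t \<omega> * N t \<omega>))"
    by (rule loc_L2_prod[OF a_L2 N_L2 T])
  have iJ: "integrable (lborel \<Otimes>\<^sub>M M) (\<lambda>(t, \<omega>). indicator {0..T} t * (a t \<omega> * J t \<omega> + x t \<omega> * g t \<omega>))"
    using Bochner_Integration.integrable_add[OF loc_L2_prod[OF a_L2 J_L2 T] loc_L2_prod[OF x_L2 g_L2 T]]
    by (simp add: split_beta' distrib_left)
  have mx: "x T \<in> borel_measurable M" "N T \<in> borel_measurable M" "J T \<in> borel_measurable M"
    using loc_L2_measurable(2) x_L2 N_L2 J_L2 by auto
  have ixN: "integrable M (\<lambda>\<omega>. x T \<omega> * N T \<omega>)" and ixJ: "integrable M (\<lambda>\<omega>. x T \<omega> * J T \<omega>)"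
    and i\<zeta>N: "integrable M (\<lambda>\<omega>. \<zeta> \<omega> * N T \<omega>)"
    using mx x_square[OF T] N_square[OF T] J_square[OF T] \<zeta>_measurable \<zeta>_square by (auto intro!: integrable_mult_square)
  have "AE \<omega> in M. x T \<omega> * J T \<omega> = (LBINT s:{0..T}. a s \<omega> * J s \<omega> + x s \<omega> * g s \<omega>)"
    using pa pg x_eq
  proof eventually_elim
    case (elim \<omega>)
    show ?case
      using lebesgue_integration_by_parts(3)[OF T elim(1) elim(2), of "\<lambda>t. x t \<omega>" "\<zeta> \<omega>" "\<lambda>t. J t \<omega>" 0] elim(3)
      by (simp add: J_def)
  qed
  then have "expectation (\<lambda>\<omega>. x T \<omega> * J T \<omega>) = expectation (\<lambda>\<omega>. LBINT s:{0..T}. a s \<omega> * J s \<omega> + x s \<omega> * g s \<omega>)"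
    using ixJ fubini_time(3)[OF iJ] by (intro integral_cong_AE) auto
  then have 1: "expectation (\<lambda>\<omega>. x T \<omega> * J T \<omega>) = (LBINT s:{0..T}. expectation (\<lambda>\<omega>. a s \<omega> * J s \<omega> + x s \<omega> * g s \<omega>))"
    using fubini_time(5)[OF iJ] by simp
  have "AE \<omega> in M. x T \<omega> * N T \<omega> = \<zeta> \<omega> * N T \<omega> + (LBINT s:{0..T}. a s \<omega> * N T \<omega>)"
    using pa x_eq
  proof eventually_elim
    case (elim \<omega>)
    then show ?case using T by (simp add: distrib_right)
  qed
  then have "expectation (\<lambda>\<omega>. x T \<omega> * N T \<omega>) = expectation (\<lambda>\<omega>. \<zeta> \<omega> * N T \<omega> + (LBINT s:{0..T}. a s \<omega> * N T \<omega>))"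
    using ixN i\<zeta>N fubini_time(3)[OF iaN] by (intro integral_cong_AE) auto
  also have "\<dots> = expectation (\<lambda>\<omega>. \<zeta> \<omega> * N T \<omega>) + (LBINT s:{0..T}. expectation (\<lambda>\<omega>. a s \<omega> * N T \<omega>))"
    using Bochner_Integration.integral_add[OF i\<zeta>N fubini_time(3)[OF iaN]] fubini_time(5)[OF iaN] by simp
  also have "expectation (\<lambda>\<omega>. \<zeta> \<omega> * N T \<omega>) = expectation (\<lambda>\<omega>. \<zeta> \<omega> * y 0 \<omega>)"
    using orthogonality[OF _ T \<zeta>_adapted \<zeta>_square] by (simp add: N_0)
  \<comment> \<open>Orthogonality admits square integrable test variables only, and
    \<open>a s\<close> is one for almost every \<open>s\<close>, which is enough under the
    integral.\<close>
  also have "(LBINT s:{0..T}. expectation (\<lambda>\<omega>. a s \<omega> * N T \<omega>)) = (LBINT s:{0..T}. expectation (\<lambda>\<omega>. a s \<omega> * N s \<omega>))"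
    unfolding set_lebesgue_integral_def
  proof (rule integral_cong_AE)
    show "(\<lambda>s. indicator {0..T} s *\<^sub>R expectation (\<lambda>\<omega>. a s \<omega> * N T \<omega>)) \<in> borel_measurable lborel"
      "(\<lambda>s. indicator {0..T} s *\<^sub>R expectation (\<lambda>\<omega>. a s \<omega> * N s \<omega>)) \<in> borel_measurable lborel"
      using fubini_time(4)[OF iaN] fubini_time(4)[OF iaN'] unfolding set_integrable_def by auto
    show "AE s in lborel. indicator {0..T} s *\<^sub>R expectation (\<lambda>\<omega>. a s \<omega> * N T \<omega>)
       = indicator {0..T} s *\<^sub>R expectation (\<lambda>\<omega>. a s \<omega> * N s \<omega>)"
      using loc_L2_AE_square[OF a_L2]
      by eventually_elim (auto simp: indicator_def intro!: orthogonality a_adapted)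
  qed
  finally have 2: "expectation (\<lambda>\<omega>. x T \<omega> * N T \<omega>) = expectation (\<lambda>\<omega>. \<zeta> \<omega> * y 0 \<omega>) + (LBINT s:{0..T}. expectation (\<lambda>\<omega>. a s \<omega> * N s \<omega>))" .
  have "expectation (\<lambda>\<omega>. x T \<omega> * y T \<omega>) = expectation (\<lambda>\<omega>. x T \<omega> * N T \<omega> + x T \<omega> * J T \<omega>)"
    by (simp add: N_def algebra_simps)
  also have "\<dots> = expectation (\<lambda>\<omega>. x T \<omega> * N T \<omega>) + expectation (\<lambda>\<omega>. x T \<omega> * J T \<omega>)"
    using ixN ixJ by (rule Bochner_Integration.integral_add)
  also have "\<dots> = expectation (\<lambda>\<omega>. \<zeta> \<omega> * y 0 \<omega>) + ((LBINT s:{0..T}. expectation (\<lambda>\<omega>. a s \<omega> * N s \<omega>))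
      + (LBINT s:{0..T}. expectation (\<lambda>\<omega>. a s \<omega> * J s \<omega> + x s \<omega> * g s \<omega>)))"
    unfolding 1 2 by simp
  \<comment> \<open>The two time integrals are joined on the product space, where
    \<open>N + J\<close> recombines to \<open>y\<close> before any section is taken.\<close>
  also have "(LBINT s:{0..T}. expectation (\<lambda>\<omega>. a s \<omega> * N s \<omega>)) + (LBINT s:{0..T}. expectation (\<lambda>\<omega>. a s \<omega> * J s \<omega> + x s \<omega> * g s \<omega>))
     = (\<integral>z. (case z of (t, \<omega>) \<Rightarrow> indicator {0..T} t * (a t \<omega> * N t \<omega>)) + (case z of (t, \<omega>) \<Rightarrow> indicator {0..T} t * (a t \<omega> * J t \<omega> + x t \<omega> * g t \<omega>)) \<partial>(lborel \<Otimes>\<^sub>M M))"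
    using Bochner_Integration.integral_add[OF iaN' iJ] fubini_time(6)[OF iaN'] fubini_time(6)[OF iJ] by simp
  also have "\<dots> = (\<integral>(t, \<omega>). indicator {0..T} t * (a t \<omega> * y t \<omega> + x t \<omega> * g t \<omega>) \<partial>(lborel \<Otimes>\<^sub>M M))"
    by (intro Bochner_Integration.integral_cong) (auto simp: N_def algebra_simps)
  also have "\<dots> = (LBINT s:{0..T}. expectation (\<lambda>\<omega>. a s \<omega> * y s \<omega> + x s \<omega> * g s \<omega>))"
  proof (rule fubini_time(6))
    show "integrable (lborel \<Otimes>\<^sub>M M) (\<lambda>(t, \<omega>). indicator {0..T} t * (a t \<omega> * y t \<omega> + x t \<omega> * g t \<omega>))"
      using Bochner_Integration.integrable_add[OF loc_L2_prod[OF a_L2 y_L2 T] loc_L2_prod[OF x_L2 g_L2 T]]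
      by (simp add: split_beta' distrib_left)
  qed
  finally show ?thesis .
qed

section \<open>Discounted second moment and total energy\<close>

lemma w_integrable: "set_integrable lborel {0..} w"
proof -
  have "integrable (lborel \<Otimes>\<^sub>M M) (\<lambda>(t, \<omega>). indicator {0..} t * (exp (- r * t) * ((x t \<omega>)\<^sup>2 + (y t \<omega>)\<^sup>2)))"
    using Bochner_Integration.integrable_add[OF x_weighted y_weighted]
    by (simp add: split_beta' distrib_left)
  from fubini_time(4)[OF this] show ?thesis by (simp add: w_def[abs_def])
qed

lemma set_integral_unit_const:
  "set_integrable lborel {0..1::real} (\<lambda>s. k :: real)" "(LBINT s:{0..1::real}. k :: real) = k"
  by (simp_all add: set_integrable_def set_integral_const)

lemma unit_integral_affine_w:
  "set_integrable lborel {0..1} (\<lambda>s. k * w s + q)" "(LBINT s:{0..1}. k * w s + q) = k * (LBINT s:{0..1}. w s) + q"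
proof -
  have "set_integrable lborel {0..1} w" using w_integrable by (rule set_integrable_subset) auto
  then have kw: "set_integrable lborel {0..1} (\<lambda>s. k * w s)" by (intro set_integrable_mult_right)
  have "(LBINT s:{0..1}. k * w s) = k * (LBINT s:{0..1}. w s)" by (rule set_integral_mult_right)
  then show "set_integrable lborel {0..1} (\<lambda>s. k * w s + q)" "(LBINT s:{0..1}. k * w s + q) = k * (LBINT s:{0..1}. w s) + q"
    using set_integral_add[OF kw set_integral_unit_const(1), of q] set_integral_unit_const(2)[of q] by auto
qed

lemma w_nonneg: "0 \<le> w t"
  unfolding w_def by (intro Bochner_Integration.integral_nonneg) auto

lemma w_set_integrable: "A \<subseteq> {0..} \<Longrightarrow> A \<in> sets borel \<Longrightarrow> set_integrable lborel A w"
  using w_integrable by (rule set_integrable_subset) auto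

lemma w_integral_le_energy:
  assumes "A \<subseteq> {0..}" "A \<in> sets borel"
  shows "(LBINT t:A. w t) \<le> energy"
  unfolding energy_def set_lebesgue_integral_def
  using w_set_integrable[OF assms] w_integrable w_nonneg assms unfolding set_integrable_def
  by (intro integral_mono) (auto simp: indicator_def)

text \<open>The drift \<open>g\<close> contributes \<open>r * E[x y]\<close> to the growth of
  \<open>E[x y]\<close>, and the discount factor is there to cancel exactly this term; monotonicity
  bounds what is left by \<open>- \<kappa> * w\<close>.\<close>

lemma discounted_xy_le:
  assumes T: "0 \<le> T"
  shows "exp (- r * T) * expectation (\<lambda>\<omega>. x T \<omega> * y T \<omega>)
    \<le> expectation (\<lambda>\<omega>. \<zeta> \<omega> * y 0 \<omega>) - \<kappa> * (LBINT s:{0..T}. w s)"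
proof -
  define u where "u t = expectation (\<lambda>\<omega>. x t \<omega> * y t \<omega>)" for t
  define f where "f t = expectation (\<lambda>\<omega>. a t \<omega> * y t \<omega> + x t \<omega> * g t \<omega>)" for t
  have f: "set_integrable lborel {0..T} f"
    using fubini_time(4)[of "{0..T}" "\<lambda>t \<omega>. a t \<omega> * y t \<omega> + x t \<omega> * g t \<omega>"]
      Bochner_Integration.integrable_add[OF loc_L2_prod[OF a_L2 y_L2 T] loc_L2_prod[OF x_L2 g_L2 T]]
    by (simp add: split_beta' distrib_left f_def[abs_def])
  have e: "set_integrable lborel {0..T} (\<lambda>s. - r * exp (- r * s))"
    unfolding set_integrable_def by (intro borel_integrable_compact) (auto intro!: continuous_intros)
  have E: "exp (- r * t) = 1 + (LBINT s:{0..t}. - r * exp (- r * s))" if "0 \<le> t" for t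
  proof -
    have "(\<integral>s. (- r * exp (- r * s)) * indicator {0..t} s \<partial>lborel) = exp (- r * t) - exp (- r * 0)"
      using that by (intro integral_FTC_Icc_real) (auto intro!: derivative_eq_intros continuous_intros)
    then show ?thesis by (simp add: set_lebesgue_integral_def mult.commute)
  qed
  \<comment> \<open>\<open>u\<close> is differentiable only in the integrated sense of
    \<open>expectation_xy\<close>, so the discount factor is brought in by integration by
    parts.\<close>
  note ibp = lebesgue_integration_by_parts[OF T f e, of u "expectation (\<lambda>\<omega>. \<zeta> \<omega> * y 0 \<omega>)" "\<lambda>t. exp (- r * t)" 1,
      OF expectation_xy[folded u_def f_def] E]
  have "u T * exp (- r * T) = expectation (\<lambda>\<omega>. \<zeta> \<omega> * y 0 \<omega>) + (LBINT s:{0..T}. f s * exp (- r * s) + u s * (- r * exp (- r * s)))"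
    using ibp(3) by simp
  also have "(LBINT s:{0..T}. f s * exp (- r * s) + u s * (- r * exp (- r * s))) \<le> (LBINT s:{0..T}. - \<kappa> * w s)"
  proof (rule set_integral_mono_AE)
    show "set_integrable lborel {0..T} (\<lambda>s. f s * exp (- r * s) + u s * (- r * exp (- r * s)))"
      using ibp(1,2) by (intro set_integral_add) auto
    show "set_integrable lborel {0..T} (\<lambda>s. - \<kappa> * w s)"
      using w_set_integrable[of "{0..T}"] by (intro set_integrable_mult_right) auto
    show "AE s \<in> {0..T} in lborel. f s * exp (- r * s) + u s * (- r * exp (- r * s)) \<le> - \<kappa> * w s"
      using loc_L2_AE_square[OF a_L2] loc_L2_AE_square[OF c_L2] loc_L2_AE_square[OF g_L2]
    proof eventually_elim
      case (elim s)
      show ?case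
      proof
        assume s: "s \<in> {0..T}"
        note m = loc_L2_measurable(2)[of _ s, OF x_L2] loc_L2_measurable(2)[of _ s, OF y_L2] loc_L2_measurable(2)[of _ s, OF a_L2]
          loc_L2_measurable(2)[of _ s, OF c_L2] loc_L2_measurable(2)[of _ s, OF g_L2]
        have i: "integrable M (\<lambda>\<omega>. a s \<omega> * y s \<omega>)" "integrable M (\<lambda>\<omega>. x s \<omega> * c s \<omega>)"
          "integrable M (\<lambda>\<omega>. x s \<omega> * y s \<omega>)" "integrable M (\<lambda>\<omega>. x s \<omega> * g s \<omega>)"
          using elim s m x_square[of s] y_square[of s] by (auto intro!: integrable_mult_square)
        have "f s = expectation (\<lambda>\<omega>. (a s \<omega> * y s \<omega> - x s \<omega> * c s \<omega>) + r * (x s \<omega> * y s \<omega>))"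
          by (simp add: f_def g_def algebra_simps)
        also have "\<dots> = expectation (\<lambda>\<omega>. a s \<omega> * y s \<omega> - x s \<omega> * c s \<omega>) + r * u s"
          unfolding u_def using i by simp
        also have "expectation (\<lambda>\<omega>. a s \<omega> * y s \<omega> - x s \<omega> * c s \<omega>) \<le> expectation (\<lambda>\<omega>. - \<kappa> * ((x s \<omega>)\<^sup>2 + (y s \<omega>)\<^sup>2))"
          using i s x_square[of s] y_square[of s] monotone[of s] by (intro integral_mono) auto
        finally have "f s - r * u s \<le> - \<kappa> * expectation (\<lambda>\<omega>. (x s \<omega>)\<^sup>2 + (y s \<omega>)\<^sup>2)" by simp
        then have "exp (- r * s) * (f s - r * u s) \<le> exp (- r * s) * (- \<kappa> * expectation (\<lambda>\<omega>. (x s \<omega>)\<^sup>2 + (y s \<omega>)\<^sup>2))"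
          by (intro mult_left_mono) auto
        also have "\<dots> = - \<kappa> * w s" by (simp add: w_def)
        finally show "f s * exp (- r * s) + u s * (- r * exp (- r * s)) \<le> - \<kappa> * w s"
          by (simp add: algebra_simps)
      qed
    qed
  qed
  also have "(LBINT s:{0..T}. - \<kappa> * w s) = - \<kappa> * (LBINT s:{0..T}. w s)" by (rule set_integral_mult_right)
  finally show ?thesis by (simp add: u_def mult.commute)
qed

text \<open>Here weighted integrability replaces a terminal condition. If the bound failed at some
  \<open>T\<close> by \<open>d > 0\<close>, the discounted product would stay below
  \<open>- d\<close> from \<open>T\<close> on. As it is at least \<open>- w\<close>, this would
  force \<open>w \<ge> d\<close> on a half-line, against the integrability of
  \<open>w\<close>.\<close>

lemma energy_le: "\<kappa> * energy \<le> expectation (\<lambda>\<omega>. \<zeta> \<omega> * y 0 \<omega>)"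
proof -
  let ?W = "\<lambda>T. LBINT s:{0..T}. w s"
  have le: "\<kappa> * ?W T \<le> expectation (\<lambda>\<omega>. \<zeta> \<omega> * y 0 \<omega>)" if T: "0 \<le> T" for T
  proof (rule ccontr)
    define d where "d = \<kappa> * ?W T - expectation (\<lambda>\<omega>. \<zeta> \<omega> * y 0 \<omega>)"
    assume "\<not> \<kappa> * ?W T \<le> expectation (\<lambda>\<omega>. \<zeta> \<omega> * y 0 \<omega>)"
    then have d: "0 < d" by (simp add: d_def)
    have wd: "d \<le> w t" if t: "T \<le> t" for t
    proof -
      have t0: "0 \<le> t" using t T by simp
      have "?W T \<le> ?W t"
        unfolding set_lebesgue_integral_def
        using w_set_integrable[of "{0..T}"] w_set_integrable[of "{0..t}"] w_nonneg t unfolding set_integrable_def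
        by (intro integral_mono) (auto simp: indicator_def)
      then have "\<kappa> * ?W T \<le> \<kappa> * ?W t" using \<kappa> by simp
      then have "exp (- r * t) * expectation (\<lambda>\<omega>. x t \<omega> * y t \<omega>) \<le> - d"
        using discounted_xy_le[OF t0] by (simp add: d_def)
      also have "- w t \<le> exp (- r * t) * expectation (\<lambda>\<omega>. x t \<omega> * y t \<omega>)"
      proof -
        have i: "integrable M (\<lambda>\<omega>. x t \<omega> * y t \<omega>)"
          using x_square[OF t0] y_square[OF t0] loc_L2_measurable(2) x_L2 y_L2 by (intro integrable_mult_square) auto
        have "- ((x t \<omega>)\<^sup>2 + (y t \<omega>)\<^sup>2) \<le> x t \<omega> * y t \<omega>" for \<omega>
        proof -
          have "x t \<omega> * y t \<omega> + ((x t \<omega>)\<^sup>2 + (y t \<omega>)\<^sup>2) = ((x t \<omega> + y t \<omega>)\<^sup>2 + (x t \<omega>)\<^sup>2 + (y t \<omega>)\<^sup>2) / 2"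
            by (simp add: power2_eq_square algebra_simps)
          then show ?thesis by (smt (verit) zero_le_power2 divide_nonneg_pos)
        qed
        then have "expectation (\<lambda>\<omega>. - ((x t \<omega>)\<^sup>2 + (y t \<omega>)\<^sup>2)) \<le> expectation (\<lambda>\<omega>. x t \<omega> * y t \<omega>)"
          using i x_square[OF t0] y_square[OF t0] by (intro integral_mono) auto
        then have "exp (- r * t) * expectation (\<lambda>\<omega>. - ((x t \<omega>)\<^sup>2 + (y t \<omega>)\<^sup>2)) \<le> exp (- r * t) * expectation (\<lambda>\<omega>. x t \<omega> * y t \<omega>)"
          by (intro mult_left_mono) auto
        then show ?thesis by (simp add: w_def del: minus_add_distrib)
      qed
      ultimately show ?thesis by simp
    qed
    have dn: "d * n \<le> energy" if n: "0 \<le> n" for n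
    proof -
      have "d * n = (LBINT t:{T..T + n}. d)"
        using n by (simp add: set_integral_const)
      also have "\<dots> \<le> (LBINT t:{T..T + n}. w t)"
        using w_set_integrable[of "{T..T+n}"] T wd by (intro set_integral_mono) (auto simp: set_integrable_def)
      also have "\<dots> \<le> energy" using T by (intro w_integral_le_energy) auto
      finally show ?thesis .
    qed
    have "0 \<le> energy"
      unfolding energy_def set_lebesgue_integral_def using w_nonneg by (intro Bochner_Integration.integral_nonneg) auto
    \<comment> \<open>An interval so long that \<open>d\<close> times its length is
      \<open>energy + 1\<close>.\<close>
    then have "d * ((energy + 1) / d) \<le> energy" using d by (intro dn) auto
    then show False using d by simp
  qed
  have "((\<lambda>T. \<kappa> * ?W T) \<longlongrightarrow> \<kappa> * energy) at_top"
    unfolding energy_def using w_integrable by (intro tendsto_mult tendsto_const tendsto_set_lebesgue_integral_at_top) auto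
  moreover have "\<forall>\<^sub>F T in at_top. \<kappa> * ?W T \<le> expectation (\<lambda>\<omega>. \<zeta> \<omega> * y 0 \<omega>)"
    using eventually_ge_at_top[of "0::real"] by eventually_elim (rule le)
  ultimately show ?thesis by (rule tendsto_upperbound) simp
qed

text \<open>The energy controls \<open>y\<close> on time average and says nothing about the single
  time 0. Against a test variable known at time 0, however, \<open>y 0\<close> may be exchanged for
  \<open>N s\<close> at any later \<open>s\<close>; averaging over the unit interval then yields a
  time integral, within reach of the energy.\<close>

lemma initial_value_le:
  assumes G: "G \<in> borel_measurable (F 0)" and G2: "integrable M (\<lambda>\<omega>. (G \<omega>)\<^sup>2)"
  shows "expectation (\<lambda>\<omega>. G \<omega> * y 0 \<omega>) \<le> K * (LBINT s:{0..1}. expectation (\<lambda>\<omega>. \<bar>G \<omega>\<bar> * (\<bar>x s \<omega>\<bar> + \<bar>y s \<omega>\<bar>)))"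
proof -
  have GM: "G \<in> borel_measurable M" using G subalg by (rule measurable_from_subalg[rotated])
  have GL: "loc_L2 M (\<lambda>t. G)" "loc_L2 M (\<lambda>t \<omega>. \<bar>G \<omega>\<bar>)" using GM G2 by (auto intro!: loc_L2_const loc_L2_abs)
  \<comment> \<open>One variable dominating \<open>J s\<close> for all \<open>s\<close> in
    \<open>[0,1]\<close> simultaneously.\<close>
  define Gb where "Gb \<omega> = (LBINT s:{0..1}. \<bar>g s \<omega>\<bar>)" for \<omega>
  have Gb: "Gb \<in> borel_measurable M" "integrable M (\<lambda>\<omega>. (Gb \<omega>)\<^sup>2)"
    using loc_L2_time_integral[OF loc_L2_abs[OF g_L2]] loc_L2_measurable(2) unfolding Gb_def[abs_def] by auto
  have iGb: "integrable M (\<lambda>\<omega>. \<bar>G \<omega>\<bar> * Gb \<omega>)" using GM G2 Gb by (intro integrable_mult_square) auto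
  have iGy: "integrable (lborel \<Otimes>\<^sub>M M) (\<lambda>(t, \<omega>). indicator {0..1} t * (\<bar>G \<omega>\<bar> * \<bar>y t \<omega>\<bar>))"
    using loc_L2_prod[OF GL(2) loc_L2_abs[OF y_L2]] by simp
  have iGg: "integrable (lborel \<Otimes>\<^sub>M M) (\<lambda>(t, \<omega>). indicator {0..1} t * (\<bar>G \<omega>\<bar> * \<bar>g t \<omega>\<bar>))"
    using loc_L2_prod[OF GL(2) loc_L2_abs[OF g_L2]] by simp
  have iGxy: "integrable (lborel \<Otimes>\<^sub>M M) (\<lambda>(t, \<omega>). indicator {0..1} t * (\<bar>G \<omega>\<bar> * (\<bar>x t \<omega>\<bar> + \<bar>y t \<omega>\<bar>)))"
    using loc_L2_prod[OF GL(2) loc_L2_add[OF loc_L2_abs[OF x_L2] loc_L2_abs[OF y_L2]]] by simp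
  have Jb: "AE \<omega> in M. \<forall>s. 0 \<le> s \<and> s \<le> 1 \<longrightarrow> \<bar>J s \<omega>\<bar> \<le> Gb \<omega>"
    using fubini_time(1)[OF loc_L2_integrable[OF g_L2, of 1, simplified]]
    unfolding J_def Gb_def by eventually_elim (auto intro: abs_set_integral_Icc_le)
  have pt: "expectation (\<lambda>\<omega>. G \<omega> * y 0 \<omega>) \<le> expectation (\<lambda>\<omega>. \<bar>G \<omega>\<bar> * \<bar>y s \<omega>\<bar>) + expectation (\<lambda>\<omega>. \<bar>G \<omega>\<bar> * Gb \<omega>)"
    if s: "0 \<le> s" "s \<le> 1" for s
  proof -
    have i: "integrable M (\<lambda>\<omega>. \<bar>G \<omega>\<bar> * \<bar>y s \<omega>\<bar>)" "integrable M (\<lambda>\<omega>. G \<omega> * N s \<omega>)"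
      using GM G2 y_square[OF s(1)] N_square[OF s(1)] loc_L2_measurable(2) y_L2 N_L2 by (auto intro!: integrable_mult_square)
    have "expectation (\<lambda>\<omega>. G \<omega> * y 0 \<omega>) = expectation (\<lambda>\<omega>. G \<omega> * N s \<omega>)"
      using orthogonality[OF _ s(1) G G2] by (simp add: N_0)
    also have "\<dots> \<le> expectation (\<lambda>\<omega>. \<bar>G \<omega>\<bar> * \<bar>y s \<omega>\<bar> + \<bar>G \<omega>\<bar> * Gb \<omega>)"
    proof (rule integral_mono_AE)
      show "AE \<omega> in M. G \<omega> * N s \<omega> \<le> \<bar>G \<omega>\<bar> * \<bar>y s \<omega>\<bar> + \<bar>G \<omega>\<bar> * Gb \<omega>"
        using Jb
      proof eventually_elim
        case (elim \<omega>)
        have "G \<omega> * N s \<omega> \<le> \<bar>G \<omega>\<bar> * \<bar>N s \<omega>\<bar>" by (metis abs_ge_self abs_mult)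
        also have "\<dots> \<le> \<bar>G \<omega>\<bar> * (\<bar>y s \<omega>\<bar> + Gb \<omega>)"
        proof (rule mult_left_mono)
          have "\<bar>J s \<omega>\<bar> \<le> Gb \<omega>" using elim s by simp
          then show "\<bar>N s \<omega>\<bar> \<le> \<bar>y s \<omega>\<bar> + Gb \<omega>" unfolding N_def by linarith
        qed simp
        finally show ?case by (simp add: distrib_left)
      qed
    qed (use i iGb in auto)
    also have "\<dots> = expectation (\<lambda>\<omega>. \<bar>G \<omega>\<bar> * \<bar>y s \<omega>\<bar>) + expectation (\<lambda>\<omega>. \<bar>G \<omega>\<bar> * Gb \<omega>)"
      using i(1) iGb by simp
    finally show ?thesis .
  qed
  \<comment> \<open>The bound \<open>pt\<close> depends on \<open>s\<close> only on its right side,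
    so it can be averaged over an interval of length 1.\<close>
  have "expectation (\<lambda>\<omega>. G \<omega> * y 0 \<omega>) = (LBINT s:{0..1::real}. expectation (\<lambda>\<omega>. G \<omega> * y 0 \<omega>))"
    by (rule set_integral_unit_const(2)[symmetric])
  also have "\<dots> \<le> (LBINT s:{0..1}. expectation (\<lambda>\<omega>. \<bar>G \<omega>\<bar> * \<bar>y s \<omega>\<bar>) + expectation (\<lambda>\<omega>. \<bar>G \<omega>\<bar> * Gb \<omega>))"
    using fubini_time(4)[OF iGy] set_integral_unit_const pt by (intro set_integral_mono set_integral_add) auto
  also have "\<dots> = (LBINT s:{0..1}. expectation (\<lambda>\<omega>. \<bar>G \<omega>\<bar> * \<bar>y s \<omega>\<bar>)) + expectation (\<lambda>\<omega>. \<bar>G \<omega>\<bar> * Gb \<omega>)"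
    using fubini_time(4)[OF iGy] set_integral_unit_const by (subst set_integral_add) auto
  also have "expectation (\<lambda>\<omega>. \<bar>G \<omega>\<bar> * Gb \<omega>) = (LBINT s:{0..1}. expectation (\<lambda>\<omega>. \<bar>G \<omega>\<bar> * \<bar>g s \<omega>\<bar>))"
    using fubini_time(5)[OF iGg] by (simp add: Gb_def)
  also have "(LBINT s:{0..1}. expectation (\<lambda>\<omega>. \<bar>G \<omega>\<bar> * \<bar>y s \<omega>\<bar>)) + (LBINT s:{0..1}. expectation (\<lambda>\<omega>. \<bar>G \<omega>\<bar> * \<bar>g s \<omega>\<bar>))
     = (\<integral>z. (case z of (t, \<omega>) \<Rightarrow> indicator {0..1} t * (\<bar>G \<omega>\<bar> * \<bar>y t \<omega>\<bar>)) + (case z of (t, \<omega>) \<Rightarrow> indicator {0..1} t * (\<bar>G \<omega>\<bar> * \<bar>g t \<omega>\<bar>)) \<partial>(lborel \<Otimes>\<^sub>M M))"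
    using Bochner_Integration.integral_add[OF iGy iGg] fubini_time(6)[OF iGy] fubini_time(6)[OF iGg] by simp
  also have "\<dots> \<le> (\<integral>z. K * (case z of (t, \<omega>) \<Rightarrow> indicator {0..1} t * (\<bar>G \<omega>\<bar> * (\<bar>x t \<omega>\<bar> + \<bar>y t \<omega>\<bar>))) \<partial>(lborel \<Otimes>\<^sub>M M))"
  proof (rule integral_mono)
    show "integrable (lborel \<Otimes>\<^sub>M M) (\<lambda>z. (case z of (t, \<omega>) \<Rightarrow> indicator {0..1} t * (\<bar>G \<omega>\<bar> * \<bar>y t \<omega>\<bar>)) + (case z of (t, \<omega>) \<Rightarrow> indicator {0..1} t * (\<bar>G \<omega>\<bar> * \<bar>g t \<omega>\<bar>)))"
      using iGy iGg by (rule Bochner_Integration.integrable_add)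
    show "integrable (lborel \<Otimes>\<^sub>M M) (\<lambda>z. K * (case z of (t, \<omega>) \<Rightarrow> indicator {0..1} t * (\<bar>G \<omega>\<bar> * (\<bar>x t \<omega>\<bar> + \<bar>y t \<omega>\<bar>))))"
      using iGxy by simp
    fix z :: "real \<times> 'a" assume "z \<in> space (lborel \<Otimes>\<^sub>M M)"
    then obtain t \<omega> where z: "z = (t, \<omega>)" "\<omega> \<in> space M" by (cases z) (auto simp: space_pair_measure)
    have "\<bar>G \<omega>\<bar> * \<bar>y t \<omega>\<bar> + \<bar>G \<omega>\<bar> * \<bar>g t \<omega>\<bar> \<le> K * (\<bar>G \<omega>\<bar> * (\<bar>x t \<omega>\<bar> + \<bar>y t \<omega>\<bar>))" if t: "0 \<le> t"
    proof -
      have "\<bar>g t \<omega>\<bar> \<le> \<bar>r * y t \<omega>\<bar> + \<bar>c t \<omega>\<bar>" unfolding g_def by (rule abs_triangle_ineq4)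
      also have "\<dots> \<le> r * \<bar>y t \<omega>\<bar> + l * (\<bar>x t \<omega>\<bar> + \<bar>y t \<omega>\<bar>)"
        using c_bound[OF t z(2)] r by (simp add: abs_mult)
      finally have "\<bar>y t \<omega>\<bar> + \<bar>g t \<omega>\<bar> \<le> \<bar>y t \<omega>\<bar> + r * \<bar>y t \<omega>\<bar> + l * (\<bar>x t \<omega>\<bar> + \<bar>y t \<omega>\<bar>)" by simp
      also have "\<dots> \<le> K * (\<bar>x t \<omega>\<bar> + \<bar>y t \<omega>\<bar>)"
        using r by (simp add: K_def algebra_simps)
      finally have "\<bar>G \<omega>\<bar> * (\<bar>y t \<omega>\<bar> + \<bar>g t \<omega>\<bar>) \<le> \<bar>G \<omega>\<bar> * (K * (\<bar>x t \<omega>\<bar> + \<bar>y t \<omega>\<bar>))"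
        by (intro mult_left_mono) auto
      then show ?thesis by (simp add: algebra_simps)
    qed
    then show "(case z of (t, \<omega>) \<Rightarrow> indicator {0..1} t * (\<bar>G \<omega>\<bar> * \<bar>y t \<omega>\<bar>)) + (case z of (t, \<omega>) \<Rightarrow> indicator {0..1} t * (\<bar>G \<omega>\<bar> * \<bar>g t \<omega>\<bar>))
      \<le> K * (case z of (t, \<omega>) \<Rightarrow> indicator {0..1} t * (\<bar>G \<omega>\<bar> * (\<bar>x t \<omega>\<bar> + \<bar>y t \<omega>\<bar>)))"
      by (auto simp: z indicator_def)
  qed
  also have "\<dots> = K * (LBINT s:{0..1}. expectation (\<lambda>\<omega>. \<bar>G \<omega>\<bar> * (\<bar>x s \<omega>\<bar> + \<bar>y s \<omega>\<bar>)))"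
    using fubini_time(6)[OF iGxy] by simp
  finally show ?thesis .
qed

text \<open>The outcome of absorbing half of \<open>\<kappa> * energy\<close>: what remains is
  multiplied by \<open>2 / \<kappa>\<close>. The factor \<open>exp r\<close> bounds
  \<open>exp (r * s)\<close> on the unit interval.\<close>

definition "C_stab = 2 * K\<^sup>2 * exp r / \<kappa>\<^sup>2"

text \<open>\<open>energy_le\<close> bounds the energy by a term with \<open>y 0\<close>, and
  \<open>initial_value_le\<close> with \<open>G = \<zeta>\<close> bounds that term by the energy on
  \<open>[0,1]\<close>. The circle closes because Young's inequality makes the returning share of
  the energy as small as desired.\<close>

lemma stability: "energy \<le> C_stab * expectation (\<lambda>\<omega>. (\<zeta> \<omega>)\<^sup>2)"
proof -
  let ?q = "K\<^sup>2 * exp r / \<kappa> * expectation (\<lambda>\<omega>. (\<zeta> \<omega>)\<^sup>2)"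
  have iG: "integrable (lborel \<Otimes>\<^sub>M M) (\<lambda>(t, \<omega>). indicator {0..1} t * (\<bar>\<zeta> \<omega>\<bar> * (\<bar>x t \<omega>\<bar> + \<bar>y t \<omega>\<bar>)))"
    using loc_L2_prod[OF loc_L2_abs[OF loc_L2_const[OF \<zeta>_measurable \<zeta>_square]] loc_L2_add[OF loc_L2_abs[OF x_L2] loc_L2_abs[OF y_L2]]] by simp
  have pt: "K * expectation (\<lambda>\<omega>. \<bar>\<zeta> \<omega>\<bar> * (\<bar>x s \<omega>\<bar> + \<bar>y s \<omega>\<bar>)) \<le> \<kappa> / 2 * w s + ?q" if s: "0 \<le> s" "s \<le> 1" for s
  proof -
    have m: "x s \<in> borel_measurable M" "y s \<in> borel_measurable M" using loc_L2_measurable(2) x_L2 y_L2 by auto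
    have i: "integrable M (\<lambda>\<omega>. \<bar>\<zeta> \<omega>\<bar> * \<bar>x s \<omega>\<bar>)" "integrable M (\<lambda>\<omega>. \<bar>\<zeta> \<omega>\<bar> * \<bar>y s \<omega>\<bar>)"
      using \<zeta>_measurable \<zeta>_square x_square[OF s(1)] y_square[OF s(1)] m by (auto intro!: integrable_mult_square)
    \<comment> \<open>Young's inequality with weight \<open>\<kappa> * exp (- r * s)\<close>: taken
      for \<open>x\<close> and for \<open>y\<close>, the quadratic terms sum to half of
      \<open>\<kappa>\<close> times the integrand of \<open>w s\<close>.\<close>
    have half: "K * \<bar>\<zeta> \<omega>\<bar> * \<bar>v\<bar> \<le> \<kappa> / 2 * (exp (- r * s) * v\<^sup>2) + K\<^sup>2 * exp r / (2 * \<kappa>) * (\<zeta> \<omega>)\<^sup>2" for v \<omega>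
    proof -
      have "K * \<bar>\<zeta> \<omega>\<bar> * \<bar>v\<bar> \<le> (\<kappa> * exp (- r * s)) / 2 * \<bar>v\<bar>\<^sup>2 + (K * \<bar>\<zeta> \<omega>\<bar>)\<^sup>2 / (2 * (\<kappa> * exp (- r * s)))"
        using \<kappa> by (intro young_inequality_scaled) simp
      also have "(K * \<bar>\<zeta> \<omega>\<bar>)\<^sup>2 / (2 * (\<kappa> * exp (- r * s))) = K\<^sup>2 / (2 * \<kappa>) * (\<zeta> \<omega>)\<^sup>2 * exp (r * s)"
        by (simp add: power_mult_distrib exp_minus field_simps)
      also have "\<dots> \<le> K\<^sup>2 / (2 * \<kappa>) * (\<zeta> \<omega>)\<^sup>2 * exp r"
        using s r \<kappa> by (intro mult_left_mono) auto
      finally show ?thesis by (simp add: mult_ac)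
    qed
    have "K * expectation (\<lambda>\<omega>. \<bar>\<zeta> \<omega>\<bar> * (\<bar>x s \<omega>\<bar> + \<bar>y s \<omega>\<bar>)) = expectation (\<lambda>\<omega>. K * (\<bar>\<zeta> \<omega>\<bar> * (\<bar>x s \<omega>\<bar> + \<bar>y s \<omega>\<bar>)))"
      by simp
    also have "\<dots> = expectation (\<lambda>\<omega>. K * \<bar>\<zeta> \<omega>\<bar> * \<bar>x s \<omega>\<bar> + K * \<bar>\<zeta> \<omega>\<bar> * \<bar>y s \<omega>\<bar>)"
      by (intro Bochner_Integration.integral_cong) (auto simp: algebra_simps)
    also have "\<dots> \<le> expectation (\<lambda>\<omega>. \<kappa> / 2 * (exp (- r * s) * ((x s \<omega>)\<^sup>2 + (y s \<omega>)\<^sup>2)) + K\<^sup>2 * exp r / \<kappa> * (\<zeta> \<omega>)\<^sup>2)"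
    proof (rule integral_mono)
      show "integrable M (\<lambda>\<omega>. K * \<bar>\<zeta> \<omega>\<bar> * \<bar>x s \<omega>\<bar> + K * \<bar>\<zeta> \<omega>\<bar> * \<bar>y s \<omega>\<bar>)"
        using i by (simp add: mult.assoc)
      show "integrable M (\<lambda>\<omega>. \<kappa> / 2 * (exp (- r * s) * ((x s \<omega>)\<^sup>2 + (y s \<omega>)\<^sup>2)) + K\<^sup>2 * exp r / \<kappa> * (\<zeta> \<omega>)\<^sup>2)"
        using x_square[OF s(1)] y_square[OF s(1)] \<zeta>_square by simp
      show "K * \<bar>\<zeta> \<omega>\<bar> * \<bar>x s \<omega>\<bar> + K * \<bar>\<zeta> \<omega>\<bar> * \<bar>y s \<omega>\<bar>
        \<le> \<kappa> / 2 * (exp (- r * s) * ((x s \<omega>)\<^sup>2 + (y s \<omega>)\<^sup>2)) + K\<^sup>2 * exp r / \<kappa> * (\<zeta> \<omega>)\<^sup>2" for \<omega>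
        using half[of \<omega> "x s \<omega>"] half[of \<omega> "y s \<omega>"] \<kappa> by (simp add: field_simps)
    qed
    also have "\<dots> = \<kappa> / 2 * w s + ?q"
      unfolding w_def using x_square[OF s(1)] y_square[OF s(1)] \<zeta>_square by simp
    finally show ?thesis .
  qed
  have "\<kappa> * energy \<le> expectation (\<lambda>\<omega>. \<zeta> \<omega> * y 0 \<omega>)" by (rule energy_le)
  also have "\<dots> \<le> K * (LBINT s:{0..1}. expectation (\<lambda>\<omega>. \<bar>\<zeta> \<omega>\<bar> * (\<bar>x s \<omega>\<bar> + \<bar>y s \<omega>\<bar>)))"
    by (rule initial_value_le[OF \<zeta>_adapted \<zeta>_square])
  also have "\<dots> = (LBINT s:{0..1}. K * expectation (\<lambda>\<omega>. \<bar>\<zeta> \<omega>\<bar> * (\<bar>x s \<omega>\<bar> + \<bar>y s \<omega>\<bar>)))" by simp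
  also have "\<dots> \<le> (LBINT s:{0..1}. \<kappa> / 2 * w s + ?q)"
    using fubini_time(4)[OF iG] pt
    by (intro set_integral_mono unit_integral_affine_w set_integrable_mult_right) auto
  also have "\<dots> = \<kappa> / 2 * (LBINT s:{0..1}. w s) + ?q"
    by (rule unit_integral_affine_w)
  also have "\<dots> \<le> \<kappa> / 2 * energy + ?q"
    using w_integral_le_energy[of "{0..1}"] \<kappa> by simp
  finally have "\<kappa> / 2 * energy \<le> ?q" by linarith
  then have "2 / \<kappa> * (\<kappa> / 2 * energy) \<le> 2 / \<kappa> * ?q" using \<kappa> by (intro mult_left_mono) auto
  moreover have "2 / \<kappa> * (\<kappa> / 2 * energy) = energy" using \<kappa> by simp
  moreover have "2 / \<kappa> * ?q = C_stab * expectation (\<lambda>\<omega>. (\<zeta> \<omega>)\<^sup>2)" by (simp add: C_stab_def power2_eq_square)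
  ultimately show ?thesis by simp
qed

text \<open>Both bounds are proportional to \<open>prob A\<close>, as summation over slabs requires.
  With \<open>G = sgn (y 0)\<close> the tested quantity becomes the \<open>L1\<close> norm of
  \<open>y 0\<close>, and Young's inequality at scale \<open>\<delta>\<close> balances the energy,
  of order \<open>\<delta>\<^sup>2 * prob A\<close>, against the indicator of
  \<open>A\<close>.\<close>

lemma initial_value_L1:
  assumes A: "A \<in> events" and \<delta>: "0 < \<delta>"
    and off: "\<And>t \<omega>. 0 \<le> t \<Longrightarrow> \<omega> \<in> space M - A \<Longrightarrow> x t \<omega> = 0 \<and> y t \<omega> = 0"
    and \<zeta>: "\<And>\<omega>. \<omega> \<in> space M \<Longrightarrow> \<bar>\<zeta> \<omega>\<bar> \<le> \<delta> * indicator A \<omega>"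
  shows "expectation (\<lambda>\<omega>. \<bar>y 0 \<omega>\<bar>) \<le> K * (1 + exp r * C_stab / 2) * \<delta> * prob A"
    "energy \<le> C_stab * \<delta>\<^sup>2 * prob A"
proof -
  have "expectation (\<lambda>\<omega>. (\<zeta> \<omega>)\<^sup>2) \<le> expectation (\<lambda>\<omega>. \<delta>\<^sup>2 * indicator A \<omega>)"
  proof (rule integral_mono)
    fix \<omega> assume "\<omega> \<in> space M"
    from \<zeta>[OF this] show "(\<zeta> \<omega>)\<^sup>2 \<le> \<delta>\<^sup>2 * indicator A \<omega>"
      using \<delta> by (auto simp: indicator_def abs_le_square_iff[symmetric] split: if_splits)
  qed (use A \<zeta>_square in \<open>auto intro!: integrable_mult_right simp: emeasure_eq_measure\<close>)
  also have "\<dots> = \<delta>\<^sup>2 * prob A" using A by simp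
  finally have "C_stab * expectation (\<lambda>\<omega>. (\<zeta> \<omega>)\<^sup>2) \<le> C_stab * (\<delta>\<^sup>2 * prob A)"
    by (intro mult_left_mono) (auto simp: C_stab_def)
  then show en: "energy \<le> C_stab * \<delta>\<^sup>2 * prob A" using stability by (simp add: mult.assoc)
  define G where "G \<omega> = sgn (y 0 \<omega>)" for \<omega>
  have G: "G \<in> borel_measurable (F 0)" unfolding G_def[abs_def] using y0_adapted by simp
  have G1: "\<bar>G \<omega>\<bar> \<le> 1" for \<omega> by (simp add: G_def sgn_if)
  have GM: "G \<in> borel_measurable M" using G subalg by (rule measurable_from_subalg[rotated])
  have G2: "integrable M (\<lambda>\<omega>. (G \<omega>)\<^sup>2)"
    using GM G1 by (intro integrable_const_bound[where B=1]) (auto simp: power_le_one abs_square_le_1)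
  have iG: "integrable (lborel \<Otimes>\<^sub>M M) (\<lambda>(t, \<omega>). indicator {0..1} t * (\<bar>G \<omega>\<bar> * (\<bar>x t \<omega>\<bar> + \<bar>y t \<omega>\<bar>)))"
    using loc_L2_prod[OF loc_L2_abs[OF loc_L2_const[OF GM G2]] loc_L2_add[OF loc_L2_abs[OF x_L2] loc_L2_abs[OF y_L2]]] by simp
  have pt: "expectation (\<lambda>\<omega>. \<bar>G \<omega>\<bar> * (\<bar>x s \<omega>\<bar> + \<bar>y s \<omega>\<bar>)) \<le> \<delta> * prob A + exp r / (2 * \<delta>) * w s" if s: "0 \<le> s" "s \<le> 1" for s
  proof -
    have m: "x s \<in> borel_measurable M" "y s \<in> borel_measurable M" using loc_L2_measurable(2) x_L2 y_L2 by auto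
    have "expectation (\<lambda>\<omega>. \<bar>G \<omega>\<bar> * (\<bar>x s \<omega>\<bar> + \<bar>y s \<omega>\<bar>))
      \<le> expectation (\<lambda>\<omega>. \<delta> * indicator A \<omega> + exp r / (2 * \<delta>) * (exp (- r * s) * ((x s \<omega>)\<^sup>2 + (y s \<omega>)\<^sup>2)))"
    proof (rule integral_mono)
      have "integrable M (\<lambda>\<omega>. \<bar>G \<omega>\<bar> * \<bar>x s \<omega>\<bar>)" "integrable M (\<lambda>\<omega>. \<bar>G \<omega>\<bar> * \<bar>y s \<omega>\<bar>)"
        using GM G2 x_square[OF s(1)] y_square[OF s(1)] m by (auto intro!: integrable_mult_square)
      then show "integrable M (\<lambda>\<omega>. \<bar>G \<omega>\<bar> * (\<bar>x s \<omega>\<bar> + \<bar>y s \<omega>\<bar>))" by (simp add: distrib_left)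
      show "integrable M (\<lambda>\<omega>. \<delta> * indicator A \<omega> + exp r / (2 * \<delta>) * (exp (- r * s) * ((x s \<omega>)\<^sup>2 + (y s \<omega>)\<^sup>2)))"
        using x_square[OF s(1)] y_square[OF s(1)] A
        by (intro Bochner_Integration.integrable_add integrable_mult_right) (auto simp: emeasure_eq_measure)
      fix \<omega> assume \<omega>: "\<omega> \<in> space M"
      show "\<bar>G \<omega>\<bar> * (\<bar>x s \<omega>\<bar> + \<bar>y s \<omega>\<bar>) \<le> \<delta> * indicator A \<omega> + exp r / (2 * \<delta>) * (exp (- r * s) * ((x s \<omega>)\<^sup>2 + (y s \<omega>)\<^sup>2))"
      proof (cases "\<omega> \<in> A")
        case True
        \<comment> \<open>The weight \<open>1 / \<delta>\<close> produces a constant of size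
          \<open>\<delta>\<close>, acceptable because everything vanishes off \<open>A\<close>; the
          discount is compensated by \<open>exp r\<close> since \<open>s \<le> 1\<close>.\<close>
        have h: "\<bar>v\<bar> \<le> \<delta> / 2 + exp r / (2 * \<delta>) * (exp (- r * s) * v\<^sup>2)" for v
        proof -
          have "1 * \<bar>v\<bar> \<le> (1 / \<delta>) / 2 * \<bar>v\<bar>\<^sup>2 + 1\<^sup>2 / (2 * (1 / \<delta>))"
            using \<delta> by (intro young_inequality_scaled) simp
          then have 1: "\<bar>v\<bar> \<le> \<delta> / 2 + 1 / (2 * \<delta>) * (1 * v\<^sup>2)" using \<delta> by simp
          have "1 \<le> exp r * exp (- r * s)" using r s by (simp flip: exp_add add: mult_le_cancel_left2)
          then have "1 / (2 * \<delta>) * (1 * v\<^sup>2) \<le> 1 / (2 * \<delta>) * ((exp r * exp (- r * s)) * v\<^sup>2)"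
            using \<delta> by (intro mult_left_mono mult_right_mono) auto
          then show ?thesis using 1 by (simp add: mult_ac)
        qed
        have "\<bar>G \<omega>\<bar> * (\<bar>x s \<omega>\<bar> + \<bar>y s \<omega>\<bar>) \<le> 1 * (\<bar>x s \<omega>\<bar> + \<bar>y s \<omega>\<bar>)"
          using G1[of \<omega>] by (intro mult_right_mono) auto
        then show ?thesis using h[of "x s \<omega>"] h[of "y s \<omega>"] True by (simp add: distrib_left)
      next
        case False
        then show ?thesis using off[OF s(1), of \<omega>] \<omega> by simp
      qed
    qed
    also have "\<dots> = \<delta> * prob A + exp r / (2 * \<delta>) * w s"
      unfolding w_def using x_square[OF s(1)] y_square[OF s(1)] A
      by (subst Bochner_Integration.integral_add) (auto intro!: integrable_mult_right simp: emeasure_eq_measure)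
    finally show ?thesis .
  qed
  have "expectation (\<lambda>\<omega>. \<bar>y 0 \<omega>\<bar>) = expectation (\<lambda>\<omega>. G \<omega> * y 0 \<omega>)"
    by (simp add: G_def abs_sgn mult.commute)
  also have "\<dots> \<le> K * (LBINT s:{0..1}. expectation (\<lambda>\<omega>. \<bar>G \<omega>\<bar> * (\<bar>x s \<omega>\<bar> + \<bar>y s \<omega>\<bar>)))"
    by (rule initial_value_le[OF G G2])
  also have "(LBINT s:{0..1}. expectation (\<lambda>\<omega>. \<bar>G \<omega>\<bar> * (\<bar>x s \<omega>\<bar> + \<bar>y s \<omega>\<bar>))) \<le> (LBINT s:{0..1}. exp r / (2 * \<delta>) * w s + \<delta> * prob A)"
    using fubini_time(4)[OF iG] pt
    by (intro set_integral_mono unit_integral_affine_w) (auto simp: add.commute)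
  also have "\<dots> = exp r / (2 * \<delta>) * (LBINT s:{0..1}. w s) + \<delta> * prob A"
    by (rule unit_integral_affine_w)
  also have "\<dots> \<le> exp r / (2 * \<delta>) * (C_stab * \<delta>\<^sup>2 * prob A) + \<delta> * prob A"
    using w_integral_le_energy[of "{0..1}"] en \<delta> by (intro add_right_mono mult_left_mono) auto
  also have "\<dots> = (1 + exp r * C_stab / 2) * \<delta> * prob A"
    using \<delta> by (simp add: field_simps power2_eq_square)
  finally show "expectation (\<lambda>\<omega>. \<bar>y 0 \<omega>\<bar>) \<le> K * (1 + exp r * C_stab / 2) * \<delta> * prob A"
    using K_pos by (simp add: mult_left_mono mult.assoc)
qed

end

section \<open>Solutions along a fixed flow of laws\<close>

text \<open>Processes are constrained at nonnegative times only; \<open>ext\<close> makes them measurable on all of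
  \<open>\<real> \<times> \<Omega>\<close>.\<close>

definition ext :: "(real \<Rightarrow> 'a \<Rightarrow> real) \<Rightarrow> real \<Rightarrow> 'a \<Rightarrow> real" where
  "ext v t \<omega> = v (max 0 t) \<omega>"

lemma ext_nonneg [simp]: "0 \<le> t \<Longrightarrow> ext v t = v t"
  by (simp add: ext_def fun_eq_iff)

lemma time_axis_measurable_ext:
  assumes "(\<lambda>(t, \<omega>). v t \<omega>) \<in> borel_measurable (time_axis \<Otimes>\<^sub>M M)"
  shows "(\<lambda>(t, \<omega>). ext v t \<omega>) \<in> borel_measurable (borel \<Otimes>\<^sub>M M)"
proof -
  have "(\<lambda>(t, \<omega>). (max 0 t, \<omega>)) \<in> measurable (borel \<Otimes>\<^sub>M M) (time_axis \<Otimes>\<^sub>M M)"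
    by (auto intro!: measurable_Pair measurable_restrict_space2 simp: split_beta')
  from measurable_compose[OF this assms] show ?thesis by (simp add: ext_def split_beta')
qed

section \<open>Passage from \<open>Lr2\<close> to locally square integrable processes\<close>

context brownian_setup
begin

interpretation P: pair_sigma_finite lborel M ..

lemma Lr2_ext:
  assumes v: "v \<in> Lr2 M \<F> r"
  shows "(\<lambda>(t, \<omega>). ext v t \<omega>) \<in> borel_measurable (borel \<Otimes>\<^sub>M M)"
    "integrable (lborel \<Otimes>\<^sub>M M) (\<lambda>(t, \<omega>). indicator {0..} t * (exp (- r * t) * (ext v t \<omega>)\<^sup>2))"
    "0 \<le> t \<Longrightarrow> v t \<in> borel_measurable (\<F> t)"
proof -
  show m: "(\<lambda>(t, \<omega>). ext v t \<omega>) \<in> borel_measurable (borel \<Otimes>\<^sub>M M)"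
    using v by (intro time_axis_measurable_ext) (simp add: Lr2_def)
  show "0 \<le> t \<Longrightarrow> v t \<in> borel_measurable (\<F> t)" using v by (simp add: Lr2_def)
  let ?f = "\<lambda>(t, \<omega>). indicator {0..} t * (exp (- r * t) * (ext v t \<omega>)\<^sup>2)"
  have m': "(\<lambda>z. ext v (fst z) (snd z)) \<in> borel_measurable (lborel \<Otimes>\<^sub>M M)"
    using m unfolding measurable_lborel_pair by (simp add: split_beta')
  have mf: "?f \<in> borel_measurable (lborel \<Otimes>\<^sub>M M)" using m' by (simp add: split_beta')
  show "integrable (lborel \<Otimes>\<^sub>M M) ?f"
  proof (rule integrableI_bounded[OF mf])
    have "(\<integral>\<^sup>+z. ennreal (norm (?f z)) \<partial>(lborel \<Otimes>\<^sub>M M)) = (\<integral>\<^sup>+\<omega>. (\<integral>\<^sup>+t. ennreal (norm (?f (t, \<omega>))) \<partial>lborel) \<partial>M)"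
      using mf by (intro P.nn_integral_snd[symmetric]) simp
    also have "\<dots> = (\<integral>\<^sup>+\<omega>. (\<integral>\<^sup>+t. ennreal (exp (- r * t) * \<bar>v t \<omega>\<bar>\<^sup>2) \<partial>time_axis) \<partial>M)"
      by (simp add: nn_integral_restrict_space) (auto intro!: nn_integral_cong simp: indicator_def)
    also have "\<dots> < \<infinity>" using v by (simp add: Lr2_def)
    finally show "(\<integral>\<^sup>+z. ennreal (norm (?f z)) \<partial>(lborel \<Otimes>\<^sub>M M)) < \<infinity>" .
  qed
qed

lemma Lr2_loc_L2:
  assumes "v \<in> Lr2 M \<F> r" "0 < r"
  shows "loc_L2 M (ext v)"
proof -
  show ?thesis using Lr2_ext[OF assms(1)] assms(2) by (intro loc_L2_of_weighted) auto
qed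

end

text \<open>Continuity of the flow serves to make \<open>(t, \<omega>) \<mapsto> \<partial>H(X\<^sub>t, m\<^sub>t, Y\<^sub>t)\<close> jointly measurable.\<close>

locale mckean_flow = brownian_setup M B F0
  for M :: "'a measure" and B :: "real \<Rightarrow> 'a \<Rightarrow> real" and F0 :: "'a measure" +
  fixes H :: "real \<Rightarrow> real measure \<Rightarrow> real \<Rightarrow> real" and m :: "real \<Rightarrow> real measure" and r l \<kappa> :: real
  assumes r: "0 < r" and l: "0 < l" and \<kappa>: "0 < \<kappa>"
    and lipschitz_y: "\<And>x x' \<mu> \<mu>' y y'. \<mu> \<in> P2 \<Longrightarrow> \<mu>' \<in> P2 \<Longrightarrow>
          \<bar>partial_y H x \<mu> y - partial_y H x' \<mu>' y'\<bar> \<le> l * (\<bar>x - x'\<bar> + \<bar>y - y'\<bar> + W2 \<mu> \<mu>')"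
    and lipschitz_x: "\<And>x x' \<mu> \<mu>' y y'. \<mu> \<in> P2 \<Longrightarrow> \<mu>' \<in> P2 \<Longrightarrow>
          \<bar>partial_x H x \<mu> y - partial_x H x' \<mu>' y'\<bar> \<le> l * (\<bar>x - x'\<bar> + \<bar>y - y'\<bar> + W2 \<mu> \<mu>')"
    and monotone: "\<And>x x' \<mu> y y'. \<mu> \<in> P2 \<Longrightarrow>
          - (x - x') * (partial_x H x \<mu> y - partial_x H x' \<mu> y')
            + (y - y') * (partial_y H x \<mu> y - partial_y H x' \<mu> y')
          \<le> - \<kappa> * (\<bar>x - x'\<bar>\<^sup>2 + \<bar>y - y'\<bar>\<^sup>2)"
    and flow_P2: "\<And>t. 0 \<le> t \<Longrightarrow> m t \<in> P2"
    and flow_continuous: "\<And>T. 0 \<le> T \<Longrightarrow> \<exists>L. \<forall>s\<in>{0..T}. \<forall>t\<in>{0..T}. W2 (m s) (m t) \<le> L * sqrt \<bar>s - t\<bar>"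
begin

interpretation P: pair_sigma_finite lborel M ..

text \<open>Clamping time as in \<open>ext\<close> keeps the inserted law in \<open>P2\<close> for
  every real \<open>t\<close>.\<close>

definition "\<phi> t x y = partial_y H x (m (max 0 t)) y"
definition "\<psi> t x y = partial_x H x (m (max 0 t)) y"

lemma W2_flow_self: "W2 (m (max 0 t)) (m (max 0 t)) = 0"
  using flow_P2[of "max 0 t"] by (intro W2_self) (auto simp: P2_def)

lemma \<phi>_lipschitz: "\<bar>\<phi> t x y - \<phi> t x' y'\<bar> \<le> l * (\<bar>x - x'\<bar> + \<bar>y - y'\<bar>)"
  using lipschitz_y[OF flow_P2 flow_P2, of "max 0 t" "max 0 t" x y x' y'] by (simp add: \<phi>_def W2_flow_self)

lemma \<psi>_lipschitz: "\<bar>\<psi> t x y - \<psi> t x' y'\<bar> \<le> l * (\<bar>x - x'\<bar> + \<bar>y - y'\<bar>)"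
  using lipschitz_x[OF flow_P2 flow_P2, of "max 0 t" "max 0 t" x y x' y'] by (simp add: \<psi>_def W2_flow_self)

lemma \<phi>_\<psi>_monotone:
  "(\<phi> t x y - \<phi> t x' y') * (y - y') - (x - x') * (\<psi> t x y - \<psi> t x' y') \<le> - \<kappa> * ((x - x')\<^sup>2 + (y - y')\<^sup>2)"
  using monotone[OF flow_P2, of "max 0 t" x x' y y'] by (simp add: \<phi>_def \<psi>_def algebra_simps)

lemma coefficient_continuous:
  assumes lip: "\<And>x x' \<mu> \<mu>' y y'. \<mu> \<in> P2 \<Longrightarrow> \<mu>' \<in> P2 \<Longrightarrow> \<bar>D x \<mu> y - D x' \<mu>' y'\<bar> \<le> l * (\<bar>x - x'\<bar> + \<bar>y - y'\<bar> + W2 \<mu> \<mu>')"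
  shows "continuous_on UNIV (\<lambda>p :: real \<times> real \<times> real. D (fst (snd p)) (m (max 0 (fst p))) (snd (snd p)))"
proof (rule continuous_at_imp_continuous_on, rule ballI)
  let ?f = "\<lambda>p :: real \<times> real \<times> real. D (fst (snd p)) (m (max 0 (fst p))) (snd (snd p))"
  fix p0 :: "real \<times> real \<times> real"
  \<comment> \<open>All times near \<open>fst p0\<close> stay below this \<open>T\<close>, so a
    single modulus \<open>L\<close> of the flow serves the whole neighbourhood.\<close>
  define T where "T = max 0 (fst p0) + 1"
  have "0 \<le> T" by (simp add: T_def)
  then obtain L where "\<forall>s\<in>{0..T}. \<forall>t\<in>{0..T}. W2 (m s) (m t) \<le> L * sqrt \<bar>s - t\<bar>"
    using flow_continuous by blast
  then have L: "W2 (m s) (m t) \<le> L * sqrt \<bar>s - t\<bar>" if "s \<in> {0..T}" "t \<in> {0..T}" for s t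
    using that by blast
  let ?g = "\<lambda>p. l * (\<bar>fst (snd p) - fst (snd p0)\<bar> + \<bar>snd (snd p) - snd (snd p0)\<bar> + L * sqrt \<bar>max 0 (fst p) - max 0 (fst p0)\<bar>)"
  have ev: "\<forall>\<^sub>F p in at p0. fst p < fst p0 + 1"
    by (rule order_tendstoD(2)[OF tendsto_fst[OF tendsto_ident_at]]) simp
  have "\<forall>\<^sub>F p in at p0. norm (?f p - ?f p0) \<le> ?g p"
    using ev
  proof eventually_elim
    case (elim p)
    have "W2 (m (max 0 (fst p))) (m (max 0 (fst p0))) \<le> L * sqrt \<bar>max 0 (fst p) - max 0 (fst p0)\<bar>"
      using elim by (intro L) (auto simp: T_def max_def)
    then have "l * (\<bar>fst (snd p) - fst (snd p0)\<bar> + \<bar>snd (snd p) - snd (snd p0)\<bar> + W2 (m (max 0 (fst p))) (m (max 0 (fst p0)))) \<le> ?g p"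
      using l by (intro mult_left_mono add_left_mono) auto
    then show ?case
      using lip[OF flow_P2 flow_P2, of "max 0 (fst p)" "max 0 (fst p0)" "fst (snd p)" "snd (snd p)" "fst (snd p0)" "snd (snd p0)"] by simp
  qed
  moreover have "(?g \<longlongrightarrow> l * (\<bar>fst (snd p0) - fst (snd p0)\<bar> + \<bar>snd (snd p0) - snd (snd p0)\<bar> + L * sqrt \<bar>max 0 (fst p0) - max 0 (fst p0)\<bar>)) (at p0)"
    by (intro tendsto_intros)
  then have "(?g \<longlongrightarrow> 0) (at p0)" by simp
  ultimately have "((\<lambda>p. ?f p - ?f p0) \<longlongrightarrow> 0) (at p0)" by (rule Lim_null_comparison)
  then show "isCont ?f p0" unfolding isCont_def by (rule LIM_zero_cancel)
qed

lemma \<phi>_continuous: "continuous_on UNIV (\<lambda>p. \<phi> (fst p) (fst (snd p)) (snd (snd p)))"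
  unfolding \<phi>_def using lipschitz_y by (rule coefficient_continuous)

lemma \<psi>_continuous: "continuous_on UNIV (\<lambda>p. \<psi> (fst p) (fst (snd p)) (snd (snd p)))"
  unfolding \<psi>_def using lipschitz_x by (rule coefficient_continuous)

lemma coefficient_measurable:
  fixes g :: "real \<Rightarrow> real \<Rightarrow> real \<Rightarrow> real"
  assumes g: "continuous_on UNIV (\<lambda>p. g (fst p) (fst (snd p)) (snd (snd p)))"
    and "T \<in> borel_measurable N" "u \<in> borel_measurable N" "v \<in> borel_measurable N"
  shows "(\<lambda>z. g (T z) (u z) (v z)) \<in> borel_measurable N"
proof -
  have "(\<lambda>z. (T z, u z, v z)) \<in> borel_measurable N"
    using assms by (intro borel_measurable_Pair)
  from measurable_compose[OF this borel_measurable_continuous_onI[OF g]] show ?thesis by simp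
qed

text \<open>Lipschitz continuity gives linear growth around \<open>g t 0 0\<close>, which is
  continuous in \<open>t\<close> and hence locally square integrable.\<close>

lemma coefficient_loc_L2:
  fixes g :: "real \<Rightarrow> real \<Rightarrow> real \<Rightarrow> real"
  assumes g: "continuous_on UNIV (\<lambda>p. g (fst p) (fst (snd p)) (snd (snd p)))"
    and lip: "\<And>t x y x' y'. \<bar>g t x y - g t x' y'\<bar> \<le> l * (\<bar>x - x'\<bar> + \<bar>y - y'\<bar>)"
    and u: "loc_L2 M u" and v: "loc_L2 M v"
  shows "loc_L2 M (\<lambda>t \<omega>. g t (u t \<omega>) (v t \<omega>))"
proof (rule loc_L2_bound)
  show "(\<lambda>(t, \<omega>). g t (u t \<omega>) (v t \<omega>)) \<in> borel_measurable (borel \<Otimes>\<^sub>M M)"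
    using loc_L2_measurable(1)[OF u] loc_L2_measurable(1)[OF v] unfolding split_beta'
    by (intro coefficient_measurable[OF g]) auto
  have "continuous_on UNIV (\<lambda>t. g t 0 0)"
    using continuous_on_compose2[OF g, of UNIV "\<lambda>t. (t, 0, 0)"] by (simp add: continuous_intros)
  then show "loc_L2 M (\<lambda>t \<omega>. \<bar>g t 0 0\<bar> + l * (\<bar>u t \<omega>\<bar> + \<bar>v t \<omega>\<bar>))"
    using u v by (intro loc_L2_add loc_L2_cmult loc_L2_abs loc_L2_continuous)
  show "\<bar>g t (u t \<omega>) (v t \<omega>)\<bar> \<le> \<bar>\<bar>g t 0 0\<bar> + l * (\<bar>u t \<omega>\<bar> + \<bar>v t \<omega>\<bar>)\<bar>" for t \<omega>
    using lip[of t "u t \<omega>" "v t \<omega>" 0 0] by simp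
qed

definition "\<Phi> X Y t \<omega> = \<phi> t (ext X t \<omega>) (ext Y t \<omega>)"
definition "\<Psi> X Y t \<omega> = \<psi> t (ext X t \<omega>) (ext Y t \<omega>)"
text \<open>The backward component with its drift removed. Along a solution it equals
  \<open>Y 0\<close> plus the Ito integral, so it carries the martingale property without mentioning
  \<open>Z\<close>.\<close>

definition "D X Y t \<omega> = ext Y t \<omega> - (LBINT s:{0..t}. r * ext Y s \<omega> - \<Psi> X Y s \<omega>)"

lemma sol_loc_L2:
  assumes sol: "fbsde_solution M B \<F> r H m \<xi> X Y Z"
  shows "loc_L2 M (ext X)" "loc_L2 M (ext Y)" "loc_L2 M (\<Phi> X Y)" "loc_L2 M (\<Psi> X Y)"
    "loc_L2 M (\<lambda>t \<omega>. r * ext Y t \<omega> - \<Psi> X Y t \<omega>)" "loc_L2 M (D X Y)"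
proof -
  show X: "loc_L2 M (ext X)" and Y: "loc_L2 M (ext Y)"
    using sol r by (auto simp: fbsde_solution_def intro: Lr2_loc_L2)
  show "loc_L2 M (\<Phi> X Y)"
    unfolding \<Phi>_def[abs_def] by (rule coefficient_loc_L2[OF \<phi>_continuous \<phi>_lipschitz X Y])
  show \<Psi>: "loc_L2 M (\<Psi> X Y)"
    unfolding \<Psi>_def[abs_def] by (rule coefficient_loc_L2[OF \<psi>_continuous \<psi>_lipschitz X Y])
  show g: "loc_L2 M (\<lambda>t \<omega>. r * ext Y t \<omega> - \<Psi> X Y t \<omega>)" by (intro loc_L2_diff loc_L2_cmult Y \<Psi>)
  show "loc_L2 M (D X Y)"
    unfolding D_def[abs_def] by (intro loc_L2_diff Y loc_L2_time_integral(1) g)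
qed

lemma sol_forward:
  assumes sol: "fbsde_solution M B \<F> r H m \<xi> X Y Z"
  shows "AE \<omega> in M. \<forall>t\<ge>0. ext X t \<omega> = \<xi> \<omega> + (LBINT s:{0..t}. \<Phi> X Y s \<omega>) + B t \<omega>"
proof -
  have "AE \<omega> in M. \<forall>t\<ge>0. X t \<omega> = \<xi> \<omega> + (LBINT s:{0..t}. partial_y H (X s \<omega>) (m s) (Y s \<omega>)) + B t \<omega>"
    using sol by (auto simp: fbsde_solution_def elim!: eventually_mono)
  then show ?thesis
  proof eventually_elim
    case (elim \<omega>)
    have "(LBINT s:{0..t}. \<Phi> X Y s \<omega>) = (LBINT s:{0..t}. partial_y H (X s \<omega>) (m s) (Y s \<omega>))" for t
      by (intro set_lebesgue_integral_cong) (auto simp: \<Phi>_def \<phi>_def)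
    then show ?case using elim by simp
  qed
qed

lemma sol_backward:
  assumes sol: "fbsde_solution M B \<F> r H m \<xi> X Y Z"
  obtains I where "has_ito_integral M \<F> B Z I" "AE \<omega> in M. \<forall>t\<ge>0. D X Y t \<omega> = Y 0 \<omega> + I t \<omega>"
proof -
  obtain I where I: "has_ito_integral M \<F> B Z I" and
    eq: "AE \<omega> in M. \<forall>t\<ge>0.
          set_integrable lborel {0..t} (\<lambda>s. partial_y H (X s \<omega>) (m s) (Y s \<omega>)) \<and>
          set_integrable lborel {0..t} (\<lambda>s. partial_x H (X s \<omega>) (m s) (Y s \<omega>) - r * Y s \<omega>) \<and>
          X t \<omega> = \<xi> \<omega> + (LBINT s:{0..t}. partial_y H (X s \<omega>) (m s) (Y s \<omega>)) + B t \<omega> \<and>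
          Y t \<omega> = Y 0 \<omega> - (LBINT s:{0..t}. partial_x H (X s \<omega>) (m s) (Y s \<omega>) - r * Y s \<omega>) + I t \<omega>"
    using sol unfolding fbsde_solution_def by blast
  from eq have "AE \<omega> in M. \<forall>t\<ge>0. D X Y t \<omega> = Y 0 \<omega> + I t \<omega>"
  proof eventually_elim
    case (elim \<omega>)
    have "(LBINT s:{0..t}. r * ext Y s \<omega> - \<Psi> X Y s \<omega>) = (LBINT s:{0..t}. - (partial_x H (X s \<omega>) (m s) (Y s \<omega>) - r * Y s \<omega>))" for t
      by (intro set_lebesgue_integral_cong) (auto simp: \<Psi>_def \<psi>_def)
    also have "\<dots> t = - (LBINT s:{0..t}. partial_x H (X s \<omega>) (m s) (Y s \<omega>) - r * Y s \<omega>)" for t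
      unfolding set_lebesgue_integral_def scaleR_minus_right by (rule Bochner_Integration.integral_minus)
    finally have *: "(LBINT s:{0..t}. r * ext Y s \<omega> - \<Psi> X Y s \<omega>) = - (LBINT s:{0..t}. partial_x H (X s \<omega>) (m s) (Y s \<omega>) - r * Y s \<omega>)" for t .
    show ?case
    proof (intro allI impI)
      fix t :: real assume t: "0 \<le> t"
      then have "Y t \<omega> = Y 0 \<omega> - (LBINT s:{0..t}. partial_x H (X s \<omega>) (m s) (Y s \<omega>) - r * Y s \<omega>) + I t \<omega>"
        using elim by blast
      then show "D X Y t \<omega> = Y 0 \<omega> + I t \<omega>" using *[of t] t by (simp only: D_def ext_nonneg)
    qed
  qed
  with I show ?thesis by (rule that)
qed

lemma sol_adapted:
  assumes sol: "fbsde_solution M B \<F> r H m \<xi> X Y Z" and t: "0 \<le> t"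
  shows "X t \<in> borel_measurable (\<F> t)" "Y t \<in> borel_measurable (\<F> t)" "\<Phi> X Y t \<in> borel_measurable (\<F> t)"
proof -
  show X: "X t \<in> borel_measurable (\<F> t)" and Y: "Y t \<in> borel_measurable (\<F> t)"
    using sol t by (auto simp: fbsde_solution_def Lr2_def)
  show "\<Phi> X Y t \<in> borel_measurable (\<F> t)"
    unfolding \<Phi>_def[abs_def] using X Y t by (intro coefficient_measurable[OF \<phi>_continuous]) auto
qed

text \<open>Membership in \<open>Lr2\<close> makes \<open>Y t\<close> square integrable for almost
  every time, and a single such time \<open>t0\<close> is enough: the backward equation leads from
  \<open>t0\<close> to \<open>Y 0\<close>, and from \<open>Y 0\<close> to every other time.\<close>

lemma sol_square:
  assumes sol: "fbsde_solution M B \<F> r H m \<xi> X Y Z" and t: "0 \<le> t"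
  shows "integrable M (\<lambda>\<omega>. (Y t \<omega>)\<^sup>2)" "integrable M (\<lambda>\<omega>. (D X Y t \<omega>)\<^sup>2)"
proof -
  obtain I where I: "has_ito_integral M \<F> B Z I" and eq: "AE \<omega> in M. \<forall>t\<ge>0. D X Y t \<omega> = Y 0 \<omega> + I t \<omega>"
    using sol_backward[OF sol] .
  have Z: "(\<lambda>(t, \<omega>). Z t \<omega>) \<in> borel_measurable (time_axis \<Otimes>\<^sub>M M)" using sol by (auto simp: fbsde_solution_def Lr2_def)
  note I2 = ito_martingale(1,2)[OF Z I]
  note L2 = sol_loc_L2[OF sol]
  note J2 = loc_L2_time_integral[OF L2(5)]
  have mY: "Y t \<in> borel_measurable M" if "0 \<le> t" for t using loc_L2_measurable(2)[OF L2(2), of t] that by simp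
  have mJ: "(\<lambda>\<omega>. LBINT s:{0..t}. r * ext Y s \<omega> - \<Psi> X Y s \<omega>) \<in> borel_measurable M" for t
    by (rule loc_L2_measurable(2)[OF J2(1)])
  have mD: "D X Y t \<in> borel_measurable M" for t by (rule loc_L2_measurable(2)[OF L2(6)])
  \<comment> \<open>Otherwise \<open>[0,1]\<close> would have Lebesgue measure 0.\<close>
  obtain t0 where t0: "0 \<le> t0" "integrable M (\<lambda>\<omega>. (ext Y t0 \<omega>)\<^sup>2)"
  proof (rule ccontr)
    assume "\<not> thesis"
    then have "AE t in lborel. t \<notin> {0..1::real}"
      using loc_L2_AE_square[OF L2(2)] by (auto elim!: eventually_mono intro: that)
    then have "emeasure lborel {0..1::real} = 0" by (subst (asm) AE_iff_measurable[of "{0..1}"]) auto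
    then show False by simp
  qed
  have "integrable M (\<lambda>\<omega>. (D X Y t0 \<omega> - I t0 \<omega>)\<^sup>2)"
    unfolding D_def using t0 I2[OF t0(1)] J2(2)[OF t0(1)] mY[OF t0(1)] mJ
    by (intro integrable_diff_square borel_measurable_diff) auto
  moreover have "AE \<omega> in M. (D X Y t0 \<omega> - I t0 \<omega>)\<^sup>2 = (Y 0 \<omega>)\<^sup>2"
    using eq by eventually_elim (use t0 in simp)
  ultimately have Y0: "integrable M (\<lambda>\<omega>. (Y 0 \<omega>)\<^sup>2)"
    using mY[of 0] integrable_cong_AE_imp[of M "\<lambda>\<omega>. (D X Y t0 \<omega> - I t0 \<omega>)\<^sup>2" "\<lambda>\<omega>. (Y 0 \<omega>)\<^sup>2"] by simp
  have "integrable M (\<lambda>\<omega>. (Y 0 \<omega> + I t \<omega>)\<^sup>2)"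
    using Y0 mY[of 0] I2[OF t] by (intro integrable_add_square) auto
  moreover have "AE \<omega> in M. (Y 0 \<omega> + I t \<omega>)\<^sup>2 = (D X Y t \<omega>)\<^sup>2"
    using eq by eventually_elim (use t in simp)
  ultimately show D2: "integrable M (\<lambda>\<omega>. (D X Y t \<omega>)\<^sup>2)"
    using mD[of t] integrable_cong_AE_imp[of M "\<lambda>\<omega>. (Y 0 \<omega> + I t \<omega>)\<^sup>2" "\<lambda>\<omega>. (D X Y t \<omega>)\<^sup>2"] by simp
  have "integrable M (\<lambda>\<omega>. (D X Y t \<omega> + (LBINT s:{0..t}. r * ext Y s \<omega> - \<Psi> X Y s \<omega>))\<^sup>2)"
    using D2 mD mJ J2(2)[OF t] by (intro integrable_add_square)
  then show "integrable M (\<lambda>\<omega>. (Y t \<omega>)\<^sup>2)" using t by (simp add: D_def)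
qed

lemma sol_martingale:
  assumes sol: "fbsde_solution M B \<F> r H m \<xi> X Y Z" and st: "0 \<le> s" "s \<le> t"
    and G: "G \<in> borel_measurable (\<F> s)" "integrable M (\<lambda>\<omega>. (G \<omega>)\<^sup>2)"
  shows "expectation (\<lambda>\<omega>. G \<omega> * D X Y t \<omega>) = expectation (\<lambda>\<omega>. G \<omega> * D X Y s \<omega>)"
proof -
  obtain I where I: "has_ito_integral M \<F> B Z I" and eq: "AE \<omega> in M. \<forall>t\<ge>0. D X Y t \<omega> = Y 0 \<omega> + I t \<omega>"
    using sol_backward[OF sol] .
  have Z: "(\<lambda>(t, \<omega>). Z t \<omega>) \<in> borel_measurable (time_axis \<Otimes>\<^sub>M M)" using sol by (auto simp: fbsde_solution_def Lr2_def)
  have t: "0 \<le> t" using st by simp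
  have GM: "G \<in> borel_measurable M" using G(1) st by (intro filt_measurableD)
  have mD: "D X Y t \<in> borel_measurable M" for t by (rule loc_L2_measurable(2)[OF sol_loc_L2(6)[OF sol]])
  have i: "integrable M (\<lambda>\<omega>. G \<omega> * D X Y t \<omega>)" "integrable M (\<lambda>\<omega>. G \<omega> * D X Y s \<omega>)"
    using GM G(2) mD sol_square(2)[OF sol t] sol_square(2)[OF sol st(1)] by (auto intro!: integrable_mult_square)
  have "expectation (\<lambda>\<omega>. G \<omega> * D X Y t \<omega>) - expectation (\<lambda>\<omega>. G \<omega> * D X Y s \<omega>) = expectation (\<lambda>\<omega>. G \<omega> * D X Y t \<omega> - G \<omega> * D X Y s \<omega>)"
    using i by simp
  also have "\<dots> = expectation (\<lambda>\<omega>. G \<omega> * (I t \<omega> - I s \<omega>))"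
  proof (rule integral_cong_AE)
    show "AE \<omega> in M. G \<omega> * D X Y t \<omega> - G \<omega> * D X Y s \<omega> = G \<omega> * (I t \<omega> - I s \<omega>)"
      using eq by eventually_elim (use st in \<open>simp add: algebra_simps\<close>)
  qed (use GM mD ito_martingale(1)[OF Z I] st in auto)
  also have "\<dots> = 0" by (rule ito_martingale(3)[OF Z I st G])
  finally show ?thesis by simp
qed

lemma weighted_diff_indicator:
  assumes u: "u \<in> Lr2 M \<F> r" and v: "v \<in> Lr2 M \<F> r" and A: "A \<in> events"
  shows "(\<lambda>(t, \<omega>). indicator A \<omega> * (ext u t \<omega> - ext v t \<omega>)) \<in> borel_measurable (borel \<Otimes>\<^sub>M M)"
    "integrable (lborel \<Otimes>\<^sub>M M) (\<lambda>(t, \<omega>). indicator {0..} t * (exp (- r * t) * (indicator A \<omega> * (ext u t \<omega> - ext v t \<omega>))\<^sup>2))"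
proof -
  have m: "(\<lambda>z. ext u (fst z) (snd z)) \<in> borel_measurable (borel \<Otimes>\<^sub>M M)" "(\<lambda>z. ext v (fst z) (snd z)) \<in> borel_measurable (borel \<Otimes>\<^sub>M M)"
    using Lr2_ext(1)[OF u] Lr2_ext(1)[OF v] by (simp_all add: split_beta')
  have mA: "(\<lambda>z :: real \<times> 'a. indicator A (snd z) :: real) \<in> borel_measurable (borel \<Otimes>\<^sub>M M)" using A by measurable
  show mm: "(\<lambda>(t, \<omega>). indicator A \<omega> * (ext u t \<omega> - ext v t \<omega>)) \<in> borel_measurable (borel \<Otimes>\<^sub>M M)"
    using m mA by (simp add: split_beta')
  show "integrable (lborel \<Otimes>\<^sub>M M) (\<lambda>(t, \<omega>). indicator {0..} t * (exp (- r * t) * (indicator A \<omega> * (ext u t \<omega> - ext v t \<omega>))\<^sup>2))"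
  proof (rule Bochner_Integration.integrable_bound)
    show "integrable (lborel \<Otimes>\<^sub>M M) (\<lambda>z. 2 * (case z of (t, \<omega>) \<Rightarrow> indicator {0..} t * (exp (- r * t) * (ext u t \<omega>)\<^sup>2))
       + 2 * (case z of (t, \<omega>) \<Rightarrow> indicator {0..} t * (exp (- r * t) * (ext v t \<omega>)\<^sup>2)))"
      using Lr2_ext(2)[OF u] Lr2_ext(2)[OF v] by (intro Bochner_Integration.integrable_add integrable_mult_right)
    have "(\<lambda>z. indicator A (snd z) * (ext u (fst z) (snd z) - ext v (fst z) (snd z))) \<in> borel_measurable (lborel \<Otimes>\<^sub>M M)"
      using mm unfolding measurable_lborel_pair by (simp add: split_beta')
    then show "(\<lambda>(t, \<omega>). indicator {0..} t * (exp (- r * t) * (indicator A \<omega> * (ext u t \<omega> - ext v t \<omega>))\<^sup>2)) \<in> borel_measurable (lborel \<Otimes>\<^sub>M M)"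
      by (simp add: split_beta')
    have sq: "(p - q)\<^sup>2 \<le> 2 * p\<^sup>2 + 2 * q\<^sup>2" for p q :: real
      using square_diff_le[of p q 0] by simp
    have "exp (- r * t) * (p - q)\<^sup>2 \<le> 2 * (exp (- r * t) * p\<^sup>2) + 2 * (exp (- r * t) * q\<^sup>2)" for t p q :: real
      using mult_left_mono[OF sq[of p q], of "exp (- r * t)"] by (simp add: algebra_simps)
    then show "AE z in lborel \<Otimes>\<^sub>M M. norm (case z of (t, \<omega>) \<Rightarrow> indicator {0..} t * (exp (- r * t) * (indicator A \<omega> * (ext u t \<omega> - ext v t \<omega>))\<^sup>2))
       \<le> norm (2 * (case z of (t, \<omega>) \<Rightarrow> indicator {0..} t * (exp (- r * t) * (ext u t \<omega>)\<^sup>2))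
       + 2 * (case z of (t, \<omega>) \<Rightarrow> indicator {0..} t * (exp (- r * t) * (ext v t \<omega>)\<^sup>2)))"
      by (intro AE_I2) (auto simp: indicator_def)
  qed
qed

text \<open>In the forward difference the common Brownian path cancels, so no martingale part is
  left. The indicator of the initial event does not depend on time: it commutes with time integrals,
  is adapted at every time, and can be shifted onto the test variable in the martingale
  identity.\<close>

lemma linear_difference_solutions:
  assumes sol: "fbsde_solution M B \<F> r H m \<xi> X Y Z" and sol': "fbsde_solution M B \<F> r H m \<xi>' X' Y' Z'"
    and A: "A \<in> sets (\<F> 0)" and \<xi>: "\<xi> \<in> L2 M (\<F> 0)" "\<xi>' \<in> L2 M (\<F> 0)"
  shows "linear_difference M \<F> (\<lambda>t \<omega>. indicator A \<omega> * (ext X t \<omega> - ext X' t \<omega>)) (\<lambda>t \<omega>. indicator A \<omega> * (ext Y t \<omega> - ext Y' t \<omega>))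
     (\<lambda>t \<omega>. indicator A \<omega> * (\<Phi> X Y t \<omega> - \<Phi> X' Y' t \<omega>)) (\<lambda>t \<omega>. indicator A \<omega> * (\<Psi> X Y t \<omega> - \<Psi> X' Y' t \<omega>))
     (\<lambda>\<omega>. indicator A \<omega> * (\<xi> \<omega> - \<xi>' \<omega>)) r l \<kappa>"
    (is "linear_difference M \<F> ?x ?y ?a ?c ?\<zeta> r l \<kappa>")
proof -
  have AM: "A \<in> events" using A subalgebra_filt[of 0] by (auto simp: subalgebra_def)
  have mA: "indicator A \<in> borel_measurable (\<F> t)" if "0 \<le> t" for t
  proof -
    have "A \<in> sets (\<F> t)" using A subalgebra_filt_mono[of 0 t] that by (auto simp: subalgebra_def)
    then show ?thesis by simp
  qed
  have Lr2: "X \<in> Lr2 M \<F> r" "X' \<in> Lr2 M \<F> r" "Y \<in> Lr2 M \<F> r" "Y' \<in> Lr2 M \<F> r"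
    using sol sol' by (auto simp: fbsde_solution_def)
  have mm: "(\<lambda>(t, \<omega>). indicator A \<omega> * (u t \<omega> - v t \<omega>)) \<in> borel_measurable (borel \<Otimes>\<^sub>M M)" if "loc_L2 M u" "loc_L2 M v" for u v
  proof -
    have "(\<lambda>z. u (fst z) (snd z)) \<in> borel_measurable (borel \<Otimes>\<^sub>M M)" "(\<lambda>z. v (fst z) (snd z)) \<in> borel_measurable (borel \<Otimes>\<^sub>M M)"
      "(\<lambda>z :: real \<times> 'a. indicator A (snd z) :: real) \<in> borel_measurable (borel \<Otimes>\<^sub>M M)"
      using loc_L2_measurable(1)[OF that(1)] loc_L2_measurable(1)[OF that(2)] AM by (auto simp: split_beta')
    then show ?thesis by (simp add: split_beta')
  qed
  have ind2: "integrable M (\<lambda>\<omega>. (indicator A \<omega> * f \<omega>)\<^sup>2)" if "integrable M (\<lambda>\<omega>. (f \<omega>)\<^sup>2)" for f :: "'a \<Rightarrow> real"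
  proof -
    have "(\<lambda>\<omega>. (indicator A \<omega> * f \<omega>)\<^sup>2) = (\<lambda>\<omega>. (f \<omega>)\<^sup>2 * indicator A \<omega>)" by (auto simp: fun_eq_iff indicator_def)
    then show ?thesis using integrable_real_mult_indicator[OF AM that] by simp
  qed
  note L2 = sol_loc_L2[OF sol] and L2' = sol_loc_L2[OF sol']
  have mM\<xi>: "\<xi> \<in> borel_measurable M" "\<xi>' \<in> borel_measurable M"
    using \<xi> by (auto simp: L2_def intro: filt_measurableD[of 0])
  define E where "E t \<omega> = ?y t \<omega> - (LBINT u:{0..t}. r * ?y u \<omega> - ?c u \<omega>)" for t \<omega>
  have E: "AE \<omega> in M. E t \<omega> = indicator A \<omega> * (D X Y t \<omega> - D X' Y' t \<omega>)" if "0 \<le> t" for t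
    using fubini_time(1)[OF loc_L2_integrable[OF L2(5) that]] fubini_time(1)[OF loc_L2_integrable[OF L2'(5) that]]
  proof eventually_elim
    case (elim \<omega>)
    have "(LBINT u:{0..t}. r * ?y u \<omega> - ?c u \<omega>) = (LBINT u:{0..t}. indicator A \<omega> * ((r * ext Y u \<omega> - \<Psi> X Y u \<omega>) - (r * ext Y' u \<omega> - \<Psi> X' Y' u \<omega>)))"
      by (intro set_lebesgue_integral_cong) (auto simp: algebra_simps)
    also have "\<dots> = indicator A \<omega> * (LBINT u:{0..t}. (r * ext Y u \<omega> - \<Psi> X Y u \<omega>) - (r * ext Y' u \<omega> - \<Psi> X' Y' u \<omega>))"
      by (rule set_integral_mult_right)
    also have "\<dots> = indicator A \<omega> * ((LBINT u:{0..t}. r * ext Y u \<omega> - \<Psi> X Y u \<omega>) - (LBINT u:{0..t}. r * ext Y' u \<omega> - \<Psi> X' Y' u \<omega>))"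
      using set_integral_diff(2)[OF elim] by simp
    finally show ?case by (simp add: E_def D_def algebra_simps)
  qed
  show ?thesis
  proof
    show "0 < r" "0 \<le> l" "0 < \<kappa>" using r l \<kappa> by auto
    show "(\<lambda>(t, \<omega>). ?x t \<omega>) \<in> borel_measurable (borel \<Otimes>\<^sub>M M)" "(\<lambda>(t, \<omega>). ?y t \<omega>) \<in> borel_measurable (borel \<Otimes>\<^sub>M M)"
      "(\<lambda>(t, \<omega>). ?a t \<omega>) \<in> borel_measurable (borel \<Otimes>\<^sub>M M)" "(\<lambda>(t, \<omega>). ?c t \<omega>) \<in> borel_measurable (borel \<Otimes>\<^sub>M M)"
      by (intro mm L2 L2')+
    show "integrable (lborel \<Otimes>\<^sub>M M) (\<lambda>(t, \<omega>). indicator {0..} t * (exp (- r * t) * (?x t \<omega>)\<^sup>2))"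
      "integrable (lborel \<Otimes>\<^sub>M M) (\<lambda>(t, \<omega>). indicator {0..} t * (exp (- r * t) * (?y t \<omega>)\<^sup>2))"
      by (intro weighted_diff_indicator Lr2 AM)+
    show "subalgebra M (\<F> 0)" by (rule subalgebra_filt) simp
    show "?a t \<in> borel_measurable (\<F> t)" if "0 \<le> t" for t
      using sol_adapted(3)[OF sol that] sol_adapted(3)[OF sol' that] mA[OF that]
      by (intro borel_measurable_times borel_measurable_diff)
    show "?y 0 \<in> borel_measurable (\<F> 0)"
      using sol_adapted(2)[OF sol, of 0] sol_adapted(2)[OF sol', of 0] mA[of 0]
      by (intro borel_measurable_times borel_measurable_diff) auto
    show "?\<zeta> \<in> borel_measurable (\<F> 0)"
      using \<xi> mA[of 0] by (intro borel_measurable_times borel_measurable_diff) (auto simp: L2_def)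
    show "integrable M (\<lambda>\<omega>. (?\<zeta> \<omega>)\<^sup>2)"
      using \<xi> mM\<xi> by (intro ind2 integrable_diff_square) (auto simp: L2_def)
    show "integrable M (\<lambda>\<omega>. (?y t \<omega>)\<^sup>2)" if "0 \<le> t" for t
      using sol_square(1)[OF sol that] sol_square(1)[OF sol' that] that
        loc_L2_measurable(2)[OF L2(2), of t] loc_L2_measurable(2)[OF L2'(2), of t]
      by (intro ind2 integrable_diff_square) auto
    show "AE \<omega> in M. \<forall>t\<ge>0. ?x t \<omega> = ?\<zeta> \<omega> + (LBINT s:{0..t}. ?a s \<omega>)"
    proof -
      \<comment> \<open>Integrability on the countably many intervals \<open>[0, n]\<close> provides
        one null set valid for all \<open>t\<close> at once.\<close>
      have "AE \<omega> in M. \<forall>n. set_integrable lborel {0..real n} (\<lambda>s. \<Phi> X Y s \<omega>) \<and> set_integrable lborel {0..real n} (\<lambda>s. \<Phi> X' Y' s \<omega>)"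
        unfolding AE_all_countable AE_conj_iff
        using fubini_time(1)[OF loc_L2_integrable[OF L2(3)]] fubini_time(1)[OF loc_L2_integrable[OF L2'(3)]] by simp
      then show ?thesis using sol_forward[OF sol] sol_forward[OF sol']
      proof eventually_elim
        case (elim \<omega>)
        show ?case
        proof (intro allI impI)
          fix t :: real assume t: "0 \<le> t"
          obtain n where n: "t \<le> real n" using real_arch_simple by blast
          have "set_integrable lborel {0..t} (\<lambda>s. \<Phi> X Y s \<omega>)" "set_integrable lborel {0..t} (\<lambda>s. \<Phi> X' Y' s \<omega>)"
            using elim(1) n by (auto intro: set_integrable_subset[of _ "{0..real n}"])
          then have "(LBINT s:{0..t}. \<Phi> X Y s \<omega> - \<Phi> X' Y' s \<omega>) = (LBINT s:{0..t}. \<Phi> X Y s \<omega>) - (LBINT s:{0..t}. \<Phi> X' Y' s \<omega>)"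
            by (rule set_integral_diff)
          moreover have "(LBINT s:{0..t}. ?a s \<omega>) = indicator A \<omega> * (LBINT s:{0..t}. \<Phi> X Y s \<omega> - \<Phi> X' Y' s \<omega>)"
            by (rule set_integral_mult_right)
          moreover have "ext X t \<omega> = \<xi> \<omega> + (LBINT s:{0..t}. \<Phi> X Y s \<omega>) + B t \<omega>" "ext X' t \<omega> = \<xi>' \<omega> + (LBINT s:{0..t}. \<Phi> X' Y' s \<omega>) + B t \<omega>"
            using elim t by blast+
          ultimately show "?x t \<omega> = ?\<zeta> \<omega> + (LBINT s:{0..t}. ?a s \<omega>)"
            by (simp only: distrib_left[symmetric]) simp
        qed
      qed
    qed
    show "expectation (\<lambda>\<omega>. G \<omega> * (?y t \<omega> - (LBINT u:{0..t}. r * ?y u \<omega> - ?c u \<omega>))) =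
       expectation (\<lambda>\<omega>. G \<omega> * (?y s \<omega> - (LBINT u:{0..s}. r * ?y u \<omega> - ?c u \<omega>)))"
      if st: "0 \<le> s" "s \<le> t" and G: "G \<in> borel_measurable (\<F> s)" "integrable M (\<lambda>\<omega>. (G \<omega>)\<^sup>2)" for s t G
    proof -
      \<comment> \<open>The localized test variable is still known at time \<open>s\<close>, so the
        martingale identities of the two solutions apply to it separately.\<close>
      define G' where "G' \<omega> = indicator A \<omega> * G \<omega>" for \<omega>
      have G': "G' \<in> borel_measurable (\<F> s)" "integrable M (\<lambda>\<omega>. (G' \<omega>)\<^sup>2)"
        unfolding G'_def using G(1) mA[OF st(1)] ind2[OF G(2)] by (auto intro: borel_measurable_times)
      have GM: "G \<in> borel_measurable M" "G' \<in> borel_measurable M" using G(1) G'(1) st by (auto intro: filt_measurableD)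
      have yL: "loc_L2 M ?y" "loc_L2 M ?c"
        by (rule loc_L2_bound[OF mm[OF L2(2) L2'(2)] loc_L2_diff[OF L2(2) L2'(2)]], simp add: indicator_def)
          (rule loc_L2_bound[OF mm[OF L2(4) L2'(4)] loc_L2_diff[OF L2(4) L2'(4)]], simp add: indicator_def)
      have "loc_L2 M E" unfolding E_def[abs_def]
        by (intro loc_L2_diff loc_L2_cmult yL loc_L2_time_integral(1))
      then have mE: "E v \<in> borel_measurable M" for v by (rule loc_L2_measurable(2))
      have mD: "D X Y v \<in> borel_measurable M" "D X' Y' v \<in> borel_measurable M" for v
        using loc_L2_measurable(2) L2(6) L2'(6) by auto
      have *: "expectation (\<lambda>\<omega>. G \<omega> * E v \<omega>) = expectation (\<lambda>\<omega>. G' \<omega> * D X Y v \<omega>) - expectation (\<lambda>\<omega>. G' \<omega> * D X' Y' v \<omega>)" if v: "0 \<le> v" for v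
      proof -
        have "expectation (\<lambda>\<omega>. G \<omega> * E v \<omega>) = expectation (\<lambda>\<omega>. G' \<omega> * D X Y v \<omega> - G' \<omega> * D X' Y' v \<omega>)"
        proof (rule integral_cong_AE)
          show "AE \<omega> in M. G \<omega> * E v \<omega> = G' \<omega> * D X Y v \<omega> - G' \<omega> * D X' Y' v \<omega>"
            using E[OF v] by eventually_elim (simp add: G'_def right_diff_distrib mult_ac)
        qed (use GM mE mD in auto)
        also have "\<dots> = expectation (\<lambda>\<omega>. G' \<omega> * D X Y v \<omega>) - expectation (\<lambda>\<omega>. G' \<omega> * D X' Y' v \<omega>)"
          using GM mD G'(2) sol_square(2)[OF sol v] sol_square(2)[OF sol' v]
          by (intro Bochner_Integration.integral_diff integrable_mult_square)
        finally show ?thesis .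
      qed
      show ?thesis
        unfolding E_def[symmetric] using st * sol_martingale[OF sol st G'] sol_martingale[OF sol' st G'] by simp
    qed
    show "\<bar>?a t \<omega>\<bar> \<le> l * (\<bar>?x t \<omega>\<bar> + \<bar>?y t \<omega>\<bar>)" "\<bar>?c t \<omega>\<bar> \<le> l * (\<bar>?x t \<omega>\<bar> + \<bar>?y t \<omega>\<bar>)" for t \<omega>
      by (cases "\<omega> \<in> A"; simp add: \<Phi>_def \<Psi>_def \<phi>_lipschitz \<psi>_lipschitz)+
    show "?a t \<omega> * ?y t \<omega> - ?x t \<omega> * ?c t \<omega> \<le> - \<kappa> * ((?x t \<omega>)\<^sup>2 + (?y t \<omega>)\<^sup>2)" for t \<omega>
      using \<phi>_\<psi>_monotone by (cases "\<omega> \<in> A") (simp_all add: \<Phi>_def \<Psi>_def)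
  qed
qed

text \<open>With values in \<open>ennreal\<close> the distance is meaningful for the substituted
  process too, whose norm is not known to be finite.\<close>

definition gap :: "(real \<Rightarrow> 'a \<Rightarrow> real) \<Rightarrow> (real \<Rightarrow> 'a \<Rightarrow> real) \<Rightarrow> (real \<Rightarrow> 'a \<Rightarrow> real) \<Rightarrow> (real \<Rightarrow> 'a \<Rightarrow> real) \<Rightarrow> 'a \<Rightarrow> ennreal" where
  "gap X Y X' Y' \<omega> = (\<integral>\<^sup>+t. ennreal (exp (- r * t) * ((X t \<omega> - X' t \<omega>)\<^sup>2 + (Y t \<omega> - Y' t \<omega>)\<^sup>2)) \<partial>time_axis)"

text \<open>The constants of \<open>linear_difference\<close>, written out in \<open>r\<close>,
  \<open>l\<close> and \<open>\<kappa>\<close>: they are the same for all pairs of solutions, all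
  events and all \<open>\<delta>\<close>.\<close>

definition "C_energy = 2 * (1 + l + r)\<^sup>2 * exp r / \<kappa>\<^sup>2"
definition "C_initial = (1 + l + r) * (1 + exp r * C_energy / 2)"

text \<open>Applied in two ways: on a slab, to the given solution and one with constant initial
  value; and on the whole space, to two solutions with constant initial values.\<close>

lemma local_stability:
  assumes sol: "fbsde_solution M B \<F> r H m \<xi> X Y Z" and sol': "fbsde_solution M B \<F> r H m \<xi>' X' Y' Z'"
    and A: "A \<in> sets (\<F> 0)" and \<xi>: "\<xi> \<in> L2 M (\<F> 0)" "\<xi>' \<in> L2 M (\<F> 0)"
    and \<delta>: "0 < \<delta>" "\<And>\<omega>. \<omega> \<in> A \<Longrightarrow> \<bar>\<xi> \<omega> - \<xi>' \<omega>\<bar> \<le> \<delta>"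
  shows "(\<integral>\<^sup>+\<omega>\<in>A. gap X Y X' Y' \<omega> \<partial>M) \<le> ennreal (C_energy * \<delta>\<^sup>2) * emeasure M A"
    "(\<integral>\<^sup>+\<omega>\<in>A. ennreal \<bar>Y 0 \<omega> - Y' 0 \<omega>\<bar> \<partial>M) \<le> ennreal (C_initial * \<delta>) * emeasure M A"
proof -
  let ?x = "\<lambda>t \<omega>. indicator A \<omega> * (ext X t \<omega> - ext X' t \<omega>)" and ?y = "\<lambda>t \<omega>. indicator A \<omega> * (ext Y t \<omega> - ext Y' t \<omega>)"
  interpret L: linear_difference M \<F> ?x ?y
     "\<lambda>t \<omega>. indicator A \<omega> * (\<Phi> X Y t \<omega> - \<Phi> X' Y' t \<omega>)" "\<lambda>t \<omega>. indicator A \<omega> * (\<Psi> X Y t \<omega> - \<Psi> X' Y' t \<omega>)"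
     "\<lambda>\<omega>. indicator A \<omega> * (\<xi> \<omega> - \<xi>' \<omega>)" r l \<kappa>
    by (rule linear_difference_solutions[OF sol sol' A \<xi>])
  have AM: "A \<in> events" using A subalgebra_filt[of 0] by (auto simp: subalgebra_def)
  have C: "0 \<le> C_energy" "0 \<le> C_initial" using r l by (auto simp: C_energy_def C_initial_def)
  have const_eqs: "L.C_stab = C_energy" "L.K * (1 + exp r * C_energy / 2) = C_initial"
    by (simp_all add: L.C_stab_def L.K_def C_energy_def C_initial_def)
  have \<zeta>: "\<bar>indicator A \<omega> * (\<xi> \<omega> - \<xi>' \<omega>)\<bar> \<le> \<delta> * indicator A \<omega>" if "\<omega> \<in> space M" for \<omega>
    using \<delta> by (auto simp: indicator_def)
  have off: "?x t \<omega> = 0 \<and> ?y t \<omega> = 0" if "0 \<le> t" "\<omega> \<in> space M - A" for t \<omega> using that by simp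
  have est: "expectation (\<lambda>\<omega>. \<bar>?y 0 \<omega>\<bar>) \<le> C_initial * \<delta> * prob A" "L.energy \<le> C_energy * \<delta>\<^sup>2 * prob A"
    by (rule L.initial_value_L1[OF AM \<delta>(1) off \<zeta>, unfolded const_eqs]; assumption)+
  have iw: "integrable (lborel \<Otimes>\<^sub>M M) (\<lambda>(t, \<omega>). indicator {0..} t * (exp (- r * t) * ((?x t \<omega>)\<^sup>2 + (?y t \<omega>)\<^sup>2)))"
    using Bochner_Integration.integrable_add[OF L.x_weighted L.y_weighted]
    by (simp add: split_beta' distrib_left)
  have mw: "(\<lambda>z. ennreal (case z of (t, \<omega>) \<Rightarrow> indicator {0..} t * (exp (- r * t) * ((?x t \<omega>)\<^sup>2 + (?y t \<omega>)\<^sup>2)))) \<in> borel_measurable (lborel \<Otimes>\<^sub>M M)"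
    using iw by (intro measurable_compose[OF _ measurable_ennreal]) auto
  have "(\<integral>\<^sup>+\<omega>\<in>A. gap X Y X' Y' \<omega> \<partial>M) = (\<integral>\<^sup>+\<omega>. (\<integral>\<^sup>+t. ennreal (case (t, \<omega>) of (t, \<omega>) \<Rightarrow> indicator {0..} t * (exp (- r * t) * ((?x t \<omega>)\<^sup>2 + (?y t \<omega>)\<^sup>2))) \<partial>lborel) \<partial>M)"
    unfolding gap_def
    by (simp add: nn_integral_restrict_space) (auto intro!: nn_integral_cong simp: indicator_def)
  also have "\<dots> = (\<integral>\<^sup>+z. ennreal (case z of (t, \<omega>) \<Rightarrow> indicator {0..} t * (exp (- r * t) * ((?x t \<omega>)\<^sup>2 + (?y t \<omega>)\<^sup>2))) \<partial>(lborel \<Otimes>\<^sub>M M))"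
    by (rule P.nn_integral_snd[OF mw])
  also have "\<dots> = ennreal L.energy"
    unfolding L.energy_def L.w_def using fubini_time(6)[OF iw]
    by (subst nn_integral_eq_integral[OF iw]) (auto intro!: AE_I2)
  also have "\<dots> \<le> ennreal (C_energy * \<delta>\<^sup>2 * prob A)" using est(2) by (rule ennreal_leI)
  finally show "(\<integral>\<^sup>+\<omega>\<in>A. gap X Y X' Y' \<omega> \<partial>M) \<le> ennreal (C_energy * \<delta>\<^sup>2) * emeasure M A"
    using C by (simp add: ennreal_mult emeasure_eq_measure)
  have i0: "integrable M (\<lambda>\<omega>. \<bar>?y 0 \<omega>\<bar>)"
    using square_integrable_imp_integrable[OF loc_L2_measurable(2)[OF L.y_L2] L.y_square[of 0]] by simp
  have "(\<integral>\<^sup>+\<omega>\<in>A. ennreal \<bar>Y 0 \<omega> - Y' 0 \<omega>\<bar> \<partial>M) = (\<integral>\<^sup>+\<omega>. ennreal \<bar>?y 0 \<omega>\<bar> \<partial>M)"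
    by (intro nn_integral_cong) (auto simp: indicator_def)
  also have "\<dots> = ennreal (expectation (\<lambda>\<omega>. \<bar>?y 0 \<omega>\<bar>))" by (intro nn_integral_eq_integral i0) auto
  also have "\<dots> \<le> ennreal (C_initial * \<delta> * prob A)" using est(1) by (rule ennreal_leI)
  finally show "(\<integral>\<^sup>+\<omega>\<in>A. ennreal \<bar>Y 0 \<omega> - Y' 0 \<omega>\<bar> \<partial>M) \<le> ennreal (C_initial * \<delta>) * emeasure M A"
    using C \<delta> by (simp add: ennreal_mult emeasure_eq_measure)
qed

end

section \<open>Regularity of the flow of laws and substitution of the initial value\<close>

lemma set_integral_increment_le:
  fixes f k :: "real \<Rightarrow> real"
  assumes f: "set_integrable lborel {0..t} f" and k: "set_integrable lborel {0..t} k"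
    and le: "AE u in lborel. 0 \<le> u \<longrightarrow> \<bar>f u\<bar> \<le> k u" and st: "0 \<le> s" "s \<le> t"
  shows "\<bar>(LBINT u:{0..t}. f u) - (LBINT u:{0..s}. f u)\<bar> \<le> (LBINT u:{s..t}. k u)"
proof -
  have i: "set_integrable lborel {0..s} f" "set_integrable lborel {s<..t} f" "set_integrable lborel {s..t} k"
    using f k st by (auto intro: set_integrable_subset[of _ "{0..t}"])
  have "(LBINT u:{0..t}. f u) = (LBINT u:{0..s}. f u) + (LBINT u:{s<..t}. f u)"
  proof -
    have "{0..t} = {0..s} \<union> {s<..t}" "{0..s} \<inter> {s<..t} = {}" using st by auto
    then show ?thesis using set_integral_Un[OF _ i(1,2)] by metis
  qed
  then have "\<bar>(LBINT u:{0..t}. f u) - (LBINT u:{0..s}. f u)\<bar> = \<bar>LBINT u:{s<..t}. f u\<bar>" by simp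
  also have "\<dots> \<le> (\<integral>u. \<bar>indicator {s<..t} u * f u\<bar> \<partial>lborel)"
    unfolding set_lebesgue_integral_def using integral_abs_bound[of lborel "\<lambda>u. indicator {s<..t} u * f u"] by simp
  also have "\<dots> \<le> (LBINT u:{s..t}. k u)"
    unfolding set_lebesgue_integral_def
  proof (rule integral_mono_AE)
    show "integrable lborel (\<lambda>u. \<bar>indicator {s<..t} u * f u\<bar>)" using i(2) by (simp add: set_integrable_def)
    show "integrable lborel (\<lambda>u. indicator {s..t} u *\<^sub>R k u)" using i(3) by (simp add: set_integrable_def)
    show "AE u in lborel. \<bar>indicator {s<..t} u * f u\<bar> \<le> indicator {s..t} u *\<^sub>R k u"
      using le
    proof eventually_elim
      case (elim u)
      show ?case
      proof (cases "u \<in> {s..t}")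
        case True
        then have "\<bar>f u\<bar> \<le> k u" using elim st by simp
        then show ?thesis using True by (auto simp: indicator_def)
      qed (auto simp: indicator_def)
    qed
  qed
  finally show ?thesis .
qed

section \<open>Second moments and time regularity of the law of \<open>X\<close>\<close>

context brownian_setup
begin

interpretation P: pair_sigma_finite lborel M ..

lemma distr_in_P2:
  assumes "v \<in> borel_measurable M" "integrable M (\<lambda>\<omega>. (v \<omega>)\<^sup>2)"
  shows "distr M borel v \<in> P2"
  using assms by (simp add: P2_def prob_space_distr integrable_distr_eq)

text \<open>A bootstrap supplying the flow assumptions of \<open>mckean_flow\<close>. At almost
  every time the law of \<open>X\<close> lies in \<open>P2\<close>, so the drift bound applies
  there, and the drift matters only under the time integral. Its mean square over
  \<open>[s, t]\<close> is then of order \<open>t - s\<close>, like the variance of the Brownian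
  increment. Starting from \<open>X 0\<close>, this gives second moments at every time and Hoelder
  continuity of exponent 1/2.\<close>

lemma solution_law_flow:
  assumes r: "0 < r" and l: "0 < l"
    and lip: "\<And>x x' \<mu> \<mu>' y y'. \<mu> \<in> P2 \<Longrightarrow> \<mu>' \<in> P2 \<Longrightarrow>
          \<bar>partial_y H x \<mu> y - partial_y H x' \<mu>' y'\<bar> \<le> l * (\<bar>x - x'\<bar> + \<bar>y - y'\<bar> + W2 \<mu> \<mu>')"
    and \<xi>: "\<xi> \<in> L2 M (\<F> 0)"
    and sol: "fbsde_solution M B \<F> r H (law_flow M X) \<xi> X Y Z"
  shows "0 \<le> t \<Longrightarrow> law_flow M X t \<in> P2"
    "0 \<le> T \<Longrightarrow> \<exists>L. \<forall>s\<in>{0..T}. \<forall>t\<in>{0..T}. W2 (law_flow M X s) (law_flow M X t) \<le> L * sqrt \<bar>s - t\<bar>"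
proof -
  have X: "loc_L2 M (ext X)" and Y: "loc_L2 M (ext Y)"
    using sol r by (auto simp: fbsde_solution_def intro: Lr2_loc_L2)
  have mX: "X t \<in> borel_measurable M" if "0 \<le> t" for t
    using loc_L2_measurable(2)[OF X, of t] that by simp
  \<comment> \<open>At times with infinite second moment \<open>h\<close> has the default value 0;
    among nonnegative times these form a null set, and the bound on the drift is claimed only
    outside it.\<close>
  define h where "h s = sqrt (expectation (\<lambda>\<omega>. (ext X s \<omega>)\<^sup>2))" for s
  have h2: "(h s)\<^sup>2 = expectation (\<lambda>\<omega>. (ext X s \<omega>)\<^sup>2)" for s
    unfolding h_def by (intro real_sqrt_pow2 Bochner_Integration.integral_nonneg) auto
  have hL: "loc_L2 M (\<lambda>s \<omega>. h s)"
  proof (rule loc_L2_deterministic)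
    have "(\<lambda>s. expectation (\<lambda>\<omega>. (ext X s \<omega>)\<^sup>2)) \<in> borel_measurable borel"
      using loc_L2_measurable(1)[OF X] by (intro borel_measurable_lebesgue_integral) (simp add: split_beta')
    then show "h \<in> borel_measurable borel" unfolding h_def[abs_def] by measurable
    show "set_integrable lborel {0..T} (\<lambda>t. (h t)\<^sup>2)" if "0 \<le> T" for T
      unfolding h2 using X that by (intro fubini_time(4)) (auto simp: loc_L2_def)
  qed
  \<comment> \<open>The point mass at 0 as reference law: the distance of
    \<open>law_flow M X s\<close> to it is at most \<open>h s\<close>, which turns the Lipschitz
    condition into linear growth.\<close>
  define \<mu>0 where "\<mu>0 = distr M borel (\<lambda>_. 0 :: real)"
  have \<mu>0: "\<mu>0 \<in> P2" unfolding \<mu>0_def by (intro distr_in_P2) auto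
  define c0 where "c0 = \<bar>partial_y H 0 \<mu>0 0\<bar>"
  define k where "k s \<omega> = c0 + l * (\<bar>ext X s \<omega>\<bar> + \<bar>ext Y s \<omega>\<bar> + h s)" for s \<omega>
  have kL: "loc_L2 M k"
    unfolding k_def[abs_def]
    by (intro loc_L2_add loc_L2_cmult loc_L2_abs X Y hL loc_L2_const) auto
  have bound: "AE s in lborel. 0 \<le> s \<longrightarrow> (\<forall>\<omega>. \<bar>partial_y H (X s \<omega>) (law_flow M X s) (Y s \<omega>)\<bar> \<le> k s \<omega>)"
    using loc_L2_AE_square[OF X]
  proof eventually_elim
    case (elim s)
    show ?case
    proof (intro impI allI)
      fix \<omega> assume s: "0 \<le> s"
      have m: "law_flow M X s \<in> P2" unfolding law_flow_def using elim s mX by (intro distr_in_P2) auto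
      have "W2 (law_flow M X s) \<mu>0 \<le> h s"
        unfolding law_flow_def \<mu>0_def h_def using W2_distr_le[OF mX[OF s], of "\<lambda>_. 0"] s by simp
      then have "l * (\<bar>X s \<omega> - 0\<bar> + \<bar>Y s \<omega> - 0\<bar> + W2 (law_flow M X s) \<mu>0) \<le> l * (\<bar>X s \<omega>\<bar> + \<bar>Y s \<omega>\<bar> + h s)"
        using l by (intro mult_left_mono) auto
      then have "\<bar>partial_y H (X s \<omega>) (law_flow M X s) (Y s \<omega>) - partial_y H 0 \<mu>0 0\<bar> \<le> l * (\<bar>X s \<omega>\<bar> + \<bar>Y s \<omega>\<bar> + h s)"
        using lip[OF m \<mu>0, of "X s \<omega>" "Y s \<omega>" 0 0] by linarith
      then show "\<bar>partial_y H (X s \<omega>) (law_flow M X s) (Y s \<omega>)\<bar> \<le> k s \<omega>"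
        using s by (simp add: k_def c0_def)
    qed
  qed
  have k2: "integrable (lborel \<Otimes>\<^sub>M M) (\<lambda>(t, \<omega>). indicator {0..T} t * (k t \<omega>)\<^sup>2)" if "0 \<le> T" for T
    using kL that by (auto simp: loc_L2_def)
  define e where "e T \<omega> = (LBINT u:{0..T}. (k u \<omega>)\<^sup>2)" for T \<omega>
  have ei: "integrable M (e T)" if "0 \<le> T" for T
    unfolding e_def[abs_def] using fubini_time(3)[OF k2[OF that]] .
  have path: "AE \<omega> in M. (X t \<omega> - X s \<omega>)\<^sup>2 \<le> 2 * (t - s) * e T \<omega> + 2 * (B t \<omega> - B s \<omega>)\<^sup>2" if st: "0 \<le> s" "s \<le> t" "t \<le> T" for s t T
  proof -
    have T: "0 \<le> T" using st by simp
    have "AE \<omega> in M. \<forall>t\<ge>0. set_integrable lborel {0..t} (\<lambda>s. partial_y H (X s \<omega>) (law_flow M X s) (Y s \<omega>)) \<and>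
       X t \<omega> = \<xi> \<omega> + (LBINT s:{0..t}. partial_y H (X s \<omega>) (law_flow M X s) (Y s \<omega>)) + B t \<omega>"
      using sol by (auto simp: fbsde_solution_def elim!: eventually_mono)
    then show ?thesis using fubini_time(1)[OF loc_L2_integrable[OF kL T]] fubini_time(1)[OF k2[OF T]]
    proof eventually_elim
      case (elim \<omega>)
      let ?f = "\<lambda>s. partial_y H (X s \<omega>) (law_flow M X s) (Y s \<omega>)"
      have t: "0 \<le> t" using st by simp
      have kT: "set_integrable lborel {0..t} (\<lambda>u. k u \<omega>)" "set_integrable lborel {s..t} (\<lambda>u. k u \<omega>)" "set_integrable lborel {s..t} (\<lambda>u. (k u \<omega>)\<^sup>2)"
        using elim st by (auto intro: set_integrable_subset)
      have "\<bar>(LBINT u:{0..t}. ?f u) - (LBINT u:{0..s}. ?f u)\<bar> \<le> (LBINT u:{s..t}. k u \<omega>)"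
      proof (rule set_integral_increment_le[OF _ kT(1) _ st(1,2)])
        show "set_integrable lborel {0..t} ?f" using elim(1) t by blast
        show "AE u in lborel. 0 \<le> u \<longrightarrow> \<bar>?f u\<bar> \<le> k u \<omega>" using bound by eventually_elim blast
      qed
      moreover have "X t \<omega> - X s \<omega> = ((LBINT u:{0..t}. ?f u) - (LBINT u:{0..s}. ?f u)) + (B t \<omega> - B s \<omega>)"
        using elim(1) t st(1) by simp
      ultimately have "\<bar>X t \<omega> - X s \<omega> - (B t \<omega> - B s \<omega>)\<bar> \<le> (LBINT u:{s..t}. k u \<omega>)" by simp
      then have "\<bar>X t \<omega> - X s \<omega> - (B t \<omega> - B s \<omega>)\<bar>\<^sup>2 \<le> (LBINT u:{s..t}. k u \<omega>)\<^sup>2" by (intro power_mono) auto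
      also have "\<dots> \<le> (t - s) * (LBINT u:{s..t}. (k u \<omega>)\<^sup>2)" by (rule set_integral_square_le[OF st(2) kT(2,3)])
      also have "\<dots> \<le> (t - s) * e T \<omega>"
      proof (rule mult_left_mono)
        show "(LBINT u:{s..t}. (k u \<omega>)\<^sup>2) \<le> e T \<omega>"
          unfolding e_def set_lebesgue_integral_def using kT(3) elim(3) st unfolding set_integrable_def
          by (intro integral_mono) (auto simp: indicator_def)
      qed (use st in simp)
      finally have 1: "(X t \<omega> - X s \<omega> - (B t \<omega> - B s \<omega>))\<^sup>2 \<le> (t - s) * e T \<omega>" by simp
      have "p\<^sup>2 \<le> 2 * (p - q)\<^sup>2 + 2 * q\<^sup>2" for p q :: real using square_diff_le[of p 0 q] by simp
      from this[of "X t \<omega> - X s \<omega>" "B t \<omega> - B s \<omega>"] 1 show ?case by (simp only: mult.assoc)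
    qed
  qed
  have dom: "integrable M (\<lambda>\<omega>. 2 * (t - s) * e T \<omega> + 2 * (B t \<omega> - B s \<omega>)\<^sup>2)" if st: "0 \<le> s" "s \<le> t" "t \<le> T" for s t T
    using ei[of T] increment_moments(3)[OF st(1,2)] st by (intro Bochner_Integration.integrable_add integrable_mult_right) auto
  have dX: "integrable M (\<lambda>\<omega>. (X t \<omega> - X s \<omega>)\<^sup>2)" if st: "0 \<le> s" "s \<le> t" for s t
    using dom[OF st order_refl]
  proof (rule Bochner_Integration.integrable_bound)
    show "(\<lambda>\<omega>. (X t \<omega> - X s \<omega>)\<^sup>2) \<in> borel_measurable M" using mX st by (intro borel_measurable_power borel_measurable_diff) auto
    show "AE \<omega> in M. norm ((X t \<omega> - X s \<omega>)\<^sup>2) \<le> norm (2 * (t - s) * e t \<omega> + 2 * (B t \<omega> - B s \<omega>)\<^sup>2)"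
      using path[OF st order_refl] by eventually_elim (simp add: abs_le_iff)
  qed
  have X2: "integrable M (\<lambda>\<omega>. (X t \<omega>)\<^sup>2)" if t: "0 \<le> t" for t
  proof -
    have "AE \<omega> in M. X 0 \<omega> = \<xi> \<omega>"
    proof -
      have "AE \<omega> in M. X 0 \<omega> = \<xi> \<omega> + (LBINT s:{0..0}. partial_y H (X s \<omega>) (law_flow M X s) (Y s \<omega>)) + B 0 \<omega>"
        using sol by (auto simp: fbsde_solution_def elim!: eventually_mono)
      moreover have "AE \<omega> in M. B 0 \<omega> = 0" using brownian by (auto simp: brownian_motion_def)
      ultimately show ?thesis by (auto simp: set_integral_singleton)
    qed
    then have "AE \<omega> in M. (\<xi> \<omega>)\<^sup>2 = (X 0 \<omega>)\<^sup>2" by auto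
    then have X0: "integrable M (\<lambda>\<omega>. (X 0 \<omega>)\<^sup>2)"
      using \<xi> mX[of 0] integrable_cong_AE_imp[of M "\<lambda>\<omega>. (\<xi> \<omega>)\<^sup>2" "\<lambda>\<omega>. (X 0 \<omega>)\<^sup>2"] by (simp add: L2_def)
    have "integrable M (\<lambda>\<omega>. (X t \<omega> - X 0 \<omega> + X 0 \<omega>)\<^sup>2)"
      using dX[of 0 t] t X0 mX by (intro integrable_add_square borel_measurable_diff) auto
    then show ?thesis by simp
  qed
  show "law_flow M X t \<in> P2" if "0 \<le> t"
    unfolding law_flow_def using X2[OF that] mX[OF that] by (intro distr_in_P2)
  show "\<exists>L. \<forall>s\<in>{0..T}. \<forall>t\<in>{0..T}. W2 (law_flow M X s) (law_flow M X t) \<le> L * sqrt \<bar>s - t\<bar>" if T: "0 \<le> T"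
  proof -
    \<comment> \<open>The first term comes from the drift, the second from the variance
      \<open>t - s\<close> of the Brownian increment; both carry the factor 2 of the squared
      sum.\<close>
    define L where "L = 2 * expectation (e T) + 2"
    have le: "expectation (\<lambda>\<omega>. (X t \<omega> - X s \<omega>)\<^sup>2) \<le> L * (t - s)" if st: "0 \<le> s" "s \<le> t" "t \<le> T" for s t
    proof -
      have "expectation (\<lambda>\<omega>. (X t \<omega> - X s \<omega>)\<^sup>2) \<le> expectation (\<lambda>\<omega>. 2 * (t - s) * e T \<omega> + 2 * (B t \<omega> - B s \<omega>)\<^sup>2)"
        by (intro integral_mono_AE dX[OF st(1,2)] dom[OF st] path[OF st])
      also have "\<dots> = 2 * (t - s) * expectation (e T) + 2 * expectation (\<lambda>\<omega>. (B t \<omega> - B s \<omega>)\<^sup>2)"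
        using ei[OF T] increment_moments(3)[OF st(1,2)] by (subst Bochner_Integration.integral_add) auto
      also have "\<dots> = L * (t - s)" using increment_moments(4)[OF st(1,2)] by (simp add: L_def algebra_simps)
      finally show ?thesis .
    qed
    have "W2 (law_flow M X s) (law_flow M X t) \<le> sqrt L * sqrt \<bar>s - t\<bar>" if "s \<in> {0..T}" "t \<in> {0..T}" for s t
    proof -
      have "W2 (law_flow M X s) (law_flow M X t) \<le> sqrt (expectation (\<lambda>\<omega>. (X s \<omega> - X t \<omega>)\<^sup>2))"
        unfolding law_flow_def using that mX by (intro W2_distr_le) auto
      also have "expectation (\<lambda>\<omega>. (X s \<omega> - X t \<omega>)\<^sup>2) \<le> L * \<bar>s - t\<bar>"
      proof (cases "s \<le> t")
        case True
        then show ?thesis using le[of s t] that by (simp add: power2_commute)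
      next
        case False
        then show ?thesis using le[of t s] that by simp
      qed
      finally show ?thesis by (simp add: real_sqrt_mult)
    qed
    then show ?thesis by blast
  qed
qed

text \<open>\<open>\<omega>\<close> itself is treated as a random element, of the space carrying
  only the Brownian sigma-algebra. There it is independent of \<open>\<xi>\<close>, so the pair has
  a product law and Tonelli applies. Over \<open>M\<close> the two would in general be
  dependent.\<close>

lemma freezing:
  assumes \<xi>: "\<xi> \<in> borel_measurable (\<F> 0)"
    and h: "(\<lambda>(x, \<omega>). h x \<omega>) \<in> borel_measurable (borel \<Otimes>\<^sub>M brownian_sigma M B)"
  shows "(\<integral>\<^sup>+\<omega>. h (\<xi> \<omega>) \<omega> \<partial>M) = (\<integral>\<^sup>+x. (\<integral>\<^sup>+\<omega>. h x \<omega> \<partial>M) \<partial>distr M borel \<xi>)"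
proof -
  let ?BS = "brownian_sigma M B"
  have \<xi>M: "\<xi> \<in> borel_measurable M" using \<xi> by (rule filt_measurableD[rotated]) simp
  have id: "(\<lambda>\<omega>. \<omega>) \<in> measurable M ?BS"
    using subalgebra_brownian_sigma by (auto simp: subalgebra_def measurable_def)
  interpret D: prob_space "distr M ?BS (\<lambda>\<omega>. \<omega>)" using id by (rule prob_space_distr)
  have h': "(\<lambda>z. h (fst z) (snd z)) \<in> borel_measurable (borel \<Otimes>\<^sub>M ?BS)" using h by (simp add: split_beta')
  have sec: "h x \<in> borel_measurable ?BS" for x
    using borel_measurable_section(1)[of "\<lambda>x \<omega>. h x \<omega>" borel ?BS x] h measurable_compose[OF measurable_Pair1' h'] by simp
  have "(\<integral>\<^sup>+\<omega>. h (\<xi> \<omega>) \<omega> \<partial>M) = (\<integral>\<^sup>+z. h (fst z) (snd z) \<partial>distr M (borel \<Otimes>\<^sub>M ?BS) (\<lambda>\<omega>. (\<xi> \<omega>, \<omega>)))"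
    using h' \<xi>M id by (subst nn_integral_distr) auto
  also have "distr M (borel \<Otimes>\<^sub>M ?BS) (\<lambda>\<omega>. (\<xi> \<omega>, \<omega>)) = distr M borel \<xi> \<Otimes>\<^sub>M distr M ?BS (\<lambda>\<omega>. \<omega>)"
  proof (rule pair_measure_eqI[symmetric])
    show "sigma_finite_measure (distr M borel \<xi>)" "sigma_finite_measure (distr M ?BS (\<lambda>\<omega>. \<omega>))"
      using prob_space_distr[OF \<xi>M] D.sigma_finite_measure_axioms by (auto simp: prob_space_imp_sigma_finite)
    show "sets (distr M borel \<xi> \<Otimes>\<^sub>M distr M ?BS (\<lambda>\<omega>. \<omega>)) = sets (distr M (borel \<Otimes>\<^sub>M ?BS) (\<lambda>\<omega>. (\<xi> \<omega>, \<omega>)))"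
      by (simp cong: sets_pair_measure_cong)
    fix A C assume "A \<in> sets (distr M borel \<xi>)" "C \<in> sets (distr M ?BS (\<lambda>\<omega>. \<omega>))"
    then have A: "A \<in> sets borel" and C: "C \<in> sets ?BS" by auto
    have C': "C \<subseteq> space M" using sets.sets_into_space[OF C] by simp
    have A': "\<xi> -` A \<inter> space M \<in> sets (\<F> 0)" using measurable_sets[OF \<xi> A] by simp
    have "emeasure (distr M (borel \<Otimes>\<^sub>M ?BS) (\<lambda>\<omega>. (\<xi> \<omega>, \<omega>))) (A \<times> C) = emeasure M ((\<lambda>\<omega>. (\<xi> \<omega>, \<omega>)) -` (A \<times> C) \<inter> space M)"
      using A C \<xi>M id by (intro emeasure_distr measurable_Pair) auto
    also have "(\<lambda>\<omega>. (\<xi> \<omega>, \<omega>)) -` (A \<times> C) \<inter> space M = (\<xi> -` A \<inter> space M) \<inter> C" using C' by auto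
    also have "emeasure M \<dots> = emeasure M (\<xi> -` A \<inter> space M) * emeasure M C"
      using indep_setD[OF indep_filt0_brownian_sigma A' C] by (simp add: emeasure_eq_measure ennreal_mult)
    also have "\<dots> = emeasure (distr M borel \<xi>) A * emeasure (distr M ?BS (\<lambda>\<omega>. \<omega>)) C"
      using A C C' \<xi>M id by (simp add: emeasure_distr Int_absorb2)
    finally show "emeasure (distr M borel \<xi>) A * emeasure (distr M ?BS (\<lambda>\<omega>. \<omega>)) C
       = emeasure (distr M (borel \<Otimes>\<^sub>M ?BS) (\<lambda>\<omega>. (\<xi> \<omega>, \<omega>))) (A \<times> C)" by simp
  qed
  also have "(\<integral>\<^sup>+z. h (fst z) (snd z) \<partial>(distr M borel \<xi> \<Otimes>\<^sub>M distr M ?BS (\<lambda>\<omega>. \<omega>)))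
     = (\<integral>\<^sup>+x. (\<integral>\<^sup>+\<omega>. h x \<omega> \<partial>distr M ?BS (\<lambda>\<omega>. \<omega>)) \<partial>distr M borel \<xi>)"
    using h' by (subst D.nn_integral_fst[symmetric]) (auto cong: measurable_cong_sets)
  also have "\<dots> = (\<integral>\<^sup>+x. (\<integral>\<^sup>+\<omega>. h x \<omega> \<partial>M) \<partial>distr M borel \<xi>)"
    using sec id by (simp add: nn_integral_distr)
  finally show ?thesis .
qed

end

text \<open>\<open>N\<close> is left general because both \<open>M\<close> and the parameter space
  \<open>borel \<Otimes>\<^sub>M brownian_sigma M B\<close> occur.\<close>

lemma discounted_distance_measurable:
  assumes u: "(\<lambda>(t, z). u t z) \<in> borel_measurable (time_axis \<Otimes>\<^sub>M N)" "(\<lambda>(t, z). u' t z) \<in> borel_measurable (time_axis \<Otimes>\<^sub>M N)"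
    and v: "(\<lambda>(t, z). v t z) \<in> borel_measurable (time_axis \<Otimes>\<^sub>M N)" "(\<lambda>(t, z). v' t z) \<in> borel_measurable (time_axis \<Otimes>\<^sub>M N)"
  shows "(\<lambda>(t, z). ennreal (exp (- r * t) * ((u t z - u' t z)\<^sup>2 + (v t z - v' t z)\<^sup>2))) \<in> borel_measurable (time_axis \<Otimes>\<^sub>M N)"
    "(\<lambda>z. \<integral>\<^sup>+t. ennreal (exp (- r * t) * ((u t z - u' t z)\<^sup>2 + (v t z - v' t z)\<^sup>2)) \<partial>time_axis) \<in> borel_measurable N"
proof -
  interpret T: sigma_finite_measure time_axis
    by (intro sigma_finite_measure_restrict_space sigma_finite_lborel) simp
  have [measurable]: "(\<lambda>z. u (fst z) (snd z)) \<in> borel_measurable (time_axis \<Otimes>\<^sub>M N)" "(\<lambda>z. u' (fst z) (snd z)) \<in> borel_measurable (time_axis \<Otimes>\<^sub>M N)"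
    "(\<lambda>z. v (fst z) (snd z)) \<in> borel_measurable (time_axis \<Otimes>\<^sub>M N)" "(\<lambda>z. v' (fst z) (snd z)) \<in> borel_measurable (time_axis \<Otimes>\<^sub>M N)"
    using u v by (simp_all add: split_beta')
  have [measurable]: "(\<lambda>t. t) \<in> borel_measurable time_axis" by (rule measurable_restrict_space1) simp
  show m: "(\<lambda>(t, z). ennreal (exp (- r * t) * ((u t z - u' t z)\<^sup>2 + (v t z - v' t z)\<^sup>2))) \<in> borel_measurable (time_axis \<Otimes>\<^sub>M N)"
    unfolding split_beta' by measurable
  show "(\<lambda>z. \<integral>\<^sup>+t. ennreal (exp (- r * t) * ((u t z - u' t z)\<^sup>2 + (v t z - v' t z)\<^sup>2)) \<partial>time_axis) \<in> borel_measurable N"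
  proof (rule T.borel_measurable_nn_integral)
    show "(\<lambda>(z, t). ennreal (exp (- r * t) * ((u t z - u' t z)\<^sup>2 + (v t z - v' t z)\<^sup>2))) \<in> borel_measurable (N \<Otimes>\<^sub>M time_axis)"
      using measurable_compose[OF measurable_pair_swap' m] by (simp add: split_beta')
  qed
qed

context mckean_flow
begin

lemma gap_triangle:
  assumes "(\<lambda>t. X t \<omega>) \<in> borel_measurable time_axis" "(\<lambda>t. Y t \<omega>) \<in> borel_measurable time_axis"
    "(\<lambda>t. X1 t \<omega>) \<in> borel_measurable time_axis" "(\<lambda>t. Y1 t \<omega>) \<in> borel_measurable time_axis"
    "(\<lambda>t. X2 t \<omega>) \<in> borel_measurable time_axis" "(\<lambda>t. Y2 t \<omega>) \<in> borel_measurable time_axis"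
  shows "gap X Y X2 Y2 \<omega> \<le> 2 * gap X Y X1 Y1 \<omega> + 2 * gap X2 Y2 X1 Y1 \<omega>"
proof -
  have [measurable]: "(\<lambda>t. t) \<in> borel_measurable time_axis" by (rule measurable_restrict_space1) simp
  note assms[measurable]
  have pt: "ennreal (exp (- r * t) * ((a - a2)\<^sup>2 + (b - b2)\<^sup>2))
    \<le> 2 * ennreal (exp (- r * t) * ((a - a1)\<^sup>2 + (b - b1)\<^sup>2)) + 2 * ennreal (exp (- r * t) * ((a2 - a1)\<^sup>2 + (b2 - b1)\<^sup>2))"
    for t a a1 a2 b b1 b2 :: real
  proof -
    from square_diff_le[of a a2 a1] square_diff_le[of b b2 b1]
    have "(a - a2)\<^sup>2 + (b - b2)\<^sup>2 \<le> 2 * ((a - a1)\<^sup>2 + (b - b1)\<^sup>2) + 2 * ((a2 - a1)\<^sup>2 + (b2 - b1)\<^sup>2)" by simp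
    then have "exp (- r * t) * ((a - a2)\<^sup>2 + (b - b2)\<^sup>2) \<le> exp (- r * t) * (2 * ((a - a1)\<^sup>2 + (b - b1)\<^sup>2) + 2 * ((a2 - a1)\<^sup>2 + (b2 - b1)\<^sup>2))"
      by (intro mult_left_mono) auto
    also have "\<dots> = 2 * (exp (- r * t) * ((a - a1)\<^sup>2 + (b - b1)\<^sup>2)) + 2 * (exp (- r * t) * ((a2 - a1)\<^sup>2 + (b2 - b1)\<^sup>2))"
      by (simp add: algebra_simps)
    finally have "ennreal (exp (- r * t) * ((a - a2)\<^sup>2 + (b - b2)\<^sup>2)) \<le> ennreal (2 * (exp (- r * t) * ((a - a1)\<^sup>2 + (b - b1)\<^sup>2)) + 2 * (exp (- r * t) * ((a2 - a1)\<^sup>2 + (b2 - b1)\<^sup>2)))"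
      by (rule ennreal_leI)
    also have "\<dots> = 2 * ennreal (exp (- r * t) * ((a - a1)\<^sup>2 + (b - b1)\<^sup>2)) + 2 * ennreal (exp (- r * t) * ((a2 - a1)\<^sup>2 + (b2 - b1)\<^sup>2))"
      by (simp add: ennreal_plus ennreal_mult)
    finally show ?thesis .
  qed
  have "gap X Y X2 Y2 \<omega> \<le> (\<integral>\<^sup>+t. 2 * ennreal (exp (- r * t) * ((X t \<omega> - X1 t \<omega>)\<^sup>2 + (Y t \<omega> - Y1 t \<omega>)\<^sup>2))
       + 2 * ennreal (exp (- r * t) * ((X2 t \<omega> - X1 t \<omega>)\<^sup>2 + (Y2 t \<omega> - Y1 t \<omega>)\<^sup>2)) \<partial>time_axis)"
    unfolding gap_def by (intro nn_integral_mono pt)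
  also have "\<dots> = 2 * gap X Y X1 Y1 \<omega> + 2 * gap X2 Y2 X1 Y1 \<omega>"
    unfolding gap_def by (subst nn_integral_add) (simp_all add: nn_integral_cmult)
  finally show ?thesis .
qed

section \<open>Substitution of the initial value into the family\<close>

context
  fixes \<xi> X Y Z and Xx Yx Zx :: "real \<Rightarrow> real \<Rightarrow> 'a \<Rightarrow> real"
  assumes \<xi>: "\<xi> \<in> L2 M (\<F> 0)"
    and sol: "fbsde_solution M B \<F> r H m \<xi> X Y Z"
    and sol_x: "\<And>x. fbsde_solution M B \<F> r H m (\<lambda>_. x) (Xx x) (Yx x) (Zx x)"
    and versions: "brownian_measurable_family M B Xx" "brownian_measurable_family M B Yx"
begin

lemma \<xi>_measurable: "\<xi> \<in> borel_measurable (\<F> 0)" "\<xi> \<in> borel_measurable M"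
proof -
  show "\<xi> \<in> borel_measurable (\<F> 0)" using \<xi> by (simp add: L2_def)
  then show "\<xi> \<in> borel_measurable M" by (rule filt_measurableD[OF order_refl])
qed

lemma const_L2: "(\<lambda>_. x) \<in> L2 M (\<F> 0)"
  by (simp add: L2_def)

lemma slab_filt: "{\<omega>\<in>space M. x \<le> \<xi> \<omega> \<and> \<xi> \<omega> < x + \<delta>} \<in> sets (\<F> 0)"
proof -
  have "\<xi> -` {x..<x + \<delta>} \<inter> space (\<F> 0) \<in> sets (\<F> 0)" using \<xi>_measurable(1) by (rule measurable_sets) simp
  moreover have "\<xi> -` {x..<x + \<delta>} \<inter> space (\<F> 0) = {\<omega>\<in>space M. x \<le> \<xi> \<omega> \<and> \<xi> \<omega> < x + \<delta>}" by auto
  ultimately show ?thesis by simp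
qed

lemma slab_events: "{\<omega>\<in>space M. x \<le> \<xi> \<omega> \<and> \<xi> \<omega> < x + \<delta>} \<in> events"
  using \<xi>_measurable(2) by measurable

lemma emeasure_slab:
  "(\<integral>\<^sup>+y. indicator {x..<x + \<delta>} y \<partial>distr M borel \<xi>) = emeasure M {\<omega>\<in>space M. x \<le> \<xi> \<omega> \<and> \<xi> \<omega> < x + \<delta>}"
proof -
  have "\<xi> -` {x..<x + \<delta>} \<inter> space M = {\<omega>\<in>space M. x \<le> \<xi> \<omega> \<and> \<xi> \<omega> < x + \<delta>}" by auto
  then show ?thesis using \<xi>_measurable(2) by (simp add: emeasure_distr)
qed

lemma solution_measurable:
  assumes "fbsde_solution M B \<F> r H m \<zeta> X' Y' Z'"
  shows "(\<lambda>(t, \<omega>). X' t \<omega>) \<in> borel_measurable (time_axis \<Otimes>\<^sub>M M)" "(\<lambda>(t, \<omega>). Y' t \<omega>) \<in> borel_measurable (time_axis \<Otimes>\<^sub>M M)"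
  using assms by (auto simp: fbsde_solution_def Lr2_def)

lemma substitution_measurable:
  assumes "brownian_measurable_family M B V"
  shows "(\<lambda>(t, \<omega>). V (\<xi> \<omega>) t \<omega>) \<in> borel_measurable (time_axis \<Otimes>\<^sub>M M)"
proof -
  have id: "(\<lambda>\<omega>. \<omega>) \<in> measurable M (brownian_sigma M B)"
    using subalgebra_brownian_sigma by (auto simp: subalgebra_def measurable_def)
  have "(\<lambda>z. (fst z, \<xi> (snd z), snd z)) \<in> measurable (time_axis \<Otimes>\<^sub>M M) (time_axis \<Otimes>\<^sub>M (borel \<Otimes>\<^sub>M brownian_sigma M B))"
    using \<xi>_measurable(2) measurable_compose[OF measurable_snd id] by (intro measurable_Pair) auto
  from measurable_compose[OF this assms[unfolded brownian_measurable_family_def]] show ?thesis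
    by (simp add: split_beta')
qed

lemma substitution_paths:
  "(AE (t, \<omega>) in time_axis \<Otimes>\<^sub>M M. Xx (\<xi> \<omega>) t \<omega> = X t \<omega>) \<and> (AE (t, \<omega>) in time_axis \<Otimes>\<^sub>M M. Yx (\<xi> \<omega>) t \<omega> = Y t \<omega>)"
proof -
  let ?X = "\<lambda>t \<omega>. Xx (\<xi> \<omega>) t \<omega>" and ?Y = "\<lambda>t \<omega>. Yx (\<xi> \<omega>) t \<omega>"
  note mX = solution_measurable[OF sol] and mx = solution_measurable[OF sol_x]
    and mS = substitution_measurable[OF versions(1)] substitution_measurable[OF versions(2)]
  have Cpos: "0 \<le> C_energy" by (simp add: C_energy_def)
  have f: "gap X Y ?X ?Y \<in> borel_measurable M"
    unfolding gap_def[abs_def] using mX mS by (intro discounted_distance_measurable(2))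
  have "AE \<omega> in M. gap X Y ?X ?Y \<omega> = 0"
  proof (rule AE_zero_of_slab_bounds[OF prob_space_axioms f \<xi>_measurable(2), where C="4 * C_energy"])
    fix x \<delta> :: real assume \<delta>: "0 < \<delta>" "\<delta> \<le> 1"
    let ?A = "{\<omega>\<in>space M. x \<le> \<xi> \<omega> \<and> \<xi> \<omega> < x + \<delta>}"
    have m1: "gap X Y (Xx x) (Yx x) \<in> borel_measurable M" "gap ?X ?Y (Xx x) (Yx x) \<in> borel_measurable M"
      unfolding gap_def[abs_def]
      by (rule discounted_distance_measurable(2)[OF mX(1) mx(1)[of x] mX(2) mx(2)[of x]],
          rule discounted_distance_measurable(2)[OF mS(1) mx(1)[of x] mS(2) mx(2)[of x]])
    have 1: "(\<integral>\<^sup>+\<omega>\<in>?A. gap X Y (Xx x) (Yx x) \<omega> \<partial>M) \<le> ennreal (C_energy * \<delta>\<^sup>2) * emeasure M ?A"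
      using \<delta> by (intro local_stability(1)[OF sol sol_x slab_filt \<xi> const_L2]) auto
    \<comment> \<open>Freezing turns the parameter into a deterministic \<open>y\<close> in the
      slab. The stability bound is then used on the whole space for the two starting points
      \<open>y\<close> and \<open>x\<close>, and the probability of the slab reappears on
      integrating over the law of \<open>\<xi>\<close>.\<close>
    have 2: "(\<integral>\<^sup>+\<omega>\<in>?A. gap ?X ?Y (Xx x) (Yx x) \<omega> \<partial>M) \<le> ennreal (C_energy * \<delta>\<^sup>2) * emeasure M ?A"
    proof -
      define h where "h y \<omega> = gap (Xx y) (Yx y) (Xx x) (Yx x) \<omega> * indicator {x..<x + \<delta>} y" for y \<omega>
      have "(\<lambda>z. gap (Xx (fst z)) (Yx (fst z)) (Xx x) (Yx x) (snd z)) \<in> borel_measurable (borel \<Otimes>\<^sub>M brownian_sigma M B)"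
      proof -
        have fam: "(\<lambda>(t, z). V (fst z) t (snd z)) \<in> borel_measurable (time_axis \<Otimes>\<^sub>M (borel \<Otimes>\<^sub>M brownian_sigma M B))"
          if "brownian_measurable_family M B V" for V
          using that unfolding brownian_measurable_family_def by (simp add: split_beta')
        have fam': "(\<lambda>(t, z). V x t (snd z)) \<in> borel_measurable (time_axis \<Otimes>\<^sub>M (borel \<Otimes>\<^sub>M brownian_sigma M B))"
          if "brownian_measurable_family M B V" for V
        proof -
          have "(\<lambda>z. (fst z, x, snd (snd z))) \<in> measurable (time_axis \<Otimes>\<^sub>M (borel \<Otimes>\<^sub>M brownian_sigma M B)) (time_axis \<Otimes>\<^sub>M (borel \<Otimes>\<^sub>M brownian_sigma M B))"
            by measurable
          from measurable_compose[OF this that[unfolded brownian_measurable_family_def]] show ?thesis by (simp add: split_beta')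
        qed
        show ?thesis
          unfolding gap_def
          using fam[OF versions(1)] fam'[OF versions(1)] fam[OF versions(2)] fam'[OF versions(2)]
          by (rule discounted_distance_measurable(2))
      qed
      then have mh: "(\<lambda>(y, \<omega>). h y \<omega>) \<in> borel_measurable (borel \<Otimes>\<^sub>M brownian_sigma M B)"
        unfolding h_def split_beta' by (intro borel_measurable_times_ennreal) auto
      have inner: "(\<integral>\<^sup>+\<omega>. h y \<omega> \<partial>M) \<le> ennreal (C_energy * \<delta>\<^sup>2) * indicator {x..<x + \<delta>} y" for y
      proof (cases "y \<in> {x..<x + \<delta>}")
        case True
        have "(\<integral>\<^sup>+\<omega>\<in>space M. gap (Xx y) (Yx y) (Xx x) (Yx x) \<omega> \<partial>M) \<le> ennreal (C_energy * \<delta>\<^sup>2) * emeasure M (space M)"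
          using \<delta> True sets.top[of "\<F> 0"] by (intro local_stability(1)[OF sol_x sol_x _ const_L2 const_L2]) auto
        moreover have "(\<integral>\<^sup>+\<omega>\<in>space M. gap (Xx y) (Yx y) (Xx x) (Yx x) \<omega> \<partial>M) = (\<integral>\<^sup>+\<omega>. h y \<omega> \<partial>M)"
          using True by (intro nn_integral_cong) (simp add: h_def)
        ultimately show ?thesis using True by (simp add: emeasure_space_1)
      qed (simp add: h_def)
      have "(\<integral>\<^sup>+\<omega>\<in>?A. gap ?X ?Y (Xx x) (Yx x) \<omega> \<partial>M) = (\<integral>\<^sup>+\<omega>. h (\<xi> \<omega>) \<omega> \<partial>M)"
        by (intro nn_integral_cong) (auto simp: h_def gap_def indicator_def)
      also have "\<dots> = (\<integral>\<^sup>+y. (\<integral>\<^sup>+\<omega>. h y \<omega> \<partial>M) \<partial>distr M borel \<xi>)"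
        by (rule freezing[OF \<xi>_measurable(1) mh])
      also have "\<dots> \<le> (\<integral>\<^sup>+y. ennreal (C_energy * \<delta>\<^sup>2) * indicator {x..<x + \<delta>} y \<partial>distr M borel \<xi>)"
        by (intro nn_integral_mono inner)
      also have "\<dots> = ennreal (C_energy * \<delta>\<^sup>2) * (\<integral>\<^sup>+y. indicator {x..<x + \<delta>} y \<partial>distr M borel \<xi>)"
        by (rule nn_integral_cmult) simp
      finally show ?thesis unfolding emeasure_slab .
    qed
    have "(\<integral>\<^sup>+\<omega>\<in>?A. gap X Y ?X ?Y \<omega> \<partial>M)
       \<le> (\<integral>\<^sup>+\<omega>. 2 * (gap X Y (Xx x) (Yx x) \<omega> * indicator ?A \<omega>) + 2 * (gap ?X ?Y (Xx x) (Yx x) \<omega> * indicator ?A \<omega>) \<partial>M)"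
    proof (rule nn_integral_mono)
      fix \<omega> assume \<omega>: "\<omega> \<in> space M"
      have "gap X Y ?X ?Y \<omega> \<le> 2 * gap X Y (Xx x) (Yx x) \<omega> + 2 * gap ?X ?Y (Xx x) (Yx x) \<omega>"
      proof (rule gap_triangle)
        show "(\<lambda>t. X t \<omega>) \<in> borel_measurable time_axis" by (rule borel_measurable_section(2)[OF mX(1) \<omega>])
        show "(\<lambda>t. Y t \<omega>) \<in> borel_measurable time_axis" by (rule borel_measurable_section(2)[OF mX(2) \<omega>])
        show "(\<lambda>t. Xx x t \<omega>) \<in> borel_measurable time_axis" by (rule borel_measurable_section(2)[OF mx(1) \<omega>])
        show "(\<lambda>t. Yx x t \<omega>) \<in> borel_measurable time_axis" by (rule borel_measurable_section(2)[OF mx(2) \<omega>])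
        show "(\<lambda>t. Xx (\<xi> \<omega>) t \<omega>) \<in> borel_measurable time_axis" by (rule borel_measurable_section(2)[OF mS(1) \<omega>])
        show "(\<lambda>t. Yx (\<xi> \<omega>) t \<omega>) \<in> borel_measurable time_axis" by (rule borel_measurable_section(2)[OF mS(2) \<omega>])
      qed
      then show "gap X Y ?X ?Y \<omega> * indicator ?A \<omega> \<le> 2 * (gap X Y (Xx x) (Yx x) \<omega> * indicator ?A \<omega>) + 2 * (gap ?X ?Y (Xx x) (Yx x) \<omega> * indicator ?A \<omega>)"
        by (auto simp: indicator_def)
    qed
    also have "\<dots> = 2 * (\<integral>\<^sup>+\<omega>\<in>?A. gap X Y (Xx x) (Yx x) \<omega> \<partial>M) + 2 * (\<integral>\<^sup>+\<omega>\<in>?A. gap ?X ?Y (Xx x) (Yx x) \<omega> \<partial>M)"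
      using m1 slab_events[of x \<delta>] by (subst nn_integral_add) (simp_all add: nn_integral_cmult)
    also have "\<dots> \<le> 2 * (ennreal (C_energy * \<delta>\<^sup>2) * emeasure M ?A) + 2 * (ennreal (C_energy * \<delta>\<^sup>2) * emeasure M ?A)"
      using 1 2 by (intro add_mono mult_left_mono) auto
    also have "\<dots> = ennreal (4 * C_energy * \<delta>\<^sup>2 * prob ?A)"
    proof -
      have "2 * (ennreal q * ennreal p) + 2 * (ennreal q * ennreal p) = ennreal (4 * q * p)" if "0 \<le> q" "0 \<le> p" for q p :: real
      proof -
        have "2 * (ennreal q * ennreal p) = ennreal (2 * (q * p))" using that by (simp add: ennreal_mult)
        then show ?thesis using that by (simp add: ennreal_plus[symmetric] del: ennreal_plus)
      qed
      from this[of "C_energy * \<delta>\<^sup>2" "prob ?A"] show ?thesis using Cpos by (simp add: emeasure_eq_measure mult.assoc)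
    qed
    \<comment> \<open>The quadratic rate is given away, using \<open>\<delta> \<le> 1\<close>, to
      meet the linear form of \<open>AE_zero_of_slab_bounds\<close>.\<close>
    also have "\<dots> \<le> ennreal (4 * C_energy * \<delta> * prob ?A)"
    proof (rule ennreal_leI)
      have "\<delta>\<^sup>2 \<le> \<delta>" using \<delta> by (simp add: power2_eq_square mult_left_le)
      then show "4 * C_energy * \<delta>\<^sup>2 * prob ?A \<le> 4 * C_energy * \<delta> * prob ?A"
        using Cpos by (intro mult_right_mono mult_left_mono) auto
    qed
    also have "\<dots> = ennreal (4 * C_energy * \<delta>) * emeasure M ?A"
      using Cpos \<delta> by (simp add: emeasure_eq_measure ennreal_mult)
    finally show "(\<integral>\<^sup>+\<omega>\<in>?A. gap X Y ?X ?Y \<omega> \<partial>M) \<le> ennreal (4 * C_energy * \<delta>) * emeasure M ?A" .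
  qed
  then have zero: "(\<integral>\<^sup>+\<omega>. gap X Y ?X ?Y \<omega> \<partial>M) = 0"
    using f by (simp add: nn_integral_0_iff_AE)
  interpret T: sigma_finite_measure time_axis
    by (intro sigma_finite_measure_restrict_space sigma_finite_lborel) simp
  interpret TM: pair_sigma_finite time_axis M ..
  have md: "(\<lambda>(t, \<omega>). ennreal (exp (- r * t) * ((X t \<omega> - ?X t \<omega>)\<^sup>2 + (Y t \<omega> - ?Y t \<omega>)\<^sup>2))) \<in> borel_measurable (time_axis \<Otimes>\<^sub>M M)"
    using mX mS by (intro discounted_distance_measurable(1))
  have "(\<integral>\<^sup>+z. (case z of (t, \<omega>) \<Rightarrow> ennreal (exp (- r * t) * ((X t \<omega> - ?X t \<omega>)\<^sup>2 + (Y t \<omega> - ?Y t \<omega>)\<^sup>2))) \<partial>(time_axis \<Otimes>\<^sub>M M)) = 0"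
    using TM.nn_integral_snd[OF md] zero unfolding gap_def by simp
  then have "AE z in time_axis \<Otimes>\<^sub>M M. (case z of (t, \<omega>) \<Rightarrow> ennreal (exp (- r * t) * ((X t \<omega> - ?X t \<omega>)\<^sup>2 + (Y t \<omega> - ?Y t \<omega>)\<^sup>2))) = 0"
    using md by (simp add: nn_integral_0_iff_AE)
  then have "AE z in time_axis \<Otimes>\<^sub>M M. ?X (fst z) (snd z) = X (fst z) (snd z) \<and> ?Y (fst z) (snd z) = Y (fst z) (snd z)"
  proof eventually_elim
    case (elim z)
    have "exp (- r * fst z) * ((X (fst z) (snd z) - ?X (fst z) (snd z))\<^sup>2 + (Y (fst z) (snd z) - ?Y (fst z) (snd z))\<^sup>2) \<le> 0"
      using elim by (simp add: split_beta' ennreal_eq_0_iff)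
    then have "(X (fst z) (snd z) - ?X (fst z) (snd z))\<^sup>2 + (Y (fst z) (snd z) - ?Y (fst z) (snd z))\<^sup>2 \<le> 0"
      by (simp add: mult_le_0_iff)
    then show ?case by (simp add: sum_power2_le_zero_iff)
  qed
  then show ?thesis by (simp add: split_beta' AE_conj_iff)
qed

text \<open>The initial value is measurable with respect to two independent \<open>\<sigma>\<close>-algebras, the initial and the Brownian one.\<close>

lemma initial_value_constant: "AE \<omega> in M. Yx x 0 \<omega> = expectation (Yx x 0)"
proof -
  let ?V = "Yx x 0" let ?c = "expectation ?V"
  have F0: "?V \<in> borel_measurable (\<F> 0)" using sol_adapted(2)[OF sol_x] by simp
  have M: "?V \<in> borel_measurable M" using F0 by (rule filt_measurableD[rotated]) simp
  have V2: "integrable M (\<lambda>\<omega>. (?V \<omega>)\<^sup>2)" using sol_square(1)[OF sol_x] by simp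
  have V1: "integrable M ?V" using M V2 by (rule square_integrable_imp_integrable)
  have BS: "?V \<in> borel_measurable (brownian_sigma M B)"
  proof -
    have "(\<lambda>\<omega>. (0, x, \<omega>)) \<in> measurable (brownian_sigma M B) (time_axis \<Otimes>\<^sub>M (borel \<Otimes>\<^sub>M brownian_sigma M B))"
      by (intro measurable_Pair) (auto simp: space_restrict_space)
    from measurable_compose[OF this versions(2)[unfolded brownian_measurable_family_def]] show ?thesis by simp
  qed
  \<comment> \<open>A square integrable variable independent of itself has variance 0.\<close>
  have "indep_var borel ?V borel ?V"
  proof (rule indep_var_of_indep_set[OF indep_filt0_brownian_sigma M _ M])
    show "?V -` A \<inter> space M \<in> sets (\<F> 0)" "?V -` A \<inter> space M \<in> sets (brownian_sigma M B)" if "A \<in> sets borel" for A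
      using measurable_sets[OF F0 that] measurable_sets[OF BS that] by simp_all
  qed
  then have "expectation (\<lambda>\<omega>. ?V \<omega> * ?V \<omega>) = ?c * ?c" using V1 V1 by (rule indep_var_lebesgue_integral)
  then have "expectation (\<lambda>\<omega>. (?V \<omega>)\<^sup>2) = ?c\<^sup>2" by (simp add: power2_eq_square)
  then have "variance ?V = 0" using variance_eq[OF V1 V2] by simp
  moreover have "integrable M (\<lambda>\<omega>. (?V \<omega> - ?c)\<^sup>2)" using M V2 by (intro integrable_diff_square) auto
  ultimately have "AE \<omega> in M. (?V \<omega> - ?c)\<^sup>2 = 0" by (simp add: integral_nonneg_eq_0_iff_AE)
  then show ?thesis by simp
qed

lemma as_constant_initial_value: "as_constant M (Yx x 0) = expectation (Yx x 0)"
  unfolding as_constant_def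
proof (rule the_equality)
  show "AE \<omega> in M. Yx x 0 \<omega> = expectation (Yx x 0)" by (rule initial_value_constant)
  fix c assume "AE \<omega> in M. Yx x 0 \<omega> = c"
  then have "AE \<omega> in M. c = expectation (Yx x 0)" using initial_value_constant[of x] by eventually_elim simp
  then show "c = expectation (Yx x 0)" by simp
qed

text \<open>Both initial values are almost surely constant, so their \<open>L1\<close> distance,
  bounded by \<open>local_stability\<close> on the whole space, is the distance of two numbers.
  Below it makes \<open>x \<mapsto> expectation (Yx x 0)\<close> Borel measurable and controls its
  variation within a slab.\<close>

lemma initial_value_lipschitz: "\<bar>expectation (Yx x 0) - expectation (Yx y 0)\<bar> \<le> C_initial * \<bar>x - y\<bar>"
proof (cases "x = y")
  case False
  have C: "0 \<le> C_initial" using r l by (simp add: C_initial_def C_energy_def)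
  have "AE \<omega> in M. ennreal \<bar>Yx x 0 \<omega> - Yx y 0 \<omega>\<bar> * indicator (space M) \<omega> = ennreal \<bar>expectation (Yx x 0) - expectation (Yx y 0)\<bar>"
    using initial_value_constant[of x] initial_value_constant[of y] AE_space by eventually_elim simp
  then have "(\<integral>\<^sup>+\<omega>\<in>space M. ennreal \<bar>Yx x 0 \<omega> - Yx y 0 \<omega>\<bar> \<partial>M) = (\<integral>\<^sup>+\<omega>. ennreal \<bar>expectation (Yx x 0) - expectation (Yx y 0)\<bar> \<partial>M)"
    by (rule nn_integral_cong_AE)
  moreover have "(\<integral>\<^sup>+\<omega>\<in>space M. ennreal \<bar>Yx x 0 \<omega> - Yx y 0 \<omega>\<bar> \<partial>M) \<le> ennreal (C_initial * \<bar>x - y\<bar>) * emeasure M (space M)"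
    using False sets.top[of "\<F> 0"] by (intro local_stability(2)[OF sol_x sol_x _ const_L2 const_L2]) auto
  ultimately show ?thesis using C by (simp add: emeasure_space_1)
qed simp

text \<open>The substitution at time 0 has two readings: the number attached to the parameter
  \<open>\<xi> \<omega>\<close>, and the chosen version evaluated at \<open>\<omega>\<close>. Both
  are compared with \<open>c (\<xi> \<omega>)\<close>. The slabs identify \<open>Y 0\<close> with
  it, and freezing identifies the version with it.\<close>

lemma substitution_initial_value:
  "AE \<omega> in M. as_constant M (Yx (\<xi> \<omega>) 0) = Y 0 \<omega> \<and> Yx (\<xi> \<omega>) 0 \<omega> = Y 0 \<omega>"
proof -
  define c where "c x = expectation (Yx x 0)" for x
  have C: "0 \<le> C_initial" using r l by (simp add: C_initial_def C_energy_def)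
  have "C_initial-lipschitz_on UNIV c"
    using initial_value_lipschitz C by (intro lipschitz_onI) (auto simp: c_def dist_real_def)
  then have c: "c \<in> borel_measurable borel"
    by (intro borel_measurable_continuous_onI lipschitz_on_continuous_on)
  have c\<xi>: "(\<lambda>\<omega>. c (\<xi> \<omega>)) \<in> borel_measurable M" using \<xi>_measurable(2) c by (rule measurable_compose)
  have mY: "Y 0 \<in> borel_measurable M" "Yx x 0 \<in> borel_measurable M" for x
    using filt_measurableD[OF order_refl sol_adapted(2)[OF sol order_refl]] filt_measurableD[OF order_refl sol_adapted(2)[OF sol_x order_refl]] by auto
  have m1: "(\<lambda>\<omega>. ennreal \<bar>Y 0 \<omega> - c (\<xi> \<omega>)\<bar>) \<in> borel_measurable M" using mY c\<xi> by measurable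
  have "AE \<omega> in M. ennreal \<bar>Y 0 \<omega> - c (\<xi> \<omega>)\<bar> = 0"
  proof (rule AE_zero_of_slab_bounds[OF prob_space_axioms m1 \<xi>_measurable(2), where C="2 * C_initial"])
    fix x \<delta> :: real assume \<delta>: "0 < \<delta>" "\<delta> \<le> 1"
    let ?A = "{\<omega>\<in>space M. x \<le> \<xi> \<omega> \<and> \<xi> \<omega> < x + \<delta>}"
    have "(\<integral>\<^sup>+\<omega>\<in>?A. ennreal \<bar>Y 0 \<omega> - c (\<xi> \<omega>)\<bar> \<partial>M)
      \<le> (\<integral>\<^sup>+\<omega>. ennreal \<bar>Y 0 \<omega> - Yx x 0 \<omega>\<bar> * indicator ?A \<omega> + ennreal (C_initial * \<delta>) * indicator ?A \<omega> \<partial>M)"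
    proof (rule nn_integral_mono_AE)
      show "AE \<omega> in M. ennreal \<bar>Y 0 \<omega> - c (\<xi> \<omega>)\<bar> * indicator ?A \<omega>
         \<le> ennreal \<bar>Y 0 \<omega> - Yx x 0 \<omega>\<bar> * indicator ?A \<omega> + ennreal (C_initial * \<delta>) * indicator ?A \<omega>"
        using initial_value_constant[of x]
      proof eventually_elim
        case (elim \<omega>)
        have "\<bar>Y 0 \<omega> - c (\<xi> \<omega>)\<bar> \<le> \<bar>Y 0 \<omega> - Yx x 0 \<omega>\<bar> + C_initial * \<delta>" if "\<omega> \<in> ?A"
        proof -
          have "\<bar>c x - c (\<xi> \<omega>)\<bar> \<le> C_initial * \<bar>x - \<xi> \<omega>\<bar>" unfolding c_def by (rule initial_value_lipschitz)
          also have "\<dots> \<le> C_initial * \<delta>" using that C by (intro mult_left_mono) auto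
          finally show ?thesis using elim by (simp add: c_def)
        qed
        then have "\<omega> \<in> ?A \<Longrightarrow> ennreal \<bar>Y 0 \<omega> - c (\<xi> \<omega>)\<bar> \<le> ennreal \<bar>Y 0 \<omega> - Yx x 0 \<omega>\<bar> + ennreal (C_initial * \<delta>)"
          using C \<delta> by (simp add: ennreal_plus[symmetric] ennreal_leI del: ennreal_plus)
        then show ?case by (auto simp: indicator_def)
      qed
    qed
    also have "\<dots> = (\<integral>\<^sup>+\<omega>\<in>?A. ennreal \<bar>Y 0 \<omega> - Yx x 0 \<omega>\<bar> \<partial>M) + ennreal (C_initial * \<delta>) * emeasure M ?A"
      using mY slab_events[of x \<delta>] by (subst nn_integral_add) (simp_all add: nn_integral_cmult_indicator)
    also have "\<dots> \<le> ennreal (C_initial * \<delta>) * emeasure M ?A + ennreal (C_initial * \<delta>) * emeasure M ?A"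
      using \<delta> by (intro add_right_mono local_stability(2)[OF sol sol_x slab_filt \<xi> const_L2]) auto
    also have "\<dots> = ennreal (2 * C_initial * \<delta>) * emeasure M ?A"
      using C \<delta> by (simp add: distrib_right[symmetric] ennreal_plus[symmetric] del: ennreal_plus)
    finally show "(\<integral>\<^sup>+\<omega>\<in>?A. ennreal \<bar>Y 0 \<omega> - c (\<xi> \<omega>)\<bar> \<partial>M) \<le> ennreal (2 * C_initial * \<delta>) * emeasure M ?A" .
  qed
  then have Yc: "AE \<omega> in M. Y 0 \<omega> = c (\<xi> \<omega>)" by eventually_elim (simp add: ennreal_eq_0_iff)
  \<comment> \<open>For each \<open>x\<close> the version equals \<open>c x\<close> off a null set
    depending on \<open>x\<close>. These uncountably many null sets could add up after inserting
    \<open>\<xi>\<close>; joint measurability over the Brownian sigma-algebra and freezing rule this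
    out.\<close>
  define h where "h x \<omega> = ennreal \<bar>Yx x 0 \<omega> - c x\<bar>" for x \<omega>
  have mh: "(\<lambda>(x, \<omega>). h x \<omega>) \<in> borel_measurable (borel \<Otimes>\<^sub>M brownian_sigma M B)"
  proof -
    have "(\<lambda>z. (0, z)) \<in> measurable (borel \<Otimes>\<^sub>M brownian_sigma M B) (time_axis \<Otimes>\<^sub>M (borel \<Otimes>\<^sub>M brownian_sigma M B))"
      by (intro measurable_Pair) (auto simp: space_restrict_space)
    from measurable_compose[OF this versions(2)[unfolded brownian_measurable_family_def]]
    have "(\<lambda>z. Yx (fst z) 0 (snd z)) \<in> borel_measurable (borel \<Otimes>\<^sub>M brownian_sigma M B)" by (simp add: split_beta')
    moreover have "(\<lambda>z. c (fst z)) \<in> borel_measurable (borel \<Otimes>\<^sub>M brownian_sigma M B)" using measurable_fst c by (rule measurable_compose)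
    ultimately show ?thesis unfolding h_def split_beta' by measurable
  qed
  have "(\<integral>\<^sup>+\<omega>. h x \<omega> \<partial>M) = 0" for x
  proof -
    have "AE \<omega> in M. h x \<omega> = 0" using initial_value_constant[of x] by eventually_elim (simp add: h_def c_def)
    then have "(\<integral>\<^sup>+\<omega>. h x \<omega> \<partial>M) = (\<integral>\<^sup>+\<omega>. 0 \<partial>M)" by (rule nn_integral_cong_AE)
    then show ?thesis by simp
  qed
  then have "(\<integral>\<^sup>+\<omega>. h (\<xi> \<omega>) \<omega> \<partial>M) = 0" using freezing[OF \<xi>_measurable(1) mh] by simp
  moreover have "(\<lambda>\<omega>. h (\<xi> \<omega>) \<omega>) \<in> borel_measurable M"
  proof -
    have "(\<lambda>\<omega>. \<omega>) \<in> measurable M (brownian_sigma M B)"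
      using subalgebra_brownian_sigma by (auto simp: subalgebra_def measurable_def)
    with \<xi>_measurable(2) have "(\<lambda>\<omega>. (\<xi> \<omega>, \<omega>)) \<in> measurable M (borel \<Otimes>\<^sub>M brownian_sigma M B)" by (rule measurable_Pair)
    from measurable_compose[OF this mh] show ?thesis by simp
  qed
  ultimately have "AE \<omega> in M. h (\<xi> \<omega>) \<omega> = 0" by (simp add: nn_integral_0_iff_AE)
  then have "AE \<omega> in M. Yx (\<xi> \<omega>) 0 \<omega> = c (\<xi> \<omega>)" by eventually_elim (simp add: h_def ennreal_eq_0_iff)
  with Yc show ?thesis
    by eventually_elim (simp add: as_constant_initial_value c_def)
qed

end

end

section \<open>The flow of laws of the solution and the conclusion\<close>

theorem theorem3p4:
  fixes M :: "'a measure"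
    and B :: "real \<Rightarrow> 'a \<Rightarrow> real"
    and F0 :: "'a measure"
    and b0 f0 :: "real \<Rightarrow> real measure \<Rightarrow> real"
    and b1 f1 :: "real \<Rightarrow> real \<Rightarrow> real"
    and \<alpha> :: "real \<Rightarrow> real \<Rightarrow> real"
    and H :: "real \<Rightarrow> real measure \<Rightarrow> real \<Rightarrow> real"
    and r l \<kappa> C0 :: real
    and \<xi> :: "'a \<Rightarrow> real"
    and X Y Z :: "real \<Rightarrow> 'a \<Rightarrow> real"
    and Xx Yx Zx :: "real \<Rightarrow> real \<Rightarrow> 'a \<Rightarrow> real"
  assumes space: "brownian_setup M B F0"
    and r: "r > 0"
    and hamiltonian: "is_hamiltonian (separated b0 b1) (separated f0 f1) \<alpha> H"
    and H_cont: "jointly_continuous H"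
    and H_partials: "second_partials_exist H"
    and l: "l > 0"
    and lipschitz_y: "\<And>x x' \<mu> \<mu>' y y'. \<mu> \<in> P2 \<Longrightarrow> \<mu>' \<in> P2 \<Longrightarrow>
          \<bar>partial_y H x \<mu> y - partial_y H x' \<mu>' y'\<bar> \<le> l * (\<bar>x - x'\<bar> + \<bar>y - y'\<bar> + W2 \<mu> \<mu>')"
    and lipschitz_x: "\<And>x x' \<mu> \<mu>' y y'. \<mu> \<in> P2 \<Longrightarrow> \<mu>' \<in> P2 \<Longrightarrow>
          \<bar>partial_x H x \<mu> y - partial_x H x' \<mu>' y'\<bar> \<le> l * (\<bar>x - x'\<bar> + \<bar>y - y'\<bar> + W2 \<mu> \<mu>')"
    and constants: "\<kappa> > 0" "C0 > 0" "C0 + r / 2 < \<kappa>"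
    and monotone: "\<And>x x' \<mu> \<mu>' y y'. \<mu> \<in> P2 \<Longrightarrow> \<mu>' \<in> P2 \<Longrightarrow>
          - (x - x') * (partial_x H x \<mu> y - partial_x H x' \<mu>' y')
            + (y - y') * (partial_y H x \<mu> y - partial_y H x' \<mu>' y')
          \<le> - \<kappa> * (\<bar>x - x'\<bar>\<^sup>2 + \<bar>y - y'\<bar>\<^sup>2) + C0 * (W2 \<mu> \<mu>')\<^sup>2"
    and \<xi>: "\<xi> \<in> L2 M (filt M B F0 0)"
    and sol: "fbsde_solution M B (filt M B F0) r H (law_flow M X) \<xi> X Y Z"
    and sol_x: "\<And>x. fbsde_solution M B (filt M B F0) r H (law_flow M X) (\<lambda>_. x) (Xx x) (Yx x) (Zx x)"
    and versions: "brownian_measurable_family M B Xx" "brownian_measurable_family M B Yx"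
  shows "(AE (t, \<omega>) in time_axis \<Otimes>\<^sub>M M. Xx (\<xi> \<omega>) t \<omega> = X t \<omega>) \<and>
         (AE (t, \<omega>) in time_axis \<Otimes>\<^sub>M M. Yx (\<xi> \<omega>) t \<omega> = Y t \<omega>) \<and>
         (AE \<omega> in M. as_constant M (Yx (\<xi> \<omega>) 0) = Y 0 \<omega> \<and> Yx (\<xi> \<omega>) 0 \<omega> = Y 0 \<omega>)"
proof -
  interpret brownian_setup M B F0 by (rule space)
  interpret mckean_flow M B F0 H "law_flow M X" r l \<kappa>
  proof
    show "0 < r" "0 < l" "0 < \<kappa>" using r l constants by auto
    show "\<bar>partial_y H x \<mu> y - partial_y H x' \<mu>' y'\<bar> \<le> l * (\<bar>x - x'\<bar> + \<bar>y - y'\<bar> + W2 \<mu> \<mu>')"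
      "\<bar>partial_x H x \<mu> y - partial_x H x' \<mu>' y'\<bar> \<le> l * (\<bar>x - x'\<bar> + \<bar>y - y'\<bar> + W2 \<mu> \<mu>')"
      if "\<mu> \<in> P2" "\<mu>' \<in> P2" for x x' \<mu> \<mu>' y y'
      using lipschitz_y lipschitz_x that by auto
    \<comment> \<open>Both points carry the same law, so the Wasserstein term of the monotonicity
      condition is zero.\<close>
    show "- (x - x') * (partial_x H x \<mu> y - partial_x H x' \<mu> y') + (y - y') * (partial_y H x \<mu> y - partial_y H x' \<mu> y')
          \<le> - \<kappa> * (\<bar>x - x'\<bar>\<^sup>2 + \<bar>y - y'\<bar>\<^sup>2)" if "\<mu> \<in> P2" for x x' \<mu> y y'
      using monotone[OF that that, of x x' y y'] W2_self[of \<mu>] that by (simp add: P2_def)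
    show "law_flow M X t \<in> P2" if "0 \<le> t" for t
      by (rule solution_law_flow(1)[OF r l lipschitz_y \<xi> sol that])
    show "\<exists>L. \<forall>s\<in>{0..T}. \<forall>t\<in>{0..T}. W2 (law_flow M X s) (law_flow M X t) \<le> L * sqrt \<bar>s - t\<bar>" if "0 \<le> T" for T
      by (rule solution_law_flow(2)[OF r l lipschitz_y \<xi> sol that])
  qed
  show ?thesis
    using substitution_paths[OF \<xi> sol sol_x versions] substitution_initial_value[OF \<xi> sol sol_x versions] by blast
qed

end
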